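(* Let $1\le q\le \infty$, $1\le r<\infty$, let $j,k\in\mathbb{N}$ with $j<k$, and let $p$ be defined by $$\frac{1}{p}=\frac{j}{kr}+\frac{k-j}{kq}.$$ Then there exists a constant $C$, independent of $u$, such that $$\|\nabla^{j}u\|_{p}\leq C\,\|\nabla^{k}u\|_{r}^{j/k}\,\|u\|_{q}^{1-j/k}\qquad\text{for all } u\in L^q(\mathbb{R}^n)\cap W^{k,r}(\mathbb{R}^n).$$
   Context: Here $n\ge 1$ is the dimension, $\|\cdot\|_m$ denotes the norm of $L^m(\mathbb{R}^n)$ with respect to Lebesgue measure (essential supremum if $m=\infty$), and $1/\infty=0$. $W^{k,r}(\mathbb{R}^n)$ is the usual Sobolev space of functions in $L^r(\mathbb{R}^n)$ whose weak derivatives up to order $k$ belong to $L^r(\mathbb{R}^n)$. $\nabla^j u$ denotes the collection of all weak partial derivatives of $u$ of order $j$, and $\|\nabla^j u\|_p$ is the $L^p$ norm of its pointwise Euclidean length $|\nabla^j u|$. *)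

theory Defs
  imports "HOL-Analysis.Analysis" "HOL-Probability.Essential_Supremum"
begin

section \<open>Lebesgue norms\<close>

text \<open>Powers of extended nonnegative reals for exponents \<open>a \<ge> 0\<close>. In contrast to \<open>0 powr 0 = 0\<close>
  on the reals, the exponent \<open>0\<close> always gives \<open>1\<close>.\<close>

definition epowr :: "ennreal \<Rightarrow> real \<Rightarrow> ennreal"  (infixr \<open>epowr\<close> 80) where
  "x epowr a = (if a = 0 then 1 else if x = top then top else ennreal (enn2real x powr a))"

text \<open>The norm takes the value \<open>top\<close> when it is infinite.\<close>

definition L_norm :: "ennreal \<Rightarrow> (real^'n \<Rightarrow> real) \<Rightarrow> ennreal" where
  "L_norm m f =
     (if m = top then esssup lebesgue (\<lambda>x. ennreal \<bar>f x\<bar>)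
      else (\<integral>\<^sup>+x. ennreal \<bar>f x\<bar> epowr enn2real m \<partial>lebesgue) epowr (1 / enn2real m))"

definition L_space :: "ennreal \<Rightarrow> (real^'n \<Rightarrow> real) set" where
  "L_space m = {f. f \<in> borel_measurable lebesgue \<and> L_norm m f < top}"


section \<open>Test functions\<close>

definition partial :: "'n \<Rightarrow> (real^'n \<Rightarrow> real) \<Rightarrow> real^'n \<Rightarrow> real" where
  "partial i f x = deriv (\<lambda>t. f (x + t *\<^sub>R axis i 1)) 0"

text \<open>A partial derivative of order \<open>j\<close> is indexed by a list of \<open>j\<close> coordinate directions:
  \<open>partials [i\<^sub>1, \<dots>, i\<^sub>j] f\<close> is the derivative of \<open>f\<close> in the directions
  \<open>i\<^sub>1, \<dots>, i\<^sub>j\<close>.\<close>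

definition partials :: "'n list \<Rightarrow> (real^'n \<Rightarrow> real) \<Rightarrow> real^'n \<Rightarrow> real" where
  "partials is f = foldr partial is f"

text \<open>Total differentiability of all iterated partial derivatives makes all of them
  continuous, so this is \<open>C\<^sup>\<infinity>\<close>.\<close>

definition smooth :: "(real^'n \<Rightarrow> real) \<Rightarrow> bool" where
  "smooth f \<longleftrightarrow> (\<forall>is x. partials is f differentiable (at x))"

definition test_function :: "(real^'n \<Rightarrow> real) \<Rightarrow> bool" where
  "test_function \<phi> \<longleftrightarrow> smooth \<phi> \<and> compact (closure {x. \<phi> x \<noteq> 0})"


section \<open>Weak derivatives and Sobolev spaces\<close>

definition locally_integrable :: "(real^'n \<Rightarrow> real) \<Rightarrow> bool" where
  "locally_integrable f \<longleftrightarrow> (\<forall>K. compact K \<longrightarrow> set_integrable lebesgue K f)"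

definition has_weak_partial ::
    "(real^'n \<Rightarrow> real) \<Rightarrow> 'n list \<Rightarrow> (real^'n \<Rightarrow> real) \<Rightarrow> bool" where
  "has_weak_partial u is v \<longleftrightarrow>
     locally_integrable u \<and> locally_integrable v \<and>
     (\<forall>\<phi>. test_function \<phi> \<longrightarrow>
        (LINT x|lebesgue. u x * partials is \<phi> x) =
        (- 1) ^ length is * (LINT x|lebesgue. v x * \<phi> x))"

text \<open>Weak derivatives are unique only up to null sets; a representative is chosen here. All
  notions below are insensitive to the choice.\<close>

definition weak_partial :: "'n list \<Rightarrow> (real^'n \<Rightarrow> real) \<Rightarrow> real^'n \<Rightarrow> real" where
  "weak_partial is u = (SOME v. has_weak_partial u is v)"

definition sobolev :: "nat \<Rightarrow> ennreal \<Rightarrow> (real^'n \<Rightarrow> real) set" where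
  "sobolev k r =
     {u \<in> L_space r. \<forall>is. length is \<le> k \<longrightarrow>
        (\<exists>v. has_weak_partial u is v) \<and> weak_partial is u \<in> L_space r}"

text \<open>The pointwise Euclidean length of \<open>\<nabla>\<^sup>j u\<close>, regarded as the tensor of all
  \<open>j\<close>-fold derivatives: mixed derivatives occur once for every ordering of the directions, as in
  the Hessian matrix for \<open>j = 2\<close>.\<close>

definition nabla_length :: "nat \<Rightarrow> (real^'n \<Rightarrow> real) \<Rightarrow> real^'n \<Rightarrow> real" where
  "nabla_length j u x = sqrt (\<Sum>is | length is = j. (weak_partial is u x)\<^sup>2)"

end

theory Submission
  imports Defs "HOL-Computational_Algebra.Polynomial"
begin

text \<open>The exponents \<open>p\<^sub>m\<close> given by \<open>1/p\<^sub>m = m/(k r) + (k - m)/(k q)\<close> run from \<open>q\<close> to \<open>r\<close> as \<open>m\<close> runs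
from \<open>0\<close> to \<open>k\<close>, and their reciprocals form an arithmetic progression. So the inequality says that the norms
\<open>N\<^sub>m = \<parallel>\<nabla>\<^sup>m u\<parallel>\<close> in \<open>L\<close> to the \<open>p\<^sub>m\<close> form, up to a constant, a logarithmically convex sequence.
For that it is enough to compare three neighbours, \<open>N\<^sub>m \<le> C sqrt (N\<^sub>m\<^sub>-\<^sub>1 N\<^sub>m\<^sub>+\<^sub>1)\<close>
(lemma \<open>log_convex_interpolation\<close>), and such a comparison involves one coordinate direction only:
\<open>\<parallel>\<partial>\<^sub>i v\<parallel>\<^sup>2 \<le> C \<parallel>\<partial>\<^sub>i\<^sup>2 v\<parallel> \<parallel>v\<parallel>\<close>, with reciprocal exponents \<open>(s + t)/2\<close>, \<open>s\<close>, \<open>t\<close>.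

The one-dimensional inequality is Nirenberg's (lemma \<open>one_dimensional_interpolation\<close>). On an interval of length
\<open>\<lambda>\<close> the first derivative is bounded by the mean of \<open>\<bar>v''\<bar>\<close>, scaled by \<open>\<lambda>\<close>, plus the mean of
\<open>\<bar>v\<bar>\<close>, scaled by \<open>1/\<lambda>\<close>. If \<open>\<lambda>\<close> is chosen such that both terms agree, each equals the square
root of their product, and in the resulting bound for the integral of \<open>\<bar>v'\<bar>\<^sup>p\<close> all powers of \<open>\<lambda>\<close>
cancel. Covering the line by such balanced intervals and summing with Hoelder's inequality gives the claim; where no
balance is reached because \<open>v''\<close> dominates already at a prescribed tiny length, an interval of this length contributes a
negligible error. Integration over all lines parallel to an axis and another use of Hoelder's inequality give the
inequality in space (lemma \<open>interpolation_axis\<close>).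

Log-convexity bounds the intermediate norms only if they are finite. Therefore the argument is run for test functions
first. A smooth \<open>w\<close> with derivatives in \<open>L\<^sup>r\<close> is multiplied by \<open>\<psi>(x/R)\<close>; all terms of the
Leibniz rule in which the cutoff is differentiated carry a factor \<open>1/R\<close> and derivatives of \<open>w\<close> of lower order,
which lie in \<open>L\<^sup>r\<close>, so they disappear as \<open>R\<close> grows, and Fatou's lemma gives the inequality for \<open>w\<close>
(lemma \<open>smooth_interpolation\<close>). Finally, \<open>u\<close> is mollified: this commutes with weak derivatives
(lemma \<open>conv_weak_derivative\<close>), increases no norm (lemma \<open>mollify_norm_le\<close>), and bounds that are uniform in the
mollifiers pass to the limit (lemma \<open>mollify_limit\<close>).

Throughout, \<open>L\<^sup>p\<close> is indexed by \<open>s = 1/p\<close>, with \<open>s = 0\<close> for the supremum.\<close>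

section \<open>Hoelder's inequality\<close>

lemma powr_Young:
  fixes a b :: real
  assumes "0 \<le> a" "0 \<le> b" "0 \<le> \<theta>" "\<theta> \<le> 1"
  shows "a powr \<theta> * b powr (1 - \<theta>) \<le> \<theta> * a + (1 - \<theta>) * b"
proof (cases "a = 0 \<or> b = 0")
  case True
  then show ?thesis using assms by auto
next
  case False
  then show ?thesis
    using Youngs_inequality_0[of \<theta> "1 - \<theta>" a b] assms by auto
qed

text \<open>Hoelder's inequality for powers with weights \<open>\<theta>\<close> and \<open>1 - \<theta>\<close>, obtained by integrating Young's inequality for
\<open>f/\<integral>f\<close> and \<open>g/\<integral>g\<close>. The end points \<open>\<theta> = 0, 1\<close> are included: with \<open>0 powr 0 = 0\<close> the factor with
exponent \<open>0\<close> is the indicator of a support.\<close>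

lemma Holder_powr:
  fixes f g :: "'a \<Rightarrow> real"
  assumes f: "integrable M f" and g: "integrable M g"
    and f0: "\<And>x. 0 \<le> f x" and g0: "\<And>x. 0 \<le> g x" and \<theta>: "0 \<le> \<theta>" "\<theta> \<le> 1"
  shows "integrable M (\<lambda>x. f x powr \<theta> * g x powr (1 - \<theta>))"
    and "(\<integral>x. f x powr \<theta> * g x powr (1 - \<theta>) \<partial>M)
           \<le> (\<integral>x. f x \<partial>M) powr \<theta> * (\<integral>x. g x \<partial>M) powr (1 - \<theta>)"
proof -
  have [measurable]: "f \<in> borel_measurable M" "g \<in> borel_measurable M"
    using f g by auto
  show int: "integrable M (\<lambda>x. f x powr \<theta> * g x powr (1 - \<theta>))"
  proof (rule Bochner_Integration.integrable_bound)
    show "integrable M (\<lambda>x. \<theta> * f x + (1 - \<theta>) * g x)" using f g by auto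
    show "AE x in M. norm (f x powr \<theta> * g x powr (1 - \<theta>)) \<le> norm (\<theta> * f x + (1 - \<theta>) * g x)"
      using powr_Young[OF f0 g0 \<theta>] f0 g0 \<theta> by (auto intro!: AE_I2)
  qed measurable
  let ?A = "\<integral>x. f x \<partial>M" and ?B = "\<integral>x. g x \<partial>M"
  have AB: "0 \<le> ?A" "0 \<le> ?B" using f0 g0 by auto
  show "(\<integral>x. f x powr \<theta> * g x powr (1 - \<theta>) \<partial>M) \<le> ?A powr \<theta> * ?B powr (1 - \<theta>)"
  proof (cases "?A = 0 \<or> ?B = 0")
    case True
    then have "(AE x in M. f x = 0) \<or> (AE x in M. g x = 0)"
      using integral_nonneg_eq_0_iff_AE[OF f] integral_nonneg_eq_0_iff_AE[OF g] f0 g0 by auto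
    then have "AE x in M. f x powr \<theta> * g x powr (1 - \<theta>) = 0"
      by (elim disjE) (auto elim: eventually_mono)
    then have "(\<integral>x. f x powr \<theta> * g x powr (1 - \<theta>) \<partial>M) = (\<integral>x. 0 \<partial>M)"
      by (intro integral_cong_AE) auto
    then show ?thesis by simp
  next
    case False
    with AB have pos: "0 < ?A" "0 < ?B" by auto
    have "(\<integral>x. f x powr \<theta> * g x powr (1 - \<theta>) \<partial>M)
       \<le> (\<integral>x. ?A powr \<theta> * ?B powr (1 - \<theta>) * (\<theta> * (f x / ?A) + (1 - \<theta>) * (g x / ?B)) \<partial>M)"
    proof (rule integral_mono[OF int])
      show "integrable M (\<lambda>x. ?A powr \<theta> * ?B powr (1 - \<theta>) * (\<theta> * (f x / ?A) + (1 - \<theta>) * (g x / ?B)))"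
        using f g by auto
      fix x
      have "f x powr \<theta> * g x powr (1 - \<theta>)
          = ?A powr \<theta> * ?B powr (1 - \<theta>) * ((f x / ?A) powr \<theta> * (g x / ?B) powr (1 - \<theta>))"
        using pos f0[of x] g0[of x] by (simp add: powr_divide)
      also have "\<dots> \<le> ?A powr \<theta> * ?B powr (1 - \<theta>) * (\<theta> * (f x / ?A) + (1 - \<theta>) * (g x / ?B))"
        using pos f0[of x] g0[of x] \<theta> by (intro mult_left_mono powr_Young) auto
      finally show "f x powr \<theta> * g x powr (1 - \<theta>) \<le> \<dots>" .
    qed
    also have "\<dots> = ?A powr \<theta> * ?B powr (1 - \<theta>) * (\<theta> * (?A / ?A) + (1 - \<theta>) * (?B / ?B))"
      using f g by simp
    also have "\<dots> = ?A powr \<theta> * ?B powr (1 - \<theta>)"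
      using pos by simp
    finally show ?thesis .
  qed
qed

text \<open>This superadditivity is what allows the estimates on disjoint intervals to be added up.\<close>

lemma powr_sum_Holder:
  fixes a b c d :: real
  assumes "0 \<le> a" "0 \<le> b" "0 \<le> c" "0 \<le> d" "0 \<le> \<theta>" "\<theta> \<le> 1"
  shows "a powr \<theta> * b powr (1 - \<theta>) + c powr \<theta> * d powr (1 - \<theta>) \<le> (a + c) powr \<theta> * (b + d) powr (1 - \<theta>)"
proof -
  let ?f = "\<lambda>x. if x then a else c" and ?g = "\<lambda>x. if x then b else d"
  have "(\<integral>x. ?f x powr \<theta> * ?g x powr (1 - \<theta>) \<partial>count_space UNIV)
     \<le> (\<integral>x. ?f x \<partial>count_space UNIV) powr \<theta> * (\<integral>x. ?g x \<partial>count_space UNIV) powr (1 - \<theta>)"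
    using assms by (intro Holder_powr) (auto intro!: integrable_count_space)
  then show ?thesis
    by (simp add: lebesgue_integral_count_space_finite UNIV_bool add.commute)
qed

section \<open>The interpolation inequality on the line\<close>

lemma exists_value_le_average:
  fixes f :: "real \<Rightarrow> real"
  assumes "a < b" and cont: "continuous_on {a..b} f"
  shows "\<exists>s\<in>{a..b}. f s * (b - a) \<le> integral {a..b} f"
proof -
  obtain s where s: "s \<in> {a..b}" "\<And>y. y \<in> {a..b} \<Longrightarrow> f s \<le> f y"
    using continuous_attains_inf[OF compact_Icc _ cont] \<open>a < b\<close> by auto
  have "integral {a..b} (\<lambda>_. f s) \<le> integral {a..b} f"
    using s by (intro integral_le integrable_continuous_real cont continuous_on_const) auto
  then show ?thesis
    using s(1) \<open>a < b\<close> by (auto simp: mult.commute)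
qed

lemma abs_diff_le_integral_abs_deriv:
  fixes w w' :: "real \<Rightarrow> real"
  assumes d: "\<And>x. (w has_real_derivative w' x) (at x)" and c: "continuous_on UNIV w'"
    and y: "y \<in> {a..b}" and z: "z \<in> {a..b}"
  shows "\<bar>w y - w z\<bar> \<le> integral {a..b} (\<lambda>x. \<bar>w' x\<bar>)"
proof -
  have *: "\<bar>w y - w z\<bar> \<le> integral {a..b} (\<lambda>x. \<bar>w' x\<bar>)" if "a \<le> z" "z \<le> y" "y \<le> b" for y z
  proof -
    have "(w' has_integral (w y - w z)) {z..y}"
      using that d by (intro fundamental_theorem_of_calculus)
        (auto simp: has_real_derivative_iff_has_vector_derivative intro: has_vector_derivative_at_within)
    then have "w y - w z = integral {z..y} w'" by (simp add: integral_unique)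
    also have "\<bar>\<dots>\<bar> \<le> integral {z..y} (\<lambda>x. \<bar>w' x\<bar>)"
    proof -
      have "norm (integral {z..y} w') \<le> integral {z..y} (\<lambda>x. \<bar>w' x\<bar>)"
        by (intro integral_norm_bound_integral integrable_continuous_real continuous_intros
            continuous_on_subset[OF c]) auto
      then show ?thesis by simp
    qed
    also have "\<dots> \<le> integral {a..b} (\<lambda>x. \<bar>w' x\<bar>)"
      using that by (intro integral_subset_le integrable_continuous_real continuous_intros
            continuous_on_subset[OF c]) auto
    finally show ?thesis .
  qed
  show ?thesis
  proof (cases "z \<le> y")
    case True then show ?thesis using *[of z y] y z by auto
  next
    case False
    then have "\<bar>w z - w y\<bar> \<le> integral {a..b} (\<lambda>x. \<bar>w' x\<bar>)" using *[of y z] y z by auto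
    then show ?thesis by (simp add: abs_minus_commute)
  qed
qed

text \<open>The mean value theorem for one point in the first third of the interval and one in the last third, at which \<open>\<bar>v\<bar>\<close> does
not exceed its average, produces a point where \<open>\<bar>v'\<bar>\<close> is at most \<open>18/l\<^sup>2\<close> times the integral of \<open>\<bar>v\<bar>\<close>.
From there the integral of \<open>\<bar>v''\<bar>\<close> controls the variation of \<open>v'\<close>.\<close>

lemma interval_deriv_bound:
  fixes v v' v'' :: "real \<Rightarrow> real"
  assumes d1: "\<And>x. (v has_real_derivative v' x) (at x)"
    and d2: "\<And>x. (v' has_real_derivative v'' x) (at x)"
    and c: "continuous_on UNIV v''" and l: "0 < l" and y: "y \<in> {x..x+l}"
  shows "\<bar>v' y\<bar> \<le> integral {x..x+l} (\<lambda>z. \<bar>v'' z\<bar>) + 18 / l\<^sup>2 * integral {x..x+l} (\<lambda>z. \<bar>v z\<bar>)"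
proof -
  have cv: "continuous_on S v" for S
    using d1 by (meson DERIV_isCont continuous_at_imp_continuous_on)
  let ?I = "integral {x..x+l} (\<lambda>z. \<bar>v z\<bar>)"
  have sub: "integral {a..b} (\<lambda>z. \<bar>v z\<bar>) \<le> ?I" if "x \<le> a" "b \<le> x + l" for a b
    using that by (intro integral_subset_le integrable_continuous_real continuous_intros cv) auto
  have third: "\<exists>s\<in>{a..b}. \<bar>v s\<bar> * (l/3) \<le> ?I" if "x \<le> a" "b \<le> x + l" "b - a = l/3" for a b
  proof -
    have "\<exists>s\<in>{a..b}. \<bar>v s\<bar> * (b - a) \<le> integral {a..b} (\<lambda>z. \<bar>v z\<bar>)"
      using that l by (intro exists_value_le_average continuous_intros cv) auto
    then show ?thesis using sub[OF that(1,2)] that(3) by (metis order_trans)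
  qed
  obtain s where s: "s \<in> {x..x+l/3}" "\<bar>v s\<bar> * (l/3) \<le> ?I"
    using third[of x "x+l/3"] l by auto
  obtain t where t: "t \<in> {x+2*l/3..x+l}" "\<bar>v t\<bar> * (l/3) \<le> ?I"
    using third[of "x+2*l/3" "x+l"] l by (auto simp: field_simps)
  have "s < t" using s t l by auto
  then obtain z where z: "s < z" "z < t" "v t - v s = (t - s) * v' z"
    using MVT2[of s t v v'] d1 by auto
  have "\<bar>v' z\<bar> * (l/3) \<le> \<bar>v' z\<bar> * (t - s)"
    using s t l by (intro mult_left_mono) auto
  also have "\<dots> = \<bar>v t - v s\<bar>" using z \<open>s < t\<close> by (simp add: abs_mult)
  finally have "\<bar>v' z\<bar> * (l/3) * (l/3) \<le> (\<bar>v t\<bar> + \<bar>v s\<bar>) * (l/3)"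
    using l abs_triangle_ineq4[of "v t" "v s"] by (intro mult_right_mono) linarith+
  also have "\<dots> \<le> 2 * ?I" using s(2) t(2) by (simp add: algebra_simps)
  finally have "\<bar>v' z\<bar> * l\<^sup>2 \<le> 18 * ?I" by (simp add: power2_eq_square)
  then have "\<bar>v' z\<bar> \<le> 18 / l\<^sup>2 * ?I" using l by (simp add: field_simps)
  moreover have "\<bar>v' y - v' z\<bar> \<le> integral {x..x+l} (\<lambda>z. \<bar>v'' z\<bar>)"
    using z s t y l by (intro abs_diff_le_integral_abs_deriv d2 c) auto
  ultimately show ?thesis by linarith
qed

text \<open>Hoelder's inequality against the constant \<open>1\<close>; the length of the interval enters with the complementary power.\<close>

lemma interval_Holder:
  fixes f g :: "real \<Rightarrow> real"
  assumes f: "continuous_on UNIV f" "\<And>z. 0 \<le> f z" and g: "continuous_on UNIV g"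
    and le: "\<And>z. g z \<le> K * f z powr s" and s: "0 \<le> s" "s \<le> 1" and "0 \<le> K" and l: "0 < l"
  shows "integral {x..x+l} g \<le> K * (l powr (1 - s) * integral {x..x+l} f powr s)"
proof -
  let ?M = "lebesgue_on {x..x+l}"
  have int: "integrable ?M f" "integrable ?M g" "integrable ?M (\<lambda>_. 1 :: real)"
    using f g by (auto intro!: continuous_imp_integrable_real intro: continuous_on_subset)
  have one: "(\<integral>z. 1 \<partial>?M) = l"
    using lebesgue_integral_eq_integral[OF int(3)] l by simp
  note H = Holder_powr[OF int(1,3) f(2) zero_le_one s]
  have "integral {x..x+l} g = (\<integral>z. g z \<partial>?M)"
    using lebesgue_integral_eq_integral[OF int(2)] by simp
  also have "\<dots> \<le> (\<integral>z. K * (f z powr s * 1 powr (1 - s)) \<partial>?M)"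
    using le by (intro integral_mono int integrable_mult_right H(1)) auto
  also have "\<dots> = K * (\<integral>z. f z powr s * 1 powr (1 - s) \<partial>?M)" by simp
  also have "\<dots> \<le> K * ((\<integral>z. f z \<partial>?M) powr s * (\<integral>z. 1 \<partial>?M) powr (1 - s))"
    by (intro mult_left_mono H \<open>0 \<le> K\<close>)
  also have "(\<integral>z. f z \<partial>?M) = integral {x..x+l} f"
    using lebesgue_integral_eq_integral[OF int(1)] by simp
  finally show ?thesis using one by (simp add: mult.commute)
qed

text \<open>The covering of the line is built from right to left, so all quantities are integrals over half-lines.\<close>

definition tail :: "(real \<Rightarrow> real) \<Rightarrow> real \<Rightarrow> real" where
  "tail f x = (LBINT z:{x..}. f z)"

lemma tail_split:
  assumes f: "integrable lborel f" and c: "continuous_on UNIV f" and "x \<le> y"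
  shows "tail f x = integral {x..y} f + tail f y"
proof -
  have i: "set_integrable lborel A f" if "A \<in> sets borel" for A
    unfolding set_integrable_def using f that by (intro integrable_mult_indicator) auto
  have "tail f x = (\<integral>z. indicat_real {x..y} z *\<^sub>R f z + indicat_real {y..} z *\<^sub>R f z \<partial>lborel)"
    unfolding tail_def set_lebesgue_integral_def
  proof (rule integral_cong_AE)
    show "AE z in lborel. indicat_real {x..} z *\<^sub>R f z = indicat_real {x..y} z *\<^sub>R f z + indicat_real {y..} z *\<^sub>R f z"
      using AE_lborel_singleton[of y] by (rule eventually_mono) (use \<open>x \<le> y\<close> in \<open>auto simp: indicator_def\<close>)
  qed (use f in measurable)
  also have "\<dots> = (LBINT z:{x..y}. f z) + tail f y"
    unfolding tail_def set_lebesgue_integral_def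
    by (intro Bochner_Integration.integral_add) (use i in \<open>auto simp: set_integrable_def\<close>)
  also have "(LBINT z:{x..y}. f z) = integral {x..y} f"
    by (intro set_borel_integral_eq_integral i) auto
  finally show ?thesis .
qed

lemma tail_nonneg: "(\<And>z. 0 \<le> f z) \<Longrightarrow> 0 \<le> tail f x"
  unfolding tail_def by (auto simp: set_lebesgue_integral_def)

lemma tail_eq_0: "(\<And>z. x \<le> z \<Longrightarrow> f z = 0) \<Longrightarrow> tail f x = 0"
  unfolding tail_def set_lebesgue_integral_def by (intro integral_eq_zero_AE) (auto simp: indicator_def)

lemma tail_full: "(\<And>z. z < x \<Longrightarrow> f z = 0) \<Longrightarrow> tail f x = (LBINT z. f z)"
  unfolding tail_def set_lebesgue_integral_def
  by (intro Bochner_Integration.integral_cong) (auto simp: indicator_def)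

lemma integrable_continuous_compact_support:
  fixes f :: "'a::euclidean_space \<Rightarrow> real"
  assumes c: "continuous_on UNIV f" and 0: "\<And>z. R < norm z \<Longrightarrow> f z = 0"
  shows "integrable lborel f"
proof -
  have "integrable lborel (\<lambda>x. indicator (cball 0 R) x *\<^sub>R f x)"
    by (rule borel_integrable_compact) (auto intro: continuous_on_subset[OF c])
  moreover have "(\<lambda>x. indicator (cball 0 R) x *\<^sub>R f x) = f"
    using 0 by (auto simp: indicator_def fun_eq_iff not_le)
  ultimately show ?thesis by simp
qed

text \<open>The relation between the exponents makes \<open>p s/2\<close> and \<open>p t/2\<close> complementary weights for Hoelder's inequality.\<close>

lemma interpolation_weights:
  fixes s t p :: real
  assumes "0 < s" "0 \<le> t" and p: "p = 2 / (s + t)"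
  shows "0 \<le> p * s / 2" "p * s / 2 \<le> 1" "p * t / 2 = 1 - p * s / 2"
proof -
  have "s + t \<noteq> 0" using assms by auto
  then have "p * s / 2 = s / (s + t)" "p * t / 2 = t / (s + t)"
    unfolding p by (simp_all add: field_simps)
  moreover have "0 \<le> s / (s + t)" "s / (s + t) \<le> 1" "t / (s + t) = 1 - s / (s + t)"
    using assms(1,2) by (auto simp: field_simps)
  ultimately show "0 \<le> p * s / 2" "p * s / 2 \<le> 1" "p * t / 2 = 1 - p * s / 2"
    by linarith+
qed

text \<open>If the term with the second derivative dominates, it alone bounds \<open>\<bar>v'\<bar>\<close> on the interval, up to the factor
\<open>19 = 1 + 18\<close>.\<close>

lemma interval_powr_bound:
  fixes v v' v'' \<alpha> \<beta> :: "real \<Rightarrow> real"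
  assumes d1: "\<And>x. (v has_real_derivative v' x) (at x)"
    and d2: "\<And>x. (v' has_real_derivative v'' x) (at x)"
    and c2: "continuous_on UNIV v''"
    and \<alpha>: "continuous_on UNIV \<alpha>" "\<And>x. 0 \<le> \<alpha> x" "\<And>x. \<bar>v'' x\<bar> \<le> \<alpha> x powr s"
    and \<beta>: "continuous_on UNIV \<beta>" "\<And>x. 0 \<le> \<beta> x" "\<And>x. \<bar>v x\<bar> \<le> K * \<beta> x powr t"
    and st: "0 \<le> s" "s \<le> 1" "0 \<le> t" "t \<le> 1" and K: "0 \<le> K" and l: "0 < l" and p: "0 < p"
    and le: "K * (l powr (- 1 - t) * integral {x..x+l} \<beta> powr t) \<le> l powr (1 - s) * integral {x..x+l} \<alpha> powr s"
  shows "integral {x..x+l} (\<lambda>y. \<bar>v' y\<bar> powr p)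
           \<le> l * (19 * (l powr (1 - s) * integral {x..x+l} \<alpha> powr s)) powr p"
proof -
  let ?X = "l powr (1 - s) * integral {x..x+l} \<alpha> powr s"
  have c1: "continuous_on UNIV v'" and c0: "continuous_on UNIV v"
    using d1 d2 by (meson DERIV_isCont continuous_at_imp_continuous_on)+
  have "\<bar>v' y\<bar> \<le> 19 * ?X" if y: "y \<in> {x..x+l}" for y
  proof -
    have 1: "integral {x..x+l} (\<lambda>z. \<bar>v'' z\<bar>) \<le> 1 * ?X"
      using \<alpha> st l by (intro interval_Holder continuous_intros c2) auto
    have "integral {x..x+l} (\<lambda>z. \<bar>v z\<bar>) \<le> K * (l powr (1 - t) * integral {x..x+l} \<beta> powr t)"
      using \<beta> st l K by (intro interval_Holder continuous_intros c0) auto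
    then have "18 / l\<^sup>2 * integral {x..x+l} (\<lambda>z. \<bar>v z\<bar>)
        \<le> 18 / l\<^sup>2 * (K * (l powr (1 - t) * integral {x..x+l} \<beta> powr t))"
      using l by (intro mult_left_mono) auto
    also have "\<dots> = 18 * (K * (l powr (- 1 - t) * integral {x..x+l} \<beta> powr t))"
    proof -
      have "l powr (1 - t) = l\<^sup>2 * l powr (- 1 - t)"
        using l by (simp flip: powr_numeral add: powr_add[symmetric])
      then show ?thesis using l by simp
    qed
    also have "\<dots> \<le> 18 * ?X" using le by simp
    finally show ?thesis
      using interval_deriv_bound[OF d1 d2 c2 l y] 1 by linarith
  qed
  note bound = this
  have "continuous_on UNIV (\<lambda>y. \<bar>v' y\<bar> powr p)"
    by (rule continuous_on_powr') (auto intro: c1 continuous_on_rabs simp: p)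
  then have "(\<lambda>y. \<bar>v' y\<bar> powr p) integrable_on {x..x+l}"
    by (intro integrable_continuous_real) (auto intro: continuous_on_subset)
  then have "integral {x..x+l} (\<lambda>y. \<bar>v' y\<bar> powr p) \<le> integral {x..x+l} (\<lambda>_. (19 * ?X) powr p)"
    by (rule integral_le) (use bound p in \<open>auto intro!: powr_mono2\<close>)
  then show ?thesis using l by simp
qed

text \<open>When both terms agree, their common value is the square root of their product, which scales like \<open>l\<close> to the power
\<open>-(s + t)/2 = -1/p\<close>; its \<open>p\<close>-th power cancels the length of the interval.\<close>

lemma balanced_powr:
  fixes a b K l s t p :: real
  assumes "0 \<le> a" "0 \<le> b" "0 \<le> K" "0 < l" "0 < s" "0 \<le> t" "p = 2 / (s + t)"
    and eq: "K * (l powr (- 1 - t) * b powr t) = l powr (1 - s) * a powr s"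
  shows "l * (19 * (l powr (1 - s) * a powr s)) powr p
           = 19 powr p * K powr (p / 2) * (a powr (p * s / 2) * b powr (p * t / 2))"
proof -
  let ?X = "l powr (1 - s) * a powr s"
  have X0: "0 \<le> ?X" by simp
  have "?X powr p = (?X * ?X) powr (p / 2)"
  proof -
    have "y powr p = (y * y) powr (p / 2)" if "0 \<le> y" for y :: real
      using that by (subst powr_mult) (auto simp flip: powr_add)
    then show ?thesis using X0 by blast
  qed
  also have "?X * ?X = K * (l powr (- (s + t)) * (a powr s * b powr t))"
    using assms(4) by (subst eq[symmetric]) (simp add: powr_add[symmetric] algebra_simps flip: powr_add)
  also have "\<dots> powr (p / 2) = K powr (p / 2) * (l powr (- 1) * (a powr (p * s / 2) * b powr (p * t / 2)))"
  proof -
    have e: "s + t \<noteq> 0" using assms by auto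
    have "- (s + t) * (p / 2) = - 1" "s * (p / 2) = p * s / 2" "t * (p / 2) = p * t / 2"
      using assms(7) e by (simp_all add: field_simps)
    then show ?thesis by (simp only: powr_mult powr_powr)
  qed
  finally show ?thesis using assms by (simp add: powr_mult powr_minus)
qed

text \<open>The functions \<open>\<alpha>\<close> and \<open>\<beta>\<close> stand for \<open>\<bar>v''\<bar>\<close> and \<open>\<bar>v\<bar>\<close> to the powers \<open>1/s\<close> and
\<open>1/t\<close>. Separating them from \<open>v\<close> treats \<open>t = 0\<close> together with the other exponents: then \<open>\<beta> powr 0\<close>
is the indicator of the support of \<open>\<beta>\<close>, and the third assumption on \<open>\<beta>\<close> says that
\<open>\<bar>v\<bar> \<le> K\<close> and that \<open>v\<close> vanishes where \<open>\<beta>\<close> does.\<close>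

lemma one_dimensional_interpolation:
  fixes v v' v'' \<alpha> \<beta> :: "real \<Rightarrow> real"
  assumes d1: "\<And>x. (v has_real_derivative v' x) (at x)"
    and d2: "\<And>x. (v' has_real_derivative v'' x) (at x)"
    and c2: "continuous_on UNIV v''"
    and \<alpha>: "continuous_on UNIV \<alpha>" "\<And>x. 0 \<le> \<alpha> x" "\<And>x. \<bar>v'' x\<bar> \<le> \<alpha> x powr s"
    and \<beta>: "continuous_on UNIV \<beta>" "\<And>x. 0 \<le> \<beta> x" "\<And>x. \<bar>v x\<bar> \<le> K * \<beta> x powr t"
    and supp: "\<And>x. R \<le> \<bar>x\<bar> \<Longrightarrow> v' x = 0 \<and> \<alpha> x = 0 \<and> \<beta> x = 0"
    and st: "0 < s" "s \<le> 1" "0 \<le> t" "t \<le> 1" and K: "0 \<le> K" and p: "p = 2 / (s + t)"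
  shows "(\<integral>x. \<bar>v' x\<bar> powr p \<partial>lborel)
           \<le> 19 powr p * K powr (p / 2) * ((\<integral>x. \<alpha> x \<partial>lborel) powr (p * s / 2) * (\<integral>x. \<beta> x \<partial>lborel) powr (p * t / 2))"
proof -
  have p0: "0 < p" using st p by simp
  define C where "C = 19 powr p * K powr (p / 2)"
  define f where "f = (\<lambda>x. \<bar>v' x\<bar> powr p)"
  have \<theta>: "0 \<le> p * s / 2" "p * s / 2 \<le> 1" "p * t / 2 = 1 - p * s / 2"
    using interpolation_weights[OF st(1,3) p] .
  have C0: "0 \<le> C" by (simp add: C_def)
  have c1: "continuous_on UNIV v'"
    using d2 by (meson DERIV_isCont continuous_at_imp_continuous_on)
  have cf: "continuous_on UNIV f" unfolding f_def
    by (rule continuous_on_powr') (auto intro: c1 continuous_on_rabs simp: p0)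
  define R' where "R' = max R 1"
  have supp: "v' x = 0" "\<alpha> x = 0" "\<beta> x = 0" if "R' \<le> \<bar>x\<bar>" for x
    using supp[of x] that by (auto simp: R'_def)
  have R'0: "0 < R'" by (simp add: R'_def)
  have int: "integrable lborel \<alpha>" "integrable lborel \<beta>" "integrable lborel f"
    by (rule integrable_continuous_compact_support[of _ R']; use \<alpha> \<beta> cf supp in \<open>auto simp: f_def\<close>)+
  obtain M where M: "0 \<le> M" "\<And>x. \<alpha> x \<le> M"
  proof -
    have "compact (\<alpha> ` {-R'..R'})"
      by (intro compact_continuous_image continuous_on_subset[OF \<alpha>(1)]) auto
    then obtain M where M: "\<forall>y\<in>\<alpha> ` {-R'..R'}. norm y \<le> M"
      using compact_imp_bounded bounded_iff by metis
    have "\<alpha> x \<le> max M 0" for x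
    proof (cases "R' \<le> \<bar>x\<bar>")
      case False
      then have "x \<in> {-R'..R'}" by auto
      then have "norm (\<alpha> x) \<le> M" using M by blast
      then show ?thesis by simp
    qed (simp add: supp)
    then show ?thesis using that[of "max M 0"] by auto
  qed
  note \<alpha>int = integrable_continuous_real[OF continuous_on_subset[OF \<alpha>(1) subset_UNIV]]
  note \<beta>int = integrable_continuous_real[OF continuous_on_subset[OF \<beta>(1) subset_UNIV]]
  have \<alpha>nn: "0 \<le> integral {x..y} \<alpha>" for x y by (rule integral_nonneg[OF \<alpha>int]) (use \<alpha> in auto)
  have \<beta>nn: "0 \<le> integral {x..y} \<beta>" for x y by (rule integral_nonneg[OF \<beta>int]) (use \<beta> in auto)
  \<comment> \<open>Backward induction from the right end \<open>R'\<close> of the support; \<open>n\<close> bounds the number of intervals of the minimal length \<open>l\<close> that are needed.\<close>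
  have key: "tail f x \<le> C * (tail \<alpha> x powr (p * s / 2) * tail \<beta> x powr (p * t / 2))
               + n * (l * (19 * (l * M powr s)) powr p)"
    if l: "0 < l" and "R' - n * l \<le> x" for l x :: real and n :: nat
    using that(2)
  proof (induction n arbitrary: x)
    case 0
    then have "tail f x = 0" using R'0 by (intro tail_eq_0) (simp add: f_def supp)
    then show ?case using C0 by simp
  next
    case (Suc n)
    let ?\<kappa> = "l * (19 * (l * M powr s)) powr p"
    let ?a = "\<lambda>m. integral {x..x+m} \<alpha>" and ?b = "\<lambda>m. integral {x..x+m} \<beta>"
    let ?A = "\<lambda>m. m powr (1 - s) * ?a m powr s" and ?B = "\<lambda>m. K * (m powr (- 1 - t) * ?b m powr t)"
    have \<kappa>0: "0 \<le> ?\<kappa>" using l by simp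
    note IPB = interval_powr_bound[OF d1 d2 c2 \<alpha> \<beta> less_imp_le[OF st(1)] st(2-4) K _ p0, folded f_def]
    note \<alpha>split = tail_split[OF int(1) \<alpha>(1)] and \<beta>split = tail_split[OF int(2) \<beta>(1)]
      and fsplit = tail_split[OF int(3) cf]
    have stepIH: "tail f (x + m) \<le> C * (tail \<alpha> (x + m) powr (p * s / 2) * tail \<beta> (x + m) powr (p * t / 2)) + n * ?\<kappa>"
      if "l \<le> m" for m
      using that Suc.prems by (intro Suc.IH) (auto simp: algebra_simps)
    show ?case
    proof (cases "?B l \<le> ?A l")
      case True
      \<comment> \<open>The second derivative dominates at the minimal length: the short interval is accepted at the price of one error term.\<close>
      have "?a l \<le> integral {x..x+l} (\<lambda>_. M)"
        using M by (intro integral_le \<alpha>int) auto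
      then have "?a l \<le> l * M" using l by simp
      then have "?A l \<le> l powr (1 - s) * (l * M) powr s"
        using st \<alpha>nn by (intro mult_left_mono powr_mono2) auto
      also have "\<dots> = l * M powr s"
        using l M by (simp add: powr_mult powr_diff)
      finally have "integral {x..x+l} f \<le> ?\<kappa>"
        using IPB[OF l True] l p0
        by (elim order_trans) (intro mult_left_mono powr_mono2, auto)
      moreover have "C * (tail \<alpha> (x + l) powr (p * s / 2) * tail \<beta> (x + l) powr (p * t / 2))
          \<le> C * (tail \<alpha> x powr (p * s / 2) * tail \<beta> x powr (p * t / 2))"
        using \<alpha>split[of x "x+l"] \<beta>split[of x "x+l"] l \<theta> C0 \<alpha>nn \<beta>nn p0 st
        by (intro mult_left_mono mult_mono powr_mono2 tail_nonneg \<alpha> \<beta>) auto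
      ultimately show ?thesis
        using fsplit[of x "x+l"] stepIH[of l] l by (simp add: algebra_simps)
    next
      case notbal: False
      show ?thesis
      proof (cases "tail \<alpha> x = 0")
        case True
        \<comment> \<open>The second derivative vanishes to the right of \<open>x\<close>, and so does \<open>v'\<close>.\<close>
        have "v' y = 0" if "x \<le> y" for y
        proof -
          obtain m where m: "1 \<le> m" "R' - x \<le> m" "y - x \<le> m"
            by (rule that[of "max 1 (max (R' - x) (y - x))"]) auto
          have "?a m = 0"
            using \<alpha>split[of x "x + m"] True \<alpha>nn[of x "x+m"] tail_nonneg[of \<alpha> "x + m", OF \<alpha>(2)] m by simp
          then have "integral {x..x+m} (\<lambda>z. \<bar>v'' z\<bar>) \<le> 0"
            using interval_Holder[of \<alpha> "\<lambda>z. \<bar>v'' z\<bar>" 1 s m x] \<alpha> st m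
            by (simp add: continuous_on_rabs c2)
          moreover have "\<bar>v' y - v' (x + m)\<bar> \<le> integral {x..x+m} (\<lambda>z. \<bar>v'' z\<bar>)"
            using that m by (intro abs_diff_le_integral_abs_deriv d2 c2) auto
          moreover have "v' (x + m) = 0" using R'0 m by (intro supp) auto
          ultimately show ?thesis by simp
        qed
        then have "tail f x = 0" by (intro tail_eq_0) (simp add: f_def)
        then show ?thesis using C0 \<kappa>0 by (simp add: True)
      next
        case False
        then have Tpos: "0 < tail \<alpha> x" using tail_nonneg[of \<alpha> x, OF \<alpha>(2)] by simp
        \<comment> \<open>At a length \<open>m\<close> beyond the support the integrals no longer grow, and the powers of \<open>m\<close> favour the second derivative.\<close>
        define m where "m = max (max 1 l) (max (R' - x) (K * tail \<beta> x powr t / tail \<alpha> x powr s))"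
        have m: "1 \<le> m" "l \<le> m" "R' \<le> x + m" "K * tail \<beta> x powr t / tail \<alpha> x powr s \<le> m"
          by (auto simp: m_def)
        have am: "?a m = tail \<alpha> x" and bm: "?b m = tail \<beta> x"
          using \<alpha>split[of x "x+m"] \<beta>split[of x "x+m"] m R'0 tail_eq_0[of "x+m" \<alpha>] tail_eq_0[of "x+m" \<beta>] supp
          by auto
        have balm: "?B m \<le> ?A m"
        proof -
          have "K * tail \<beta> x powr t \<le> m * tail \<alpha> x powr s"
            using m(4) Tpos by (simp add: field_simps)
          also have "m powr 1 \<le> m powr (2 - s + t)" using m st by (intro powr_mono) auto
          then have "m * tail \<alpha> x powr s \<le> m powr (2 - s + t) * tail \<alpha> x powr s"
            using m by (intro mult_right_mono) auto
          finally have "m powr (- 1 - t) * (K * tail \<beta> x powr t)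
              \<le> m powr (- 1 - t) * (m powr (2 - s + t) * tail \<alpha> x powr s)"
            by (intro mult_left_mono) auto
          also have "\<dots> = m powr (1 - s) * tail \<alpha> x powr s"
            by (simp add: powr_add[symmetric] flip: mult.assoc)
          finally show ?thesis unfolding am bm by (simp add: mult_ac)
        qed
        have bpos: "0 < ?b m'" if "l \<le> m'" for m'
        proof -
          have "?B l > 0" using notbal by (smt (verit) mult_nonneg_nonneg powr_ge_zero)
          then have "?b l \<noteq> 0" by auto
          then have "0 < ?b l" using \<beta>nn[of x "x+l"] by simp
          also have "?b l \<le> ?b m'" using that l \<beta> by (intro integral_subset_le \<beta>int) auto
          finally show ?thesis .
        qed
        have conta: "continuous_on {l..m} ?a" and contb: "continuous_on {l..m} ?b"
        proof -
          have "continuous_on {l..m} (\<lambda>q. integral {x..x+q} g)" if "g integrable_on {x..x+m}" for g :: "real \<Rightarrow> real"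
          proof -
            have "continuous_on {x..x+m} (\<lambda>y. integral {x..y} g)"
              by (rule indefinite_integral_continuous_1[OF that])
            then have "continuous_on {l..m} ((\<lambda>y. integral {x..y} g) \<circ> (\<lambda>q. x + q))"
              using l by (intro continuous_on_compose continuous_intros) (auto elim!: continuous_on_subset)
            then show ?thesis by (simp add: o_def)
          qed
          then show "continuous_on {l..m} ?a" "continuous_on {l..m} ?b" using \<alpha>int \<beta>int by auto
        qed
        \<comment> \<open>Hence the two terms balance at some length between \<open>l\<close> and \<open>m\<close>.\<close>
        have "\<exists>q\<ge>l. q \<le> m \<and> ?A q - ?B q = 0"
        proof (rule IVT')
          show "?A l - ?B l \<le> 0" "0 \<le> ?A m - ?B m" "l \<le> m" using notbal balm m by auto
          have pw: "continuous_on {l..m} (\<lambda>q::real. q powr e)" for e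
            using l by (intro continuous_on_powr' continuous_on_id continuous_on_const) auto
          have pa: "continuous_on {l..m} (\<lambda>q. ?a q powr s)"
            using st \<alpha>nn by (intro continuous_on_powr' conta continuous_on_const) auto
          have "?b q \<noteq> 0" if "q \<in> {l..m}" for q
            using bpos[of q] that by simp
          then have pb: "continuous_on {l..m} (\<lambda>q. ?b q powr t)"
            using \<beta>nn by (intro continuous_on_powr' contb continuous_on_const) blast
          show "continuous_on {l..m} (\<lambda>q. ?A q - ?B q)"
            by (intro continuous_on_diff continuous_on_mult continuous_on_const pw pa pb)
        qed
        then obtain q where q: "l \<le> q" "?B q = ?A q" by auto
        have q0: "0 < q" using q l by simp
        have "integral {x..x+q} f \<le> C * (?a q powr (p * s / 2) * ?b q powr (p * t / 2))"
          using IPB[OF q0, of x] q(2) balanced_powr[OF \<alpha>nn \<beta>nn K q0 st(1,3) p q(2)]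
          by (simp add: C_def)
        then have "tail f x \<le> C * (?a q powr (p * s / 2) * ?b q powr (p * t / 2)
             + tail \<alpha> (x + q) powr (p * s / 2) * tail \<beta> (x + q) powr (p * t / 2)) + n * ?\<kappa>"
          using fsplit[of x "x+q"] stepIH[OF q(1)] q0 by (simp add: algebra_simps)
        also have "\<dots> \<le> C * ((?a q + tail \<alpha> (x + q)) powr (p * s / 2) * (?b q + tail \<beta> (x + q)) powr (p * t / 2)) + n * ?\<kappa>"
          unfolding \<theta>(3) using \<theta>
          by (intro add_right_mono mult_left_mono C0 powr_sum_Holder \<alpha>nn \<beta>nn tail_nonneg \<alpha> \<beta>) auto
        also have "\<dots> = C * (tail \<alpha> x powr (p * s / 2) * tail \<beta> x powr (p * t / 2)) + n * ?\<kappa>"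
          using \<alpha>split[of x "x+q"] \<beta>split[of x "x+q"] q0 by simp
        also have "\<dots> \<le> C * (tail \<alpha> x powr (p * s / 2) * tail \<beta> x powr (p * t / 2)) + Suc n * ?\<kappa>"
          using \<kappa>0 by (intro add_left_mono mult_right_mono) auto
        finally show ?thesis .
      qed
    qed
  qed
  let ?L = "2 * R'"
  have full: "tail g (-R') = (LBINT x. g x)" if "\<And>x. R' \<le> \<bar>x\<bar> \<Longrightarrow> g x = 0" for g
    using that by (intro tail_full) auto
  let ?rhs = "C * ((LBINT x. \<alpha> x) powr (p * s / 2) * (LBINT x. \<beta> x) powr (p * t / 2))"
  \<comment> \<open>The support is covered by \<open>Suc n\<close> intervals of the minimal length \<open>?L / Suc n\<close>; the total error tends to \<open>0\<close>.\<close>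
  have bound: "(LBINT x. f x) \<le> ?rhs + ?L * (19 * (?L / Suc n * M powr s)) powr p" for n
    using key[of "?L / Suc n" "Suc n" "-R'"] R'0 full[of f] full[of \<alpha>] full[of \<beta>] supp by (simp add: f_def)
  have "(\<lambda>n. ?L * inverse (real (Suc n))) \<longlonglongrightarrow> ?L * 0"
    by (intro tendsto_mult tendsto_const LIMSEQ_inverse_real_of_nat)
  then have "(\<lambda>n. 19 * (?L / Suc n * M powr s)) \<longlonglongrightarrow> 19 * (?L * 0 * M powr s)"
    unfolding divide_inverse by (rule tendsto_mult[OF tendsto_const tendsto_mult[OF _ tendsto_const]])
  then have "(\<lambda>n. (19 * (?L / Suc n * M powr s)) powr p) \<longlonglongrightarrow> 0"
    using R'0 p0 by (intro tendsto_zero_powrI[OF _ tendsto_const]) (auto intro!: always_eventually)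
  then have "(\<lambda>n. ?rhs + ?L * (19 * (?L / Suc n * M powr s)) powr p) \<longlonglongrightarrow> ?rhs + ?L * 0"
    by (intro tendsto_add tendsto_mult tendsto_const)
  then have "(LBINT x. f x) \<le> ?rhs + ?L * 0"
    by (rule LIMSEQ_le_const) (use bound in auto)
  then show ?thesis by (simp add: f_def C_def)
qed

section \<open>Logarithmic convexity\<close>

text \<open>The increments are increasing, so the first \<open>j\<close> of them average at most \<open>d j\<close> and the remaining ones at least \<open>d j\<close>.\<close>

lemma discrete_convex_interpolation:
  fixes b :: "nat \<Rightarrow> real"
  assumes conv: "\<And>i. 0 < i \<Longrightarrow> i < k \<Longrightarrow> 2 * b i \<le> b (i - 1) + b (i + 1)" and j: "j \<le> k"
  shows "real k * b j \<le> real (k - j) * b 0 + real j * b k"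
proof -
  define d where "d i = b (Suc i) - b i" for i
  have step: "d i \<le> d (Suc i)" if "Suc i < k" for i
    using conv[of "Suc i"] that by (simp add: d_def)
  have mono: "d i \<le> d i'" if "i \<le> i'" "i' < k" for i i'
    using that by (induction rule: dec_induct) (use step in fastforce)+
  show ?thesis
  proof (cases "j = 0 \<or> j = k")
    case True
    then show ?thesis by auto
  next
    case False
    then have j: "0 < j" "j < k" using j by auto
    have "b j - b 0 = (\<Sum>i<j. d i)" unfolding d_def by (simp add: sum_lessThan_telescope)
    also have "\<dots> \<le> of_nat (card {..<j}) * d j"
      by (rule sum_bounded_above) (use j in \<open>auto intro: mono\<close>)
    finally have 1: "b j - b 0 \<le> j * d j" by simp
    have "of_nat (card {j..<k}) * d j \<le> (\<Sum>i\<in>{j..<k}. d i)"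
      by (rule sum_bounded_below) (auto intro: mono)
    also have "\<dots> = b k - b j" unfolding d_def using j by (simp add: sum_Suc_diff')
    finally have 2: "real (k - j) * d j \<le> b k - b j" by simp
    have "real (k - j) * (b j - b 0) \<le> real (k - j) * (j * d j)"
      by (intro mult_left_mono 1) auto
    also have "\<dots> \<le> j * (b k - b j)"
      using mult_left_mono[OF 2, of "real j"] by (simp add: mult_ac)
    finally show ?thesis using j by (simp add: of_nat_diff algebra_simps)
  qed
qed

text \<open>The constant \<open>C\<close> is absorbed by adding \<open>ln C\<close> times \<open>i\<^sup>2\<close> to \<open>ln (N i)\<close>, since the second difference of
\<open>i\<^sup>2\<close> is \<open>2\<close>. Logarithms are available because one vanishing term forces all terms strictly between the ends to vanish.\<close>

lemma log_convex_interpolation: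
  fixes N :: "nat \<Rightarrow> real"
  assumes nonneg: "\<And>i. 0 \<le> N i" and C: "1 \<le> C"
    and conv: "\<And>i. 0 < i \<Longrightarrow> i < k \<Longrightarrow> N i \<le> C * sqrt (N (i - 1) * N (i + 1))"
    and j: "0 < j" "j < k"
  shows "N j \<le> C ^ (k * j) * (N k powr (real j / real k) * N 0 powr (1 - real j / real k))"
proof (cases "N j = 0")
  case True
  then show ?thesis using C by simp
next
  case False
  have nbr: "N (i - 1) \<noteq> 0 \<and> N (i + 1) \<noteq> 0" if "N i \<noteq> 0" "0 < i" "i < k" for i
  proof (rule ccontr)
    assume "\<not> ?thesis"
    then have "N i \<le> 0" using conv[of i] that by auto
    then show False using nonneg[of i] that by simp
  qed
  have up: "N i \<noteq> 0" if "j \<le> i" "i \<le> k" for i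
    using that
  proof (induction rule: dec_induct)
    case base
    show ?case by fact
  next
    case (step n)
    then show ?case using nbr[of n] j by auto
  qed
  have down: "N i \<noteq> 0" if "i \<le> j" for i
    using that
  proof (induction rule: inc_induct)
    case base
    show ?case by fact
  next
    case (step n)
    then show ?case using nbr[of "Suc n"] j by auto
  qed
  have pos: "0 < N i" if "i \<le> k" for i
    using up down nonneg[of i] that by (cases "i \<le> j") (auto simp: order_less_le)
  define b where "b i = ln (N i) + ln C * (real i)\<^sup>2" for i
  have "real k * b j \<le> real (k - j) * b 0 + real j * b k"
  proof (rule discrete_convex_interpolation)
    fix i assume i: "0 < i" "i < k"
    have P: "0 < N (i - 1)" "0 < N i" "0 < N (i + 1)" using i by (auto intro: pos)
    have "ln (N i) \<le> ln (C * sqrt (N (i - 1) * N (i + 1)))"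
      using P conv[OF i] C by (subst ln_le_cancel_iff) auto
    also have "\<dots> = ln C + (ln (N (i - 1)) + ln (N (i + 1))) / 2"
      using P C by (simp add: ln_mult ln_sqrt)
    finally have "2 * ln (N i) \<le> 2 * ln C + ln (N (i - 1)) + ln (N (i + 1))"
      by (simp only: field_simps)
    moreover have "real (i - 1) = real i - 1" using i by (simp add: of_nat_diff)
    then have "ln C * (real (i - 1))\<^sup>2 + ln C * (real (i + 1))\<^sup>2 = 2 * (ln C * (real i)\<^sup>2) + 2 * ln C"
      by (simp add: power2_eq_square algebra_simps)
    ultimately show "2 * b i \<le> b (i - 1) + b (i + 1)"
      unfolding b_def by (simp add: algebra_simps)
  qed (use j in auto)
  moreover have "real k * ((1 - real j / real k) * b 0 + real j / real k * b k) = real (k - j) * b 0 + real j * b k"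
    using j by (simp add: of_nat_diff distrib_left right_diff_distrib)
  ultimately have "b j \<le> (1 - real j / real k) * b 0 + real j / real k * b k"
    using j mult_left_le_imp_le[of "real k" "b j"] by (metis of_nat_0_less_iff order_less_trans)
  moreover have "real j / real k * (ln C * (real k)\<^sup>2) = ln C * real (k * j)"
    using j by (simp add: power2_eq_square)
  ultimately have "ln (N j) \<le> (1 - real j / real k) * ln (N 0) + real j / real k * ln (N k)
      + ln C * (real (k * j) - real (j * j))"
    unfolding b_def by (simp add: power2_eq_square right_diff_distrib distrib_left)
  moreover have "ln C * (real (k * j) - real (j * j)) \<le> ln C * real (k * j)"
    using C by (intro mult_left_mono) auto
  ultimately have "ln (N j) \<le> (1 - real j / real k) * ln (N 0) + real j / real k * ln (N k) + real (k * j) * ln C"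
    by (simp add: mult_ac)
  then have "exp (ln (N j)) \<le> exp ((1 - real j / real k) * ln (N 0) + real j / real k * ln (N k) + real (k * j) * ln C)"
    by simp
  also have "\<dots> = N 0 powr (1 - real j / real k) * N k powr (real j / real k) * C powr real (k * j)"
    using pos[of 0] pos[of k] C by (simp add: exp_add powr_def)
  also have "C powr real (k * j) = C ^ (k * j)" using C by (intro powr_realpow) auto
  finally show ?thesis using pos[of j] j by (simp add: mult_ac)
qed

section \<open>Smooth functions and test functions\<close>

lemma partial_eq_derivative:
  fixes f :: "real^'n \<Rightarrow> real"
  assumes "(f has_derivative D) (at x)"
  shows "partial i f x = D (axis i 1)"
proof -
  interpret D: bounded_linear D by (rule has_derivative_bounded_linear[OF assms])
  have "((\<lambda>t. f (x + t *\<^sub>R axis i 1)) has_derivative (\<lambda>t. D (t *\<^sub>R axis i 1))) (at 0)"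
    by (rule has_derivative_compose[of "\<lambda>t. x + t *\<^sub>R axis i 1" _ 0 UNIV f D, simplified])
      (auto intro!: derivative_eq_intros assms)
  then have "((\<lambda>t. f (x + t *\<^sub>R axis i 1)) has_real_derivative D (axis i 1)) (at 0)"
    by (simp add: has_field_derivative_def D.scaleR mult.commute[of _ "D _"])
  then show ?thesis unfolding partial_def by (rule DERIV_imp_deriv)
qed

lemma has_derivative_partials:
  fixes f :: "real^'n \<Rightarrow> real"
  assumes "f differentiable (at x)"
  shows "(f has_derivative (\<lambda>h. \<Sum>i\<in>UNIV. h $ i * partial i f x)) (at x)"
proof -
  obtain D where D: "(f has_derivative D) (at x)" using assms by (auto simp: differentiable_def)
  interpret D: bounded_linear D by (rule has_derivative_bounded_linear[OF D])
  have "D = (\<lambda>h. \<Sum>i\<in>UNIV. h $ i * partial i f x)"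
  proof
    fix h
    have "D h = D (\<Sum>i\<in>UNIV. (h $ i) *\<^sub>R axis i 1)"
      by (simp add: basis_expansion flip: scalar_mult_eq_scaleR)
    then show "D h = (\<Sum>i\<in>UNIV. h $ i * partial i f x)"
      by (simp add: D.sum D.scaleR partial_eq_derivative[OF D])
  qed
  then show ?thesis using D by simp
qed

lemma partial_line_derivative:
  fixes f :: "real^'n \<Rightarrow> real"
  assumes "\<And>x. f differentiable (at x)"
  shows "((\<lambda>t. f (x + t *\<^sub>R axis i 1)) has_real_derivative partial i f (x + t *\<^sub>R axis i 1)) (at t)"
proof -
  let ?y = "x + t *\<^sub>R axis i 1"
  obtain D where D: "(f has_derivative D) (at ?y)" using assms by (auto simp: differentiable_def)
  interpret D: bounded_linear D by (rule has_derivative_bounded_linear[OF D])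
  have "((\<lambda>t. f (x + t *\<^sub>R axis i 1)) has_derivative (\<lambda>t. D (t *\<^sub>R axis i 1))) (at t)"
    by (rule has_derivative_compose[of "\<lambda>t. x + t *\<^sub>R axis i 1" _ t UNIV f D, simplified])
      (auto intro!: derivative_eq_intros D)
  then show ?thesis
    by (simp add: has_field_derivative_def D.scaleR mult.commute[of _ "D _"] partial_eq_derivative[OF D])
qed

lemma partials_simps [simp]:
  "partials [] f = f"
  "partials (i # is) f = partial i (partials is f)"
  by (simp_all add: partials_def)

lemma partials_append: "partials (is @ js) f = partials is (partials js f)"
  by (simp add: partials_def)

lemma smooth_partials: "smooth f \<Longrightarrow> smooth (partials is f)"
  by (simp add: smooth_def flip: partials_append)

lemma smooth_partial: "smooth f \<Longrightarrow> smooth (partial i f)"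
  using smooth_partials[of f "[i]"] by simp

lemma smooth_differentiable: "smooth f \<Longrightarrow> f differentiable (at x)"
  unfolding smooth_def by (metis partials_simps(1))

lemma smooth_continuous: "smooth f \<Longrightarrow> continuous_on S f"
  by (meson continuous_at_imp_continuous_on differentiable_imp_continuous_within smooth_differentiable)

text \<open>Smoothness is a coinductive notion: it holds for the members of any class of differentiable functions that is closed under
partial derivatives.\<close>

lemma smooth_coinduct:
  assumes "P f"
    and "\<And>g x. P g \<Longrightarrow> g differentiable (at x)" and "\<And>g i. P g \<Longrightarrow> P (partial i g)"
  shows "smooth f"
proof -
  have "P (partials is f)" for "is" by (induction "is") (auto intro: assms)
  then show ?thesis using assms(2) by (auto simp: smooth_def)
qed

text \<open>The class of functions \<open>p(1/y) exp(-1/y)\<close>, extended by \<open>0\<close>, contains the standard smooth function that vanishes on the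
left half-line and is closed under differentiation.\<close>

definition exp_bump :: "real poly \<Rightarrow> real \<Rightarrow> real" where
  "exp_bump p y = (if 0 < y then poly p (1 / y) * exp (- (1 / y)) else 0)"

lemma poly_exp_tendsto_0: "((\<lambda>z::real. poly p z * exp (- z)) \<longlongrightarrow> 0) at_top"
proof -
  have "((\<lambda>z::real. \<Sum>i\<le>degree p. coeff p i * (z ^ i / exp z)) \<longlongrightarrow> (\<Sum>i\<le>degree p. coeff p i * 0)) at_top"
    by (intro tendsto_intros tendsto_power_div_exp_0)
  then show ?thesis
    by (simp add: poly_altdef sum_distrib_right exp_minus divide_inverse mult.assoc)
qed

text \<open>For \<open>y > 0\<close> this is the chain rule with \<open>z = 1/y\<close>, \<open>dz/dy = -z\<^sup>2\<close>. At \<open>0\<close> the difference quotient is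
\<open>z p(z) exp(-z)\<close>, which tends to \<open>0\<close> as \<open>z\<close> tends to infinity.\<close>

lemma exp_bump_derivative:
  "(exp_bump p has_real_derivative exp_bump ([:0, 0, 1:] * (p - pderiv p)) y) (at y)"
proof -
  consider "0 < y" | "y < 0" | "y = 0" by linarith
  then show ?thesis
  proof cases
    case 1
    have "((\<lambda>y. poly p (1 / y) * exp (- (1 / y))) has_real_derivative
        exp_bump ([:0, 0, 1:] * (p - pderiv p)) y) (at y)"
      using 1 unfolding exp_bump_def
      by (auto intro!: derivative_eq_intros DERIV_chain2[OF poly_DERIV] simp: field_simps power2_eq_square)
    then show ?thesis
      by (rule has_field_derivative_transform_within_open[of _ _ _ "{0<..}"])
        (use 1 in \<open>auto simp: exp_bump_def\<close>)
  next
    case 2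
    have "((\<lambda>y. 0) has_real_derivative exp_bump ([:0, 0, 1:] * (p - pderiv p)) y) (at y)"
      using 2 by (simp add: exp_bump_def)
    then show ?thesis
      by (rule has_field_derivative_transform_within_open[of _ _ _ "{..<0}"])
        (use 2 in \<open>auto simp: exp_bump_def\<close>)
  next
    case 3
    have "((\<lambda>h. (exp_bump p (0 + h) - exp_bump p 0) / h) \<longlongrightarrow> 0) (at 0)"
      unfolding filterlim_at_split
    proof
      have "eventually (\<lambda>h. (exp_bump p (0 + h) - exp_bump p 0) / h = 0) (at_left (0::real))"
        by (auto simp: eventually_at_filter exp_bump_def)
      then show "((\<lambda>h. (exp_bump p (0 + h) - exp_bump p 0) / h) \<longlongrightarrow> 0) (at_left 0)"
        by (rule tendsto_eventually)
      have "((\<lambda>h. poly (pCons 0 p) (inverse h) * exp (- inverse h)) \<longlongrightarrow> 0) (at_right (0::real))"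
        by (rule filterlim_compose[OF poly_exp_tendsto_0 filterlim_inverse_at_top_right])
      moreover have "eventually (\<lambda>h. poly (pCons 0 p) (inverse h) * exp (- inverse h) =
          (exp_bump p (0 + h) - exp_bump p 0) / h) (at_right (0::real))"
        by (auto simp: eventually_at_filter exp_bump_def field_simps)
      ultimately show "((\<lambda>h. (exp_bump p (0 + h) - exp_bump p 0) / h) \<longlongrightarrow> 0) (at_right 0)"
        by (rule Lim_transform_eventually)
    qed
    then show ?thesis using 3 by (simp add: DERIV_def exp_bump_def[of _ "0::real"])
  qed
qed

text \<open>A class closed under products and partial derivatives. By the coinduction principle it consists of smooth functions, which
yields smoothness of products without a Leibniz rule of higher order.\<close>

inductive smooth_gen :: "(real^'n \<Rightarrow> real) \<Rightarrow> bool" where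
  affine: "smooth f \<Longrightarrow> smooth_gen (\<lambda>x. f (c *\<^sub>R x + d))"
| bump: "smooth_gen (\<lambda>x. exp_bump p (c + a * x $ i))"
| const: "smooth_gen (\<lambda>x. c)"
| add: "smooth_gen f \<Longrightarrow> smooth_gen g \<Longrightarrow> smooth_gen (\<lambda>x. f x + g x)"
| mult: "smooth_gen f \<Longrightarrow> smooth_gen g \<Longrightarrow> smooth_gen (\<lambda>x. f x * g x)"

lemma has_derivative_coord_exp_bump:
  "((\<lambda>x::real^'n. exp_bump p (c + a * x $ i)) has_derivative
     (\<lambda>h. exp_bump ([:0, 0, 1:] * (p - pderiv p)) (c + a * x $ i) * (a * h $ i))) (at x)"
proof -
  have "((\<lambda>x::real^'n. c + a * x $ i) has_derivative (\<lambda>h. a * h $ i)) (at x)"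
    by (auto intro!: derivative_eq_intros bounded_linear.has_derivative[OF bounded_linear_vec_nth])
  from has_derivative_compose[OF this exp_bump_derivative[of p, unfolded has_field_derivative_def]]
  show ?thesis by simp
qed

lemma has_derivative_affine:
  fixes f :: "real^'n \<Rightarrow> real"
  assumes "(f has_derivative D) (at (c *\<^sub>R x + d))"
  shows "((\<lambda>x. f (c *\<^sub>R x + d)) has_derivative (\<lambda>h. D (c *\<^sub>R h))) (at x)"
  by (rule has_derivative_compose[of "\<lambda>x. c *\<^sub>R x + d" _ x UNIV f D, simplified])
    (auto intro!: derivative_eq_intros assms)

lemma partial_affine:
  fixes f :: "real^'n \<Rightarrow> real"
  assumes "\<And>x. f differentiable (at x)"
  shows "partial i (\<lambda>x. f (c *\<^sub>R x + d)) = (\<lambda>x. c * partial i f (c *\<^sub>R x + d))"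
proof
  fix x
  obtain D where D: "(f has_derivative D) (at (c *\<^sub>R x + d))"
    using assms by (auto simp: differentiable_def)
  interpret D: bounded_linear D by (rule has_derivative_bounded_linear[OF D])
  show "partial i (\<lambda>x. f (c *\<^sub>R x + d)) x = c * partial i f (c *\<^sub>R x + d)"
    using partial_eq_derivative[OF has_derivative_affine[OF D], of i] partial_eq_derivative[OF D, of i]
    by (simp add: D.scaleR)
qed

lemma partial_add:
  fixes f g :: "real^'n \<Rightarrow> real"
  assumes "\<And>x. f differentiable (at x)" "\<And>x. g differentiable (at x)"
  shows "partial i (\<lambda>x. f x + g x) = (\<lambda>x. partial i f x + partial i g x)"
proof
  fix x
  obtain D E where "(f has_derivative D) (at x)" "(g has_derivative E) (at x)"
    using assms unfolding differentiable_def by metis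
  then show "partial i (\<lambda>x. f x + g x) x = partial i f x + partial i g x"
    using partial_eq_derivative[OF has_derivative_add, of f D x g E i] by (simp add: partial_eq_derivative)
qed

lemma partial_mult:
  fixes f g :: "real^'n \<Rightarrow> real"
  assumes "\<And>x. f differentiable (at x)" "\<And>x. g differentiable (at x)"
  shows "partial i (\<lambda>x. f x * g x) = (\<lambda>x. f x * partial i g x + partial i f x * g x)"
proof
  fix x
  obtain D E where "(f has_derivative D) (at x)" "(g has_derivative E) (at x)"
    using assms unfolding differentiable_def by metis
  then show "partial i (\<lambda>x. f x * g x) x = f x * partial i g x + partial i f x * g x"
    using partial_eq_derivative[OF has_derivative_mult, of f D x g E i] by (simp add: partial_eq_derivative)
qed

lemma partial_const [simp]: "partial i (\<lambda>x. c) = (\<lambda>x. 0)"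
  by (simp add: partial_def fun_eq_iff)

lemma smooth_gen_differentiable: "smooth_gen f \<Longrightarrow> f differentiable (at x)"
proof (induction arbitrary: x rule: smooth_gen.induct)
  case (affine f c d)
  then obtain D where D: "(f has_derivative D) (at (c *\<^sub>R x + d))"
    using smooth_differentiable[of f] by (auto simp: differentiable_def)
  show ?case unfolding differentiable_def by (rule exI, rule has_derivative_affine[OF D])
next
  case bump
  show ?case unfolding differentiable_def by (rule exI, rule has_derivative_coord_exp_bump)
qed auto

lemma smooth_gen_partial: "smooth_gen f \<Longrightarrow> smooth_gen (partial i f)"
proof (induction rule: smooth_gen.induct)
  case (affine f c d)
  show ?case
    unfolding partial_affine[OF smooth_differentiable[OF affine]]
    by (rule smooth_gen.mult[OF smooth_gen.const smooth_gen.affine[OF smooth_partial[OF affine]]])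
next
  case (bump p c a j)
  have "partial i (\<lambda>x. exp_bump p (c + a * x $ j)) =
      (\<lambda>x. exp_bump ([:0, 0, 1:] * (p - pderiv p)) (c + a * x $ j) * (a * axis i 1 $ j))"
    using partial_eq_derivative[OF has_derivative_coord_exp_bump] by (auto simp: fun_eq_iff)
  then show ?case by (auto intro!: smooth_gen.intros)
next
  case (add f g)
  then show ?case by (subst partial_add) (auto intro: smooth_gen_differentiable smooth_gen.intros)
next
  case (mult f g)
  then show ?case by (subst partial_mult) (auto intro: smooth_gen_differentiable smooth_gen.intros)
next
  case (const c)
  show ?case unfolding partial_const by (rule smooth_gen.const)
qed

lemma smooth_gen_smooth: "smooth_gen f \<Longrightarrow> smooth f"
  by (rule smooth_coinduct[of smooth_gen]) (auto intro: smooth_gen_differentiable smooth_gen_partial)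

lemma smooth_gen_prod: "finite I \<Longrightarrow> (\<And>i. i \<in> I \<Longrightarrow> smooth_gen (f i)) \<Longrightarrow> smooth_gen (\<lambda>x. \<Prod>i\<in>I. f i x)"
  by (induction rule: finite_induct) (auto intro: smooth_gen.intros)

lemma smooth_affine: "smooth f \<Longrightarrow> smooth (\<lambda>x. f (c *\<^sub>R x + d))"
  by (rule smooth_gen_smooth, rule smooth_gen.affine)

lemma smooth_const: "smooth (\<lambda>x. c)"
  by (intro smooth_gen_smooth smooth_gen.const)

lemma smooth_mult: "smooth f \<Longrightarrow> smooth g \<Longrightarrow> smooth (\<lambda>x. f x * g x)"
  using smooth_gen_smooth[OF smooth_gen.mult[OF smooth_gen.affine[of f 1 0] smooth_gen.affine[of g 1 0]]] by simp

lemma partials_cmult: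
  assumes "smooth f" shows "partials is (\<lambda>x. c * f x) = (\<lambda>x. c * partials is f x)"
proof (induction "is")
  case (Cons i "is")
  then show ?case
    by (simp add: partial_mult smooth_differentiable[OF smooth_partials[OF assms]])
qed simp

lemma partials_add:
  assumes "smooth f" "smooth g"
  shows "partials is (\<lambda>x. f x + g x) = (\<lambda>x. partials is f x + partials is g x)"
proof (induction "is")
  case (Cons i "is")
  then show ?case
    by (simp add: partial_add smooth_differentiable[OF smooth_partials] assms)
qed simp

lemma partials_affine:
  assumes "smooth f"
  shows "partials is (\<lambda>x. f (c *\<^sub>R x + d)) = (\<lambda>x. c ^ length is * partials is f (c *\<^sub>R x + d))"
proof (induction "is")
  case (Cons i "is")
  have "smooth (\<lambda>x. partials is f (c *\<^sub>R x + d))" by (intro smooth_affine smooth_partials assms)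
  then show ?case
    using partials_cmult[of "\<lambda>x. partials is f (c *\<^sub>R x + d)" "[i]" "c ^ length is"]
    by (simp add: Cons partial_affine smooth_differentiable[OF smooth_partials[OF assms]] mult_ac)
qed simp

lemma partials_support:
  fixes f :: "real^'n \<Rightarrow> real"
  assumes "\<And>x. B < norm x \<Longrightarrow> f x = 0" "B < norm x"
  shows "partials is f x = 0"
  using assms(2)
proof (induction "is" arbitrary: x)
  case (Cons i "is")
  have "open {y :: real^'n. B < norm y}" by (intro open_Collect_less continuous_intros)
  then have "(partials is f has_derivative (\<lambda>h. 0)) (at x)"
    by (rule has_derivative_transform_within_open[OF has_derivative_const[of 0]])
      (use Cons in auto)
  then show ?case by (simp add: partial_eq_derivative)
qed (use assms in auto)

lemma test_function_iff:
  "test_function f \<longleftrightarrow> smooth f \<and> (\<exists>B. \<forall>x. B < norm x \<longrightarrow> f x = 0)"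
proof -
  have "compact (closure {x. f x \<noteq> 0}) \<longleftrightarrow> bounded {x. f x \<noteq> 0}"
    by (simp add: compact_closure)
  also have "\<dots> \<longleftrightarrow> (\<exists>B. \<forall>x. B < norm x \<longrightarrow> f x = 0)"
    unfolding bounded_iff by (auto simp: not_le[symmetric])
  finally show ?thesis by (simp add: test_function_def)
qed

lemma continuous_compact_support_bounded:
  fixes f :: "real^'n \<Rightarrow> real"
  assumes c: "continuous_on UNIV f" and 0: "\<And>x. B < norm x \<Longrightarrow> f x = 0"
  obtains M where "0 \<le> M" "\<And>x. \<bar>f x\<bar> \<le> M"
proof -
  have "compact (f ` cball 0 B)"
    by (intro compact_continuous_image continuous_on_subset[OF c]) auto
  then obtain M where M: "\<forall>y\<in>f ` cball 0 B. norm y \<le> M"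
    using compact_imp_bounded bounded_iff by metis
  have "\<bar>f x\<bar> \<le> max M 0" for x
  proof (cases "B < norm x")
    case False
    then have "norm (f x) \<le> M" using M by auto
    then show ?thesis by simp
  qed (simp add: 0)
  then show thesis using that[of "max M 0"] by auto
qed

lemma test_function_partials: "test_function f \<Longrightarrow> test_function (partials is f)"
  unfolding test_function_iff using smooth_partials partials_support by metis

lemma test_function_bounded:
  assumes "test_function f" obtains M where "0 \<le> M" "\<And>x. \<bar>f x\<bar> \<le> M"
  using assms continuous_compact_support_bounded[of f] smooth_continuous[of f]
  unfolding test_function_iff by metis

lemma test_function_mult: "test_function f \<Longrightarrow> smooth g \<Longrightarrow> test_function (\<lambda>x. f x * g x)"
  unfolding test_function_iff by (auto intro: smooth_mult)

lemma test_function_affine: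
  assumes f: "test_function f" and c: "c \<noteq> 0"
  shows "test_function (\<lambda>x. f (c *\<^sub>R x + d))"
proof -
  obtain B where B: "smooth f" "\<And>x. B < norm x \<Longrightarrow> f x = 0"
    using f unfolding test_function_iff by auto
  have "f (c *\<^sub>R x + d) = 0" if "(B + norm d) / \<bar>c\<bar> < norm x" for x
  proof (rule B(2))
    have "B + norm d < norm (c *\<^sub>R x)" using that c by (simp add: field_simps)
    also have "\<dots> \<le> norm (c *\<^sub>R x + d) + norm d"
      using norm_triangle_ineq4[of "c *\<^sub>R x + d" d] by simp
    finally show "B < norm (c *\<^sub>R x + d)" by simp
  qed
  then show ?thesis unfolding test_function_iff using smooth_affine[OF B(1)] by blast
qed

text \<open>The product over the coordinates of \<open>exp(-1/(1 + t) - 1/(1 - t))\<close> is supported in the cube \<open>[-1, 1]\<^sup>n\<close>.\<close>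

lemma test_function_exists:
  obtains \<phi> :: "real^'n \<Rightarrow> real" where "test_function \<phi>" "\<And>x. 0 \<le> \<phi> x" "0 < \<phi> 0"
proof
  let ?\<phi> = "\<lambda>x::real^'n. \<Prod>i\<in>UNIV. exp_bump 1 (1 + 1 * x $ i) * exp_bump 1 (1 + (-1) * x $ i)"
  have "smooth ?\<phi>"
    by (intro smooth_gen_smooth smooth_gen_prod smooth_gen.mult smooth_gen.bump) auto
  moreover have "?\<phi> x = 0" if "real CARD('n) < norm x" for x
  proof -
    have "\<exists>i. 1 \<le> \<bar>x $ i\<bar>"
    proof (rule ccontr)
      assume "\<nexists>i. 1 \<le> \<bar>x $ i\<bar>"
      then have "(\<Sum>i\<in>UNIV. \<bar>x $ i\<bar>) \<le> (\<Sum>i\<in>(UNIV :: 'n set). 1)" by (intro sum_mono) (auto simp: not_le less_imp_le)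
      then show False using that norm_le_l1_cart[of x] by simp
    qed
    then obtain i where "1 \<le> \<bar>x $ i\<bar>" by auto
    then have "exp_bump 1 (1 + 1 * x $ i) * exp_bump 1 (1 + (-1) * x $ i) = 0"
      by (auto simp: exp_bump_def)
    then show ?thesis by (intro prod_zero) auto
  qed
  ultimately show "test_function ?\<phi>" unfolding test_function_iff by blast
  show "0 \<le> ?\<phi> x" for x by (intro prod_nonneg mult_nonneg_nonneg) (auto simp: exp_bump_def)
  show "0 < ?\<phi> 0" by (intro prod_pos mult_pos_pos) (auto simp: exp_bump_def)
qed

section \<open>Interpolation for test functions\<close>

lemma nn_integral_lborel_translate:
  fixes f :: "'a::euclidean_space \<Rightarrow> ennreal"
  assumes [measurable]: "f \<in> borel_measurable borel"
  shows "(\<integral>\<^sup>+x. f (x + c) \<partial>lborel) = (\<integral>\<^sup>+x. f x \<partial>lborel)"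
proof -
  have "(\<integral>\<^sup>+x. f x \<partial>lborel) = (\<integral>\<^sup>+x. f x \<partial>distr lborel borel ((+) c))"
    by (simp add: lborel_distr_plus)
  also have "\<dots> = (\<integral>\<^sup>+x. f (x + c) \<partial>lborel)"
    by (subst nn_integral_distr) (simp_all add: add.commute)
  finally show ?thesis by simp
qed

text \<open>Every line in direction \<open>i\<close> spends unit time in the slab. Hence integrating over the slab the integrals along the lines
through its points gives the full integral, which replaces a splitting of \<open>real^'n\<close> into a coordinate and the
orthogonal hyperplane.\<close>

definition slab :: "'n \<Rightarrow> (real^'n) set" where
  "slab i = {x. 0 \<le> x $ i \<and> x $ i \<le> 1}"

lemma slab_measurable [measurable]: "slab i \<in> sets borel"
proof -
  have "closed (slab i)" unfolding slab_def
    by (intro closed_Collect_conj closed_Collect_le continuous_intros)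
  then show ?thesis by (rule borel_closed)
qed

text \<open>Tonelli's theorem and translation invariance: for fixed \<open>x\<close> the parameters \<open>t\<close> for which \<open>x\<close> minus \<open>t\<close> times
the \<open>i\<close>-th basis vector lies in the slab form an interval of length \<open>1\<close>.\<close>

lemma nn_integral_slices:
  fixes f :: "real^'n \<Rightarrow> ennreal"
  assumes [measurable]: "f \<in> borel_measurable borel"
  shows "(\<integral>\<^sup>+x. indicator (slab i) x * (\<integral>\<^sup>+t. f (x + t *\<^sub>R axis i 1) \<partial>lborel) \<partial>lborel) = (\<integral>\<^sup>+x. f x \<partial>lborel)"
    (is "?L = _")
proof -
  let ?e = "axis i 1 :: real^'n"
  have "?L = (\<integral>\<^sup>+x. (\<integral>\<^sup>+t. indicator (slab i) x * f (x + t *\<^sub>R ?e) \<partial>lborel) \<partial>lborel)"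
    by (intro nn_integral_cong nn_integral_cmult[symmetric]) measurable
  also have "\<dots> = (\<integral>\<^sup>+t. (\<integral>\<^sup>+x. indicator (slab i) x * f (x + t *\<^sub>R ?e) \<partial>lborel) \<partial>lborel)"
    by (rule lborel_pair.Fubini') measurable
  also have "\<dots> = (\<integral>\<^sup>+t. (\<integral>\<^sup>+x. indicator (slab i) (x - t *\<^sub>R ?e) * f x \<partial>lborel) \<partial>lborel)"
  proof (rule nn_integral_cong)
    fix t :: real
    show "(\<integral>\<^sup>+x. indicator (slab i) x * f (x + t *\<^sub>R ?e) \<partial>lborel)
        = (\<integral>\<^sup>+x. indicator (slab i) (x - t *\<^sub>R ?e) * f x \<partial>lborel)"
      using nn_integral_lborel_translate[of "\<lambda>x. indicator (slab i) (x - t *\<^sub>R ?e) * f x" "t *\<^sub>R ?e"] by simp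
  qed
  also have "\<dots> = (\<integral>\<^sup>+x. (\<integral>\<^sup>+t. indicator (slab i) (x - t *\<^sub>R ?e) * f x \<partial>lborel) \<partial>lborel)"
    by (rule lborel_pair.Fubini'[symmetric]) measurable
  also have "\<dots> = (\<integral>\<^sup>+x. f x \<partial>lborel)"
  proof (rule nn_integral_cong)
    fix x :: "real^'n"
    have "(\<integral>\<^sup>+t. indicator (slab i) (x - t *\<^sub>R ?e) * f x \<partial>lborel)
        = (\<integral>\<^sup>+t. f x * indicator {x $ i - 1..x $ i} t \<partial>lborel)"
      by (intro nn_integral_cong) (auto simp: indicator_def slab_def)
    also have "\<dots> = f x" by (subst nn_integral_cmult) auto
    finally show "(\<integral>\<^sup>+t. indicator (slab i) (x - t *\<^sub>R ?e) * f x \<partial>lborel) = f x" .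
  qed
  finally show ?thesis .
qed

lemma line_continuous:
  fixes f :: "real^'n \<Rightarrow> real"
  assumes c: "continuous_on UNIV f"
  shows "continuous_on UNIV (\<lambda>t. f (x + t *\<^sub>R axis i 1))"
  by (rule continuous_on_compose2[OF c]) (auto intro!: continuous_intros)

lemma line_support:
  fixes f :: "real^'n \<Rightarrow> real"
  assumes "\<And>z. B < norm z \<Longrightarrow> f z = 0" and "B + norm x < \<bar>t\<bar>"
  shows "f (x + t *\<^sub>R axis i 1) = 0"
proof (rule assms(1))
  have "norm (t *\<^sub>R axis i 1 :: real^'n) = \<bar>t\<bar>" by simp
  then show "B < norm (x + t *\<^sub>R axis i 1)"
    using assms(2) norm_diff_ineq[of "t *\<^sub>R axis i 1" x] by (simp add: add.commute)
qed

lemma integral_slices: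
  fixes f :: "real^'n \<Rightarrow> real" and i :: 'n
  assumes c: "continuous_on UNIV f" and B: "\<And>z. B < norm z \<Longrightarrow> f z = 0" and nn: "\<And>z. 0 \<le> f z"
  defines "F \<equiv> \<lambda>x. indicator (slab i) x * (LBINT t. f (x + t *\<^sub>R axis i 1))"
  shows "integrable lborel F" and "(LBINT x. F x) = (LBINT x. f x)"
proof -
  have [measurable]: "f \<in> borel_measurable borel" by (rule borel_measurable_continuous_onI[OF c])
  have line: "integrable lborel (\<lambda>t. f (x + t *\<^sub>R axis i 1))" for x
    by (rule integrable_continuous_compact_support[OF line_continuous[OF c], of "B + norm x"])
      (use line_support[OF B] in auto)
  have F0: "0 \<le> F x" for x unfolding F_def using nn by (auto intro!: mult_nonneg_nonneg)
  have Fm: "F \<in> borel_measurable lborel" unfolding F_def by measurable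
  have "ennreal (F x) = indicator (slab i) x * (\<integral>\<^sup>+t. ennreal (f (x + t *\<^sub>R axis i 1)) \<partial>lborel)" for x
    unfolding F_def using nn line[of x] by (auto simp: indicator_def nn_integral_eq_integral)
  then have "(\<integral>\<^sup>+x. ennreal (F x) \<partial>lborel) = (\<integral>\<^sup>+x. ennreal (f x) \<partial>lborel)"
    using nn_integral_slices[of "\<lambda>x. ennreal (f x)" i] by simp
  also have "\<dots> = ennreal (LBINT x. f x)"
    using nn integrable_continuous_compact_support[OF c B] by (intro nn_integral_eq_integral) auto
  finally have *: "(\<integral>\<^sup>+x. ennreal (F x) \<partial>lborel) = ennreal (LBINT x. f x)" .
  show "integrable lborel F"
    by (rule integrableI_nn_integral_finite[OF Fm _ *]) (use F0 in auto)
  show "(LBINT x. F x) = (LBINT x. f x)"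
    using * F0 nn Fm by (subst integral_eq_nn_integral) auto
qed

text \<open>The one-dimensional inequality is applied on every line in direction \<open>i\<close> and integrated over the slab, with Hoelder's
inequality for the product on the right.\<close>

lemma interpolation_axis:
  fixes v \<alpha> \<beta> :: "real^'n \<Rightarrow> real"
  assumes v: "test_function v"
    and \<alpha>: "continuous_on UNIV \<alpha>" "\<And>x. 0 \<le> \<alpha> x" "\<And>x. \<bar>partial i (partial i v) x\<bar> \<le> \<alpha> x powr s"
    and \<beta>: "continuous_on UNIV \<beta>" "\<And>x. 0 \<le> \<beta> x" "\<And>x. \<bar>v x\<bar> \<le> K * \<beta> x powr t"
    and supp: "\<And>x. B < norm x \<Longrightarrow> \<alpha> x = 0 \<and> \<beta> x = 0"
    and st: "0 < s" "s \<le> 1" "0 \<le> t" "t \<le> 1" and K: "0 \<le> K" and p: "p = 2 / (s + t)"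
  shows "(LBINT x. \<bar>partial i v x\<bar> powr p)
           \<le> 19 powr p * K powr (p / 2) * ((LBINT x. \<alpha> x) powr (p * s / 2) * (LBINT x. \<beta> x) powr (p * t / 2))"
proof -
  let ?e = "axis i 1 :: real^'n"
  let ?C = "19 powr p * K powr (p / 2)"
  have p0: "0 < p" using st p by simp
  have \<theta>: "0 \<le> p * s / 2" "p * s / 2 \<le> 1" "p * t / 2 = 1 - p * s / 2"
    using interpolation_weights[OF st(1,3) p] .
  have sm: "smooth v" and sm1: "smooth (partial i v)" and sm2: "smooth (partial i (partial i v))"
    using v by (auto simp: test_function_iff intro: smooth_partial)
  obtain B' where B': "\<And>x. B' < norm x \<Longrightarrow> partial i v x = 0"
    using test_function_partials[OF v, of "[i]"] by (auto simp: test_function_iff)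
  define R where "R = max B B'"
  have R: "\<alpha> x = 0" "\<beta> x = 0" "partial i v x = 0" if "R < norm x" for x
    using that supp[of x] B'[of x] by (auto simp: R_def)
  let ?f = "\<lambda>x. \<bar>partial i v x\<bar> powr p"
  have cf: "continuous_on UNIV ?f"
    by (rule continuous_on_powr') (auto intro: smooth_continuous[OF sm1] continuous_on_rabs simp: p0)
  have fR: "R < norm x \<Longrightarrow> ?f x = 0" for x using R by simp
  have f0: "0 \<le> ?f x" for x by simp
  let ?S = "\<lambda>g x. indicat_real (slab i) x * (LBINT t. g (x + t *\<^sub>R ?e))"
  note If = integral_slices[OF cf fR f0, where i = i]
  note I\<alpha> = integral_slices[OF \<alpha>(1) R(1) \<alpha>(2), where i = i]
  note I\<beta> = integral_slices[OF \<beta>(1) R(2) \<beta>(2), where i = i]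
  have S0: "0 \<le> ?S g x" if "\<And>z. 0 \<le> g z" for g x using that by (auto intro!: mult_nonneg_nonneg)
  have line: "(LBINT \<tau>. ?f (x + \<tau> *\<^sub>R ?e)) \<le> ?C * ((LBINT \<tau>. \<alpha> (x + \<tau> *\<^sub>R ?e)) powr (p * s / 2)
       * (LBINT \<tau>. \<beta> (x + \<tau> *\<^sub>R ?e)) powr (p * t / 2))" for x
  proof (rule one_dimensional_interpolation[where v = "\<lambda>\<tau>. v (x + \<tau> *\<^sub>R ?e)" and R = "\<bar>R\<bar> + norm x + 1"
        and v'' = "\<lambda>\<tau>. partial i (partial i v) (x + \<tau> *\<^sub>R ?e)"])
    fix \<tau> assume "\<bar>R\<bar> + norm x + 1 \<le> \<bar>\<tau>\<bar>"
    then have "R + norm x < \<bar>\<tau>\<bar>" by linarith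
    then show "partial i v (x + \<tau> *\<^sub>R ?e) = 0 \<and> \<alpha> (x + \<tau> *\<^sub>R ?e) = 0 \<and> \<beta> (x + \<tau> *\<^sub>R ?e) = 0"
      using line_support[of R \<alpha>] line_support[of R \<beta>] line_support[of R "partial i v"] R by auto
  qed (use \<alpha> \<beta> st K p in \<open>auto intro!: partial_line_derivative smooth_differentiable sm sm1
        line_continuous smooth_continuous[OF sm2]\<close>)
  note H = Holder_powr[OF I\<alpha>(1) I\<beta>(1) S0[OF \<alpha>(2)] S0[OF \<beta>(2)] \<theta>(1,2)]
  have "(LBINT x. ?f x) = (LBINT x. ?S ?f x)" using If(2) by simp
  also have "\<dots> \<le> (LBINT x. ?C * (?S \<alpha> x powr (p * s / 2) * ?S \<beta> x powr (1 - p * s / 2)))"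
  proof (rule integral_mono[OF If(1) integrable_mult_right[OF H(1)]])
    fix x
    show "?S ?f x \<le> ?C * (?S \<alpha> x powr (p * s / 2) * ?S \<beta> x powr (1 - p * s / 2))"
      using line[of x] unfolding \<theta>(3) by (simp add: indicator_def)
  qed
  also have "\<dots> = ?C * (LBINT x. ?S \<alpha> x powr (p * s / 2) * ?S \<beta> x powr (1 - p * s / 2))" by simp
  also have "\<dots> \<le> ?C * ((LBINT x. ?S \<alpha> x) powr (p * s / 2) * (LBINT x. ?S \<beta> x) powr (1 - p * s / 2))"
    by (intro mult_left_mono H) auto
  finally show ?thesis by (simp only: I\<alpha>(2) I\<beta>(2) \<theta>(3))
qed

text \<open>The norm of \<open>L\<close> to the power \<open>1/s\<close> for functions for which it is finite, in particular for test functions.\<close>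

definition rnorm :: "real \<Rightarrow> (real^'n \<Rightarrow> real) \<Rightarrow> real" where
  "rnorm s f = (if s = 0 then SUP x. \<bar>f x\<bar> else (LBINT x. \<bar>f x\<bar> powr (1 / s)) powr s)"

lemma test_function_abs_le_rnorm_0:
  assumes "test_function f" shows "\<bar>f x\<bar> \<le> rnorm 0 f"
proof -
  obtain M where "\<And>x. \<bar>f x\<bar> \<le> M" using test_function_bounded[OF assms] by metis
  then have "bdd_above (range (\<lambda>x. \<bar>f x\<bar>))" by (auto intro!: bdd_aboveI)
  then show ?thesis by (auto simp: rnorm_def intro!: cSUP_upper)
qed

lemma rnorm_nonneg: "test_function f \<Longrightarrow> 0 \<le> rnorm s f"
  using test_function_abs_le_rnorm_0[of f 0] by (cases "s = 0") (auto simp: rnorm_def)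

text \<open>For \<open>t = 0\<close> any integrable \<open>\<beta>\<close> with the support of \<open>v\<close> will do, and \<open>K\<close> is the supremum norm.\<close>

lemma rnorm_interpolation_step:
  fixes v :: "real^'n \<Rightarrow> real"
  assumes v: "test_function v" and st: "0 < s" "s \<le> 1" "0 \<le> t" "t \<le> 1"
  shows "rnorm ((s + t) / 2) (partial i v) \<le> 19 * sqrt (rnorm s (partial i (partial i v)) * rnorm t v)"
proof -
  define p where "p = 2 / (s + t)"
  have p0: "0 < p" using st by (simp add: p_def)
  let ?w = "partial i (partial i v)"
  define \<alpha> where "\<alpha> x = \<bar>?w x\<bar> powr (1 / s)" for x
  define \<beta> where "\<beta> x = \<bar>v x\<bar> powr (if t = 0 then 1 else 1 / t)" for x
  define K where "K = (if t = 0 then rnorm 0 v else 1)"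
  have w: "test_function ?w" using test_function_partials[OF v, of "[i, i]"] by simp
  obtain B where B: "\<And>x. B < norm x \<Longrightarrow> v x = 0" using v by (auto simp: test_function_iff)
  have Bw: "?w x = 0" if "B < norm x" for x
    using partials_support[of B v x "[i, i]"] B that by simp
  have K0: "0 \<le> K" using rnorm_nonneg[OF v] by (simp add: K_def)
  have cont: "continuous_on UNIV v" "continuous_on UNIV ?w"
    using v w by (auto simp: test_function_iff intro: smooth_continuous)
  have c\<alpha>: "continuous_on UNIV \<alpha>"
    unfolding \<alpha>_def by (rule continuous_on_powr') (use st in \<open>auto intro: cont continuous_on_rabs\<close>)
  have c\<beta>: "continuous_on UNIV \<beta>"
    unfolding \<beta>_def by (rule continuous_on_powr') (use st in \<open>auto intro: cont continuous_on_rabs\<close>)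
  have v\<beta>: "\<bar>v x\<bar> \<le> K * \<beta> x powr t" for x
    using test_function_abs_le_rnorm_0[OF v, of x] st
    by (cases "v x = 0") (auto simp: K_def \<beta>_def powr_powr)
  have "(LBINT x. \<bar>partial i v x\<bar> powr p)
           \<le> 19 powr p * K powr (p / 2) * ((LBINT x. \<alpha> x) powr (p * s / 2) * (LBINT x. \<beta> x) powr (p * t / 2))"
  proof (rule interpolation_axis[OF v c\<alpha> _ _ c\<beta> _ v\<beta> _ st K0 p_def])
    show "\<bar>?w x\<bar> \<le> \<alpha> x powr s" for x using st by (simp add: \<alpha>_def powr_powr)
    show "\<alpha> x = 0 \<and> \<beta> x = 0" if "B < norm x" for x using B[OF that] Bw[OF that] by (simp add: \<alpha>_def \<beta>_def)
  qed (auto simp: \<alpha>_def \<beta>_def)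
  then have "(LBINT x. \<bar>partial i v x\<bar> powr p) powr (1 / p)
      \<le> (19 powr p * K powr (p / 2) * ((LBINT x. \<alpha> x) powr (p * s / 2) * (LBINT x. \<beta> x) powr (p * t / 2))) powr (1 / p)"
    using p0 by (intro powr_mono2) auto
  also have "\<dots> = 19 * K powr (1/2) * ((LBINT x. \<alpha> x) powr (s / 2) * (LBINT x. \<beta> x) powr (t / 2))"
  proof -
    have e: "(X powr (p * y / 2)) powr (1 / p) = X powr (y / 2)" for X y :: real
      using p0 by (simp add: powr_powr)
    show ?thesis using e[of 19 2] e[of K 1] e[of _ s] e[of _ t] p0 by (simp add: powr_mult powr_powr)
  qed
  also have "\<dots> = 19 * sqrt (K * ((LBINT x. \<alpha> x) powr s * (LBINT x. \<beta> x) powr t))"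
    using K0 by (simp add: powr_half_sqrt[symmetric] powr_mult powr_powr)
  also have "\<dots> \<le> 19 * sqrt (rnorm s ?w * rnorm t v)"
  proof -
    have "(LBINT x. \<alpha> x) powr s = rnorm s ?w" using st by (simp add: rnorm_def \<alpha>_def)
    moreover have "K * (LBINT x. \<beta> x) powr t \<le> rnorm t v"
      using K0 by (auto simp: K_def \<beta>_def rnorm_def)
    ultimately have "K * ((LBINT x. \<alpha> x) powr s * (LBINT x. \<beta> x) powr t) \<le> rnorm s ?w * rnorm t v"
      using mult_left_mono[of "K * (LBINT x. \<beta> x) powr t" "rnorm t v" "rnorm s ?w"] rnorm_nonneg[OF w]
      by (simp add: mult_ac)
    then show ?thesis by simp
  qed
  finally show ?thesis using st by (simp add: rnorm_def p_def)
qed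

lemma finite_lists_of_length: "finite {is :: 'a::finite list. length is = m}"
  using finite_lists_length_eq[of "UNIV :: 'a set" m] by simp

text \<open>Each derivative of order \<open>m\<close> with \<open>0 < m < k\<close> is \<open>\<partial>\<^sub>i w\<close> for a derivative \<open>w\<close> of order \<open>m - 1\<close>, so the
one-directional inequality compares the sums of the norms of all derivatives of orders \<open>m - 1\<close>, \<open>m\<close> and \<open>m + 1\<close>.\<close>

lemma test_function_interpolation:
  fixes v :: "real^'n \<Rightarrow> real"
  assumes v: "test_function v" and st: "0 < s" "s \<le> 1" "0 \<le> t" "t \<le> 1" and j: "0 < j" "j < k"
    and "is": "length is = j"
  shows "rnorm (real j / real k * s + (1 - real j / real k) * t) (partials is v)
     \<le> (19 * real CARD('n) ^ k) ^ (k * j) *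
        ((\<Sum>is | length is = k. rnorm s (partials is v)) powr (real j / real k) * rnorm t v powr (1 - real j / real k))"
proof -
  \<comment> \<open>The reciprocal exponents in arithmetic progression.\<close>
  define \<sigma> where "\<sigma> m = real m / real k * s + (1 - real m / real k) * t" for m
  define N where "N m = (\<Sum>is | length is = m. rnorm (\<sigma> m) (partials is v))" for m
  let ?C = "19 * real CARD('n) ^ k"
  have fin: "finite {is :: 'n list. length is = m}" for m by (rule finite_lists_of_length)
  have rn0: "0 \<le> rnorm \<tau> (partials is v)" for \<tau> "is"
    by (intro rnorm_nonneg test_function_partials v)
  have N0: "0 \<le> N m" for m unfolding N_def by (intro sum_nonneg rn0)
  have C: "1 \<le> ?C"
  proof -
    have "1 \<le> real CARD('n)" by (simp add: Suc_le_eq)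
    then have "1 \<le> real CARD('n) ^ k" by (rule one_le_power)
    then show ?thesis by linarith
  qed
  have step: "N m \<le> ?C * sqrt (N (m - 1) * N (m + 1))" if m: "0 < m" "m < k" for m
  proof -
    have \<sigma>: "\<sigma> m = (\<sigma> (m + 1) + \<sigma> (m - 1)) / 2"
      using m by (simp add: \<sigma>_def of_nat_diff field_simps)
    have le1: "0 \<le> real i / real k" "real i / real k \<le> 1" if "i \<le> k" for i using that j by auto
    have \<sigma>1: "0 < \<sigma> (m + 1)"
    proof -
      have "0 < real (m + 1) / real k * s" using st m by simp
      moreover have "0 \<le> (1 - real (m + 1) / real k) * t" using st le1[of "m+1"] m by (intro mult_nonneg_nonneg) auto
      ultimately show ?thesis by (simp add: \<sigma>_def)
    qed
    have \<sigma>b: "0 \<le> \<sigma> i" "\<sigma> i \<le> 1" if "i \<le> k" for i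
    proof -
      show "0 \<le> \<sigma> i" unfolding \<sigma>_def using le1[OF that] st by simp
      have "\<sigma> i \<le> real i / real k * 1 + (1 - real i / real k) * 1"
        unfolding \<sigma>_def using le1[OF that] st by (intro add_mono mult_left_mono) auto
      then show "\<sigma> i \<le> 1" by simp
    qed
    have each: "rnorm (\<sigma> m) (partials is v) \<le> 19 * sqrt (N (m - 1) * N (m + 1))" if l: "length is = m" for "is"
    proof -
      obtain i js where ij: "is = i # js" using l m by (cases "is") auto
      let ?w = "partials js v"
      have "rnorm (\<sigma> m) (partial i ?w) \<le> 19 * sqrt (rnorm (\<sigma> (m + 1)) (partial i (partial i ?w)) * rnorm (\<sigma> (m - 1)) ?w)"
        unfolding \<sigma> using m \<sigma>b[of "m+1"] \<sigma>b[of "m-1"] \<sigma>1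
        by (intro rnorm_interpolation_step test_function_partials v) auto
      moreover have "rnorm (\<sigma> (m + 1)) (partial i (partial i ?w)) \<le> N (m + 1)"
        unfolding N_def using ij l rn0
        using member_le_sum[of "i # i # js" "{is. length is = m + 1}" "\<lambda>is. rnorm (\<sigma> (m + 1)) (partials is v)"] fin
        by auto
      moreover have "rnorm (\<sigma> (m - 1)) ?w \<le> N (m - 1)"
        unfolding N_def using ij l rn0
        by (intro member_le_sum[of js _ "\<lambda>is. rnorm (\<sigma> (m - 1)) (partials is v)"] fin) auto
      moreover have "sqrt (rnorm (\<sigma> (m + 1)) (partial i (partial i ?w)) * rnorm (\<sigma> (m - 1)) ?w)
          \<le> sqrt (N (m + 1) * N (m - 1))"
        using calculation rn0[of _ js] N0 by (intro real_sqrt_le_mono mult_mono) auto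
      ultimately have "rnorm (\<sigma> m) (partial i ?w) \<le> 19 * sqrt (N (m + 1) * N (m - 1))" by linarith
      then show ?thesis using ij by (simp add: mult.commute)
    qed
    have "N m \<le> of_nat (card {is :: 'n list. length is = m}) * (19 * sqrt (N (m - 1) * N (m + 1)))"
      unfolding N_def[of m] by (rule sum_bounded_above) (use each in auto)
    also have "card {is :: 'n list. length is = m} = CARD('n) ^ m"
      using card_lists_length_eq[of "UNIV :: 'n set" m] by simp
    also have "of_nat (CARD('n) ^ m) * (19 * sqrt (N (m - 1) * N (m + 1))) \<le> real CARD('n) ^ k * (19 * sqrt (N (m - 1) * N (m + 1)))"
      using m N0 by (intro mult_right_mono) (auto intro!: power_increasing)
    finally show ?thesis by (simp add: mult_ac)
  qed
  have "rnorm (\<sigma> j) (partials is v) \<le> N j"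
    unfolding N_def using "is" rn0 by (intro member_le_sum fin) auto
  also have "\<dots> \<le> ?C ^ (k * j) * (N k powr (real j / real k) * N 0 powr (1 - real j / real k))"
    by (rule log_convex_interpolation[OF N0 C step j])
  also have "N 0 = rnorm t v" by (simp add: N_def \<sigma>_def)
  also have "N k = (\<Sum>is | length is = k. rnorm s (partials is v))" using j by (simp add: N_def \<sigma>_def)
  finally show ?thesis by (simp add: \<sigma>_def)
qed

section \<open>Bounds on Lebesgue norms\<close>

text \<open>Upper bounds instead of norms avoid extended reals and infinite norms. A bound survives limits almost everywhere, and for
\<open>s = 0\<close> it is an essential bound.\<close>

definition norm_le :: "real \<Rightarrow> ('a::euclidean_space \<Rightarrow> real) \<Rightarrow> real \<Rightarrow> bool" where
  "norm_le s f B \<longleftrightarrow> 0 \<le> B \<and> f \<in> borel_measurable borel \<and>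
     (if s = 0 then AE x in lborel. \<bar>f x\<bar> \<le> B
      else (\<integral>\<^sup>+x. ennreal (\<bar>f x\<bar> powr (1 / s)) \<partial>lborel) \<le> ennreal (B powr (1 / s)))"

lemma norm_leD:
  assumes "norm_le s f B" shows "0 \<le> B" "f \<in> borel_measurable borel"
  using assms by (auto simp: norm_le_def)

lemma norm_le_mono:
  assumes "norm_le s f A" "A \<le> B" "0 \<le> s" shows "norm_le s f B"
proof -
  have "ennreal (A powr (1 / s)) \<le> ennreal (B powr (1 / s))"
    using assms norm_leD[OF assms(1)] by (intro ennreal_leI powr_mono2) auto
  moreover have "AE x in lborel. \<bar>f x\<bar> \<le> B" if "AE x in lborel. \<bar>f x\<bar> \<le> A"
    using that by eventually_elim (use assms in auto)
  ultimately show ?thesis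
    using assms by (auto simp: norm_le_def split: if_splits intro: order_trans)
qed

lemma norm_le_dominated:
  assumes g: "norm_le s g B" and f: "f \<in> borel_measurable borel" and "0 \<le> c" "0 \<le> s"
    and le: "AE x in lborel. \<bar>f x\<bar> \<le> c * \<bar>g x\<bar>"
  shows "norm_le s f (c * B)"
proof (cases "s = 0")
  case True
  then have "AE x in lborel. \<bar>g x\<bar> \<le> B" using g by (auto simp: norm_le_def)
  with le have "AE x in lborel. \<bar>f x\<bar> \<le> c * B"
    by eventually_elim (use \<open>0 \<le> c\<close> in \<open>meson mult_left_mono order_trans\<close>)
  then show ?thesis using True assms norm_leD[OF g] by (auto simp: norm_le_def)
next
  case False
  then have s: "0 < s" using assms by auto
  have [measurable]: "g \<in> borel_measurable borel" by (rule norm_leD[OF g])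
  have B: "0 \<le> B" by (rule norm_leD[OF g])
  have "(\<integral>\<^sup>+x. ennreal (\<bar>f x\<bar> powr (1 / s)) \<partial>lborel)
      \<le> (\<integral>\<^sup>+x. ennreal (c powr (1 / s)) * ennreal (\<bar>g x\<bar> powr (1 / s)) \<partial>lborel)"
  proof (rule nn_integral_mono_AE)
    show "AE x in lborel. ennreal (\<bar>f x\<bar> powr (1 / s)) \<le> ennreal (c powr (1 / s)) * ennreal (\<bar>g x\<bar> powr (1 / s))"
      using le
    proof eventually_elim
      fix x assume "\<bar>f x\<bar> \<le> c * \<bar>g x\<bar>"
      then have "\<bar>f x\<bar> powr (1 / s) \<le> (c * \<bar>g x\<bar>) powr (1 / s)" using s by (intro powr_mono2) auto
      then show "ennreal (\<bar>f x\<bar> powr (1 / s)) \<le> ennreal (c powr (1 / s)) * ennreal (\<bar>g x\<bar> powr (1 / s))"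
        using \<open>0 \<le> c\<close> by (simp add: powr_mult flip: ennreal_mult)
    qed
  qed
  also have "\<dots> = ennreal (c powr (1 / s)) * (\<integral>\<^sup>+x. ennreal (\<bar>g x\<bar> powr (1 / s)) \<partial>lborel)"
    by (rule nn_integral_cmult) measurable
  also have "\<dots> \<le> ennreal (c powr (1 / s)) * ennreal (B powr (1 / s))"
    using g s by (intro mult_left_mono) (auto simp: norm_le_def)
  also have "\<dots> = ennreal ((c * B) powr (1 / s))"
    using \<open>0 \<le> c\<close> B by (simp add: powr_mult flip: ennreal_mult)
  finally show ?thesis using s assms B by (simp add: norm_le_def)
qed

text \<open>Fatou's lemma.\<close>

lemma norm_le_limit:
  assumes f: "f \<in> borel_measurable borel" and n: "\<And>m. norm_le s (F m) (b m)"
    and lim: "AE x in lborel. (\<lambda>m. F m x) \<longlonglongrightarrow> f x" and b: "b \<longlonglongrightarrow> B" and s: "0 < s"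
  shows "norm_le s f B"
proof -
  have [measurable]: "F m \<in> borel_measurable borel" for m by (rule norm_leD[OF n])
  have B: "0 \<le> B" using norm_leD(1)[OF n] by (intro LIMSEQ_le_const[OF b]) auto
  have pw: "(\<lambda>m. ennreal (a m powr (1 / s))) \<longlonglongrightarrow> ennreal (l powr (1 / s))"
    if "a \<longlonglongrightarrow> l" "\<And>m. 0 \<le> a m" for a l
    using that s by (intro tendsto_ennrealI tendsto_powr' tendsto_const) auto
  have "(\<integral>\<^sup>+x. ennreal (\<bar>f x\<bar> powr (1 / s)) \<partial>lborel) = (\<integral>\<^sup>+x. liminf (\<lambda>m. ennreal (\<bar>F m x\<bar> powr (1 / s))) \<partial>lborel)"
  proof (rule nn_integral_cong_AE)
    show "AE x in lborel. ennreal (\<bar>f x\<bar> powr (1 / s)) = liminf (\<lambda>m. ennreal (\<bar>F m x\<bar> powr (1 / s)))"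
      using lim
    proof eventually_elim
      fix x assume "(\<lambda>m. F m x) \<longlonglongrightarrow> f x"
      then have "(\<lambda>m. ennreal (\<bar>F m x\<bar> powr (1 / s))) \<longlonglongrightarrow> ennreal (\<bar>f x\<bar> powr (1 / s))"
        by (intro pw tendsto_rabs) auto
      then show "ennreal (\<bar>f x\<bar> powr (1 / s)) = liminf (\<lambda>m. ennreal (\<bar>F m x\<bar> powr (1 / s)))"
        by (rule lim_imp_Liminf[OF trivial_limit_sequentially, symmetric])
    qed
  qed
  also have "\<dots> \<le> liminf (\<lambda>m. \<integral>\<^sup>+x. ennreal (\<bar>F m x\<bar> powr (1 / s)) \<partial>lborel)"
    by (rule nn_integral_liminf) measurable
  also have "\<dots> \<le> liminf (\<lambda>m. ennreal (b m powr (1 / s)))"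
    using n s by (intro Liminf_mono always_eventually) (auto simp: norm_le_def)
  also have "\<dots> = ennreal (B powr (1 / s))"
    using pw[OF b norm_leD(1)[OF n]] by (simp add: lim_imp_Liminf)
  finally show ?thesis using f s B by (simp add: norm_le_def)
qed

lemma powr_convex_nonneg:
  fixes x y u v p :: real
  assumes "0 \<le> x" "0 \<le> y" "0 \<le> u" "0 \<le> v" "u + v = 1" "1 \<le> p"
  shows "(u * x + v * y) powr p \<le> u * x powr p + v * y powr p"
proof -
  have *: "(c * z) powr p \<le> c * z powr p" if "0 \<le> c" "c \<le> 1" "0 \<le> z" for c z
  proof -
    have "c powr p \<le> c powr 1" using that assms by (intro powr_mono') auto
    then show ?thesis using that by (simp add: powr_mult mult_right_mono)
  qed
  show ?thesis
  proof (cases "x = 0 \<or> y = 0")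
    case True
    then show ?thesis using *[of u x] *[of v y] assms by auto
  next
    case False
    have "u = 1 - v" using assms by simp
    then show ?thesis
      using convex_onD[OF powr_convex[OF \<open>1 \<le> p\<close>], of v x y] False assms(1-4) by (simp add: less_le)
  qed
qed

text \<open>Convexity of the power applied to the weighted mean of \<open>a/A\<close> and \<open>b/B\<close> with weights proportional to \<open>A\<close> and
\<open>B\<close>. Integrated, it is Minkowski's inequality.\<close>

lemma convex_powr_sum:
  fixes a b A B p :: real
  assumes "0 \<le> a" "0 \<le> b" "0 < A" "0 < B" "1 \<le> p"
  shows "(a + b) powr p \<le> (A + B) powr p * (A / (A + B) * (a powr p / A powr p) + B / (A + B) * (b powr p / B powr p))"
proof -
  have "A / (A + B) * (a / A) + B / (A + B) * (b / B) = (a + b) / (A + B)"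
    using assms by (simp add: add_divide_distrib)
  moreover have "A / (A + B) + B / (A + B) = 1"
    using assms by (simp add: add_divide_distrib[symmetric])
  ultimately have "((a + b) / (A + B)) powr p \<le> A / (A + B) * (a / A) powr p + B / (A + B) * (b / B) powr p"
    using powr_convex_nonneg[of "a / A" "b / B" "A / (A + B)" "B / (A + B)" p] assms by simp
  then have "(A + B) powr p * ((a + b) / (A + B)) powr p
      \<le> (A + B) powr p * (A / (A + B) * (a / A) powr p + B / (A + B) * (b / B) powr p)"
    by (rule mult_left_mono) simp
  then show ?thesis using assms by (simp add: powr_divide)
qed

lemma norm_le_add_pos:
  assumes f: "norm_le s f A" and g: "norm_le s g B" and s: "0 < s" "s \<le> 1" and AB: "0 < A" "0 < B"
  shows "norm_le s (\<lambda>x. f x + g x) (A + B)"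
proof -
  have [measurable]: "f \<in> borel_measurable borel" "g \<in> borel_measurable borel"
    using norm_leD(2)[OF f] norm_leD(2)[OF g] .
  define p where "p = 1 / s"
  have p: "1 \<le> p" using s by (simp add: p_def)
  define cA where "cA = (A + B) powr p * (A / (A + B)) / A powr p"
  define cB where "cB = (A + B) powr p * (B / (A + B)) / B powr p"
  have c0: "0 \<le> cA" "0 \<le> cB" using AB by (auto simp: cA_def cB_def)
  have "\<bar>f x + g x\<bar> powr p \<le> cA * \<bar>f x\<bar> powr p + cB * \<bar>g x\<bar> powr p" for x
  proof -
    have "\<bar>f x + g x\<bar> powr p \<le> (\<bar>f x\<bar> + \<bar>g x\<bar>) powr p" using p by (intro powr_mono2) auto
    also have "\<dots> \<le> cA * \<bar>f x\<bar> powr p + cB * \<bar>g x\<bar> powr p"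
      using convex_powr_sum[OF _ _ AB p, of "\<bar>f x\<bar>" "\<bar>g x\<bar>"] by (simp add: cA_def cB_def algebra_simps)
    finally show ?thesis .
  qed
  then have "(\<integral>\<^sup>+x. ennreal (\<bar>f x + g x\<bar> powr p) \<partial>lborel)
      \<le> (\<integral>\<^sup>+x. ennreal cA * ennreal (\<bar>f x\<bar> powr p) + ennreal cB * ennreal (\<bar>g x\<bar> powr p) \<partial>lborel)"
    using c0 by (intro nn_integral_mono) (simp flip: ennreal_mult ennreal_plus)
  also have "\<dots> = ennreal cA * (\<integral>\<^sup>+x. ennreal (\<bar>f x\<bar> powr p) \<partial>lborel) + ennreal cB * (\<integral>\<^sup>+x. ennreal (\<bar>g x\<bar> powr p) \<partial>lborel)"
    by (subst nn_integral_add) (auto simp: nn_integral_cmult)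
  also have "\<dots> \<le> ennreal cA * ennreal (A powr p) + ennreal cB * ennreal (B powr p)"
    using f g s by (intro add_mono mult_left_mono) (auto simp: norm_le_def p_def)
  also have "\<dots> = ennreal (cA * A powr p + cB * B powr p)"
    using c0 by (simp flip: ennreal_mult ennreal_plus)
  also have "cA * A powr p = (A + B) powr p * (A / (A + B))" unfolding cA_def using AB by simp
  also have "cB * B powr p = (A + B) powr p * (B / (A + B))" unfolding cB_def using AB by simp
  also have "(A + B) powr p * (A / (A + B)) + (A + B) powr p * (B / (A + B))
      = (A + B) powr p * (A / (A + B) + B / (A + B))" by (simp only: distrib_left)
  also have "A / (A + B) + B / (A + B) = 1" using AB by (simp add: add_divide_distrib[symmetric])
  finally show ?thesis using s AB by (simp add: norm_le_def p_def)
qed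

text \<open>The bounds are enlarged slightly to make them positive, and then the enlargement tends to \<open>0\<close>.\<close>

lemma norm_le_add:
  assumes f: "norm_le s f A" and g: "norm_le s g B" and s: "0 < s" "s \<le> 1"
  shows "norm_le s (\<lambda>x. f x + g x) (A + B)"
proof (rule norm_le_limit[where F = "\<lambda>m x. f x + g x" and b = "\<lambda>m. (A + inverse (real (Suc m))) + (B + inverse (real (Suc m)))"])
  show "(\<lambda>x. f x + g x) \<in> borel_measurable borel" using norm_leD(2)[OF f] norm_leD(2)[OF g] by measurable
  show "norm_le s (\<lambda>x. f x + g x) ((A + inverse (real (Suc m))) + (B + inverse (real (Suc m))))" for m
  proof -
    have "0 < inverse (real (Suc m))" by simp
    then show ?thesis using norm_leD(1)[OF f] norm_leD(1)[OF g] s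
      by (intro norm_le_add_pos norm_le_mono[OF f] norm_le_mono[OF g]) linarith+
  qed
  show "(\<lambda>m. (A + inverse (real (Suc m))) + (B + inverse (real (Suc m)))) \<longlonglongrightarrow> A + B"
    using tendsto_add[OF LIMSEQ_inverse_real_of_nat_add LIMSEQ_inverse_real_of_nat_add] by simp
qed (use s in auto)

lemma norm_le_zero: "norm_le s (\<lambda>x. 0) 0"
  by (simp add: norm_le_def)

lemma norm_le_sum:
  assumes "finite I" "\<And>i. i \<in> I \<Longrightarrow> norm_le s (f i) (b i)" and s: "0 < s" "s \<le> 1"
  shows "norm_le s (\<lambda>x. \<Sum>i\<in>I. f i x) (\<Sum>i\<in>I. b i)"
  using assms(1,2) by (induction rule: finite_induct) (auto intro: norm_le_zero norm_le_add s)

lemma continuous_AE_bound: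
  fixes f :: "'a::euclidean_space \<Rightarrow> real"
  assumes c: "continuous_on UNIV f" and ae: "AE x in lborel. \<bar>f x\<bar> \<le> B"
  shows "\<bar>f x\<bar> \<le> B"
proof (rule ccontr)
  assume "\<not> \<bar>f x\<bar> \<le> B"
  let ?U = "{x. B < \<bar>f x\<bar>}"
  have o: "open ?U" by (intro open_Collect_less continuous_intros c)
  have "?U \<in> null_sets lborel"
    using ae o by (subst (asm) AE_iff_null) (auto simp: not_le)
  then have "negligible ?U" by (simp add: negligible_iff_null_sets null_sets_completionI)
  moreover have "?U \<noteq> {}" using \<open>\<not> \<bar>f x\<bar> \<le> B\<close> by (auto simp: not_le)
  ultimately show False using open_not_negligible[OF o] by blast
qed

lemma integrable_powr_test_function:
  assumes v: "test_function v" and s: "0 < s"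
  shows "integrable lborel (\<lambda>x. \<bar>v x\<bar> powr (1 / s))"
proof -
  obtain B where B: "\<And>x. B < norm x \<Longrightarrow> v x = 0" using v by (auto simp: test_function_iff)
  have "continuous_on UNIV (\<lambda>x. \<bar>v x\<bar> powr (1 / s))"
    using v s by (intro continuous_on_powr' continuous_on_rabs continuous_on_const smooth_continuous)
      (auto simp: test_function_iff)
  then show ?thesis by (rule integrable_continuous_compact_support[where R = B]) (use B in auto)
qed

lemma rnorm_le:
  assumes v: "test_function v" and n: "norm_le s v B" and s: "0 \<le> s"
  shows "rnorm s v \<le> B"
proof (cases "s = 0")
  case True
  have "\<bar>v x\<bar> \<le> B" for x
    using continuous_AE_bound[of v B x] v n True by (auto simp: norm_le_def test_function_iff intro: smooth_continuous)
  then show ?thesis unfolding rnorm_def using True by (auto intro!: cSUP_least)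
next
  case False
  then have s: "0 < s" using s by simp
  have B: "0 \<le> B" by (rule norm_leD[OF n])
  have "ennreal (LBINT x. \<bar>v x\<bar> powr (1 / s)) \<le> ennreal (B powr (1 / s))"
    using n s nn_integral_eq_integral[OF integrable_powr_test_function[OF v s]] by (simp add: norm_le_def)
  then have "(LBINT x. \<bar>v x\<bar> powr (1 / s)) powr s \<le> (B powr (1 / s)) powr s"
    using s by (intro powr_mono2) (auto intro!: integral_nonneg_AE)
  then show ?thesis using s B by (simp add: rnorm_def powr_powr)
qed

lemma norm_le_rnorm:
  assumes v: "test_function v" and s: "0 < s" and le: "rnorm s v \<le> B"
  shows "norm_le s v B"
proof -
  have B: "0 \<le> B" using rnorm_nonneg[OF v] le by (rule order_trans)
  let ?I = "LBINT x. \<bar>v x\<bar> powr (1 / s)"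
  have I0: "0 \<le> ?I" by simp
  have "?I = (?I powr s) powr (1 / s)" using s I0 by (simp add: powr_powr)
  also have "\<dots> \<le> B powr (1 / s)" using le s by (intro powr_mono2) (auto simp: rnorm_def)
  finally have "ennreal ?I \<le> ennreal (B powr (1 / s))" by (rule ennreal_leI)
  moreover have "v \<in> borel_measurable borel"
    using v by (intro borel_measurable_continuous_onI) (auto simp: test_function_iff intro: smooth_continuous)
  ultimately show ?thesis
    using s B nn_integral_eq_integral[OF integrable_powr_test_function[OF v s]] by (simp add: norm_le_def)
qed

section \<open>Cutting off smooth functions\<close>

lemma finite_lists_of_length_le: "finite {js :: 'a::finite list. length js \<le> m}"
  using finite_lists_length_le[of "UNIV :: 'a set" m] by simp

text \<open>A common majorant for the terms of all Leibniz rules that occur.\<close>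

definition jet :: "nat \<Rightarrow> (real^'n \<Rightarrow> real) \<Rightarrow> real^'n \<Rightarrow> real" where
  "jet m w x = (\<Sum>js | length js \<le> m. \<bar>partials js w x\<bar>)"

lemma jet_nonneg: "0 \<le> jet m w x"
  unfolding jet_def by (intro sum_nonneg) auto

lemma partials_le_jet: "length is \<le> m \<Longrightarrow> \<bar>partials is w x\<bar> \<le> jet m w x"
  unfolding jet_def by (intro member_le_sum[of "is" _ "\<lambda>js. \<bar>partials js w x\<bar>"] finite_lists_of_length_le) auto

lemma jet_mono: "m \<le> m' \<Longrightarrow> jet m w x \<le> jet m' w x"
  unfolding jet_def by (intro sum_mono2 finite_lists_of_length_le) auto

lemma jet_partial: "jet m (partial i w) x \<le> jet (Suc m) w x"
proof -
  let ?h = "\<lambda>js. js @ [i]" and ?A = "{js :: 'n list. length js \<le> m}"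
  have "jet m (partial i w) x = (\<Sum>js\<in>?h ` ?A. \<bar>partials js w x\<bar>)"
    unfolding jet_def by (subst sum.reindex) (auto simp: inj_on_def partials_append)
  also have "\<dots> \<le> jet (Suc m) w x"
    unfolding jet_def by (intro sum_mono2 finite_lists_of_length_le) auto
  finally show ?thesis .
qed

text \<open>Whenever a derivative falls on the cutoff, the scaling produces a factor \<open>1/R\<close>. The induction removes the last entry of
the list, which is the derivative that acts first, so that the hypothesis applies to two products of the same kind.\<close>

lemma partials_cutoff:
  fixes w \<psi> :: "real^'n \<Rightarrow> real"
  assumes "smooth w" "test_function \<psi>"
  shows "\<exists>K\<ge>0. \<forall>R\<ge>1. \<forall>x. \<bar>partials is (\<lambda>x. \<psi> ((1 / R) *\<^sub>R x) * w x) x - \<psi> ((1 / R) *\<^sub>R x) * partials is w x\<bar>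
           \<le> K / R * jet (length is) w x"
  using assms
proof (induction "is" arbitrary: w \<psi> rule: rev_induct)
  case Nil
  then show ?case by (intro exI[of _ 0]) auto
next
  case (snoc i "is")
  let ?m = "length is"
  note w = snoc.prems(1) and \<psi> = snoc.prems(2)
  have sm: "smooth \<psi>" and w': "smooth (partial i w)" and \<psi>': "test_function (partial i \<psi>)"
    using w \<psi> test_function_partials[of \<psi> "[i]"] by (auto simp: test_function_iff intro: smooth_partial)
  have sm': "smooth (partial i \<psi>)" using sm by (rule smooth_partial)
  have scaled: "smooth (\<lambda>x. f ((1 / R) *\<^sub>R x))" if "smooth f" for f :: "real^'n \<Rightarrow> real" and R
    using smooth_affine[OF that, of "1 / R" 0] by simp
  obtain K1 where K1: "0 \<le> K1" "\<And>R x. 1 \<le> R \<Longrightarrow> \<bar>partials is (\<lambda>x. \<psi> ((1 / R) *\<^sub>R x) * partial i w x) x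
      - \<psi> ((1 / R) *\<^sub>R x) * partials is (partial i w) x\<bar> \<le> K1 / R * jet ?m (partial i w) x"
    using snoc.IH[OF w' \<psi>] by blast
  obtain K2 where K2: "0 \<le> K2" "\<And>R x. 1 \<le> R \<Longrightarrow> \<bar>partials is (\<lambda>x. partial i \<psi> ((1 / R) *\<^sub>R x) * w x) x
      - partial i \<psi> ((1 / R) *\<^sub>R x) * partials is w x\<bar> \<le> K2 / R * jet ?m w x"
    using snoc.IH[OF w \<psi>'] by blast
  obtain M where M: "0 \<le> M" "\<And>x. \<bar>partial i \<psi> x\<bar> \<le> M" using test_function_bounded[OF \<psi>'] by metis
  show ?case
  proof (intro exI[of _ "K1 + (K2 + M)"] conjI allI impI)
    show "0 \<le> K1 + (K2 + M)" using K1 K2 M by simp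
    fix R :: real and x :: "real^'n" assume R: "1 \<le> R"
    let ?J = "jet (Suc ?m) w x"
    have J0: "0 \<le> ?J" by (rule jet_nonneg)
    have a: "smooth (\<lambda>x. \<psi> ((1 / R) *\<^sub>R x) * partial i w x)" by (rule smooth_mult[OF scaled[OF sm] w'])
    have b: "smooth (\<lambda>x. partial i \<psi> ((1 / R) *\<^sub>R x) * w x)" by (rule smooth_mult[OF scaled[OF sm'] w])
    have "partial i (\<lambda>x. \<psi> ((1 / R) *\<^sub>R x)) = (\<lambda>x. (1 / R) * partial i \<psi> ((1 / R) *\<^sub>R x))"
      using partial_affine[OF smooth_differentiable[OF sm], of i "1 / R" 0] by simp
    then have "partial i (\<lambda>x. \<psi> ((1 / R) *\<^sub>R x) * w x)
        = (\<lambda>x. \<psi> ((1 / R) *\<^sub>R x) * partial i w x + (1 / R) * (partial i \<psi> ((1 / R) *\<^sub>R x) * w x))"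
      using partial_mult[OF smooth_differentiable[OF scaled[OF sm]] smooth_differentiable[OF w], where i = i]
      by (simp add: mult.assoc)
    then have "partials (is @ [i]) (\<lambda>x. \<psi> ((1 / R) *\<^sub>R x) * w x) x
        = partials is (\<lambda>x. \<psi> ((1 / R) *\<^sub>R x) * partial i w x) x
          + (1 / R) * partials is (\<lambda>x. partial i \<psi> ((1 / R) *\<^sub>R x) * w x) x"
      by (simp only: partials_append partials_simps partials_add[OF a smooth_mult[OF smooth_const b]] partials_cmult[OF b])
    moreover have "\<bar>partials is (\<lambda>x. \<psi> ((1 / R) *\<^sub>R x) * partial i w x) x
        - \<psi> ((1 / R) *\<^sub>R x) * partials (is @ [i]) w x\<bar> \<le> K1 / R * ?J"
    proof -
      have "K1 / R * jet ?m (partial i w) x \<le> K1 / R * ?J"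
        using K1 R by (intro mult_left_mono jet_partial) auto
      then show ?thesis using K1(2)[OF R, of x] by (simp add: partials_append)
    qed
    moreover have "\<bar>(1 / R) * partials is (\<lambda>x. partial i \<psi> ((1 / R) *\<^sub>R x) * w x) x\<bar> \<le> (K2 + M) / R * ?J"
    proof -
      have "\<bar>partial i \<psi> ((1 / R) *\<^sub>R x) * partials is w x\<bar> \<le> M * ?J"
        unfolding abs_mult using M partials_le_jet[of "is" "Suc ?m" w x] by (intro mult_mono) auto
      moreover have "K2 / R * jet ?m w x \<le> K2 * ?J"
        using K2 R J0 jet_nonneg[of ?m w x] jet_mono[of ?m "Suc ?m" w x]
        by (intro mult_mono) (auto simp: divide_le_eq mult_le_cancel_left1)
      ultimately have "\<bar>partials is (\<lambda>x. partial i \<psi> ((1 / R) *\<^sub>R x) * w x) x\<bar> \<le> (K2 + M) * ?J"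
        using K2(2)[OF R, of x] by (simp add: distrib_right)
      then have "(1 / R) * \<bar>partials is (\<lambda>x. partial i \<psi> ((1 / R) *\<^sub>R x) * w x) x\<bar> \<le> (1 / R) * ((K2 + M) * ?J)"
        using R by (intro mult_left_mono) auto
      then show ?thesis using R by (simp add: abs_mult)
    qed
    ultimately have "\<bar>partials (is @ [i]) (\<lambda>x. \<psi> ((1 / R) *\<^sub>R x) * w x) x - \<psi> ((1 / R) *\<^sub>R x) * partials (is @ [i]) w x\<bar>
        \<le> K1 / R * ?J + (K2 + M) / R * ?J"
      by linarith
    also have "\<dots> = (K1 + (K2 + M)) / R * ?J" by (simp add: add_divide_distrib distrib_right)
    finally show "\<bar>partials (is @ [i]) (\<lambda>x. \<psi> ((1 / R) *\<^sub>R x) * w x) x - \<psi> ((1 / R) *\<^sub>R x) * partials (is @ [i]) w x\<bar>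
        \<le> (K1 + (K2 + M)) / R * jet (length (is @ [i])) w x" by simp
  qed
qed

text \<open>Test functions approximate \<open>w\<close> through cutoffs at radius \<open>m + 1\<close>. The supremum \<open>M\<close> of the cutoff enters the constant
once in total because the two exponents on the right add up to \<open>1\<close>.\<close>

lemma smooth_interpolation:
  fixes s t :: real and j k :: nat
  assumes st: "0 < s" "s \<le> 1" "0 \<le> t" "t \<le> 1" and j: "0 < j" "j < k"
  shows "\<exists>C\<ge>0. \<forall>(w :: real^'n \<Rightarrow> real) b b0 is. smooth w \<longrightarrow> (\<forall>is. length is \<le> k \<longrightarrow> norm_le s (partials is w) (b is)) \<longrightarrow>
     norm_le t w b0 \<longrightarrow> length is = j \<longrightarrow>
     norm_le (real j / real k * s + (1 - real j / real k) * t) (partials is w)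
       (C * ((\<Sum>is | length is = k. b is) powr (real j / real k) * b0 powr (1 - real j / real k)))"
proof -
  define \<theta> where "\<theta> = real j / real k"
  have \<theta>: "0 < \<theta>" "\<theta> < 1" using j by (auto simp: \<theta>_def)
  define \<sigma> where "\<sigma> = \<theta> * s + (1 - \<theta>) * t"
  have \<sigma>: "0 < \<sigma>" unfolding \<sigma>_def using \<theta> st by (intro add_pos_nonneg mult_pos_pos mult_nonneg_nonneg) auto
  define C where "C = (19 * real CARD('n) ^ k) ^ (k * j)"
  have C0: "0 \<le> C" by (simp add: C_def)
  obtain \<phi> :: "real^'n \<Rightarrow> real" where \<phi>: "test_function \<phi>" "0 < \<phi> 0" by (rule test_function_exists)
  define \<psi> where "\<psi> x = \<phi> x / \<phi> 0" for x
  have \<psi>: "test_function \<psi>" and \<psi>0: "\<psi> 0 = 1"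
    using test_function_mult[OF \<phi>(1) smooth_const[of "inverse (\<phi> 0)"]] \<phi>(2)
    by (auto simp: \<psi>_def[abs_def] divide_inverse)
  obtain M where M: "0 \<le> M" "\<And>x. \<bar>\<psi> x\<bar> \<le> M" using test_function_bounded[OF \<psi>] by metis
  have smb: "f \<in> borel_measurable borel" if "smooth f" for f :: "real^'n \<Rightarrow> real"
    using that by (intro borel_measurable_continuous_onI smooth_continuous)
  have main: "norm_le \<sigma> (partials is w) (C * ((\<Sum>is | length is = k. M * b is) powr \<theta> * (M * b0) powr (1 - \<theta>)))"
    if w: "smooth w" and b: "\<And>is. length is \<le> k \<Longrightarrow> norm_le s (partials is w) (b is)"
      and b0: "norm_le t w b0" and "is": "length is = j" for w :: "real^'n \<Rightarrow> real" and b b0 "is"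
  proof -
    define v where "v m x = \<psi> ((1 / real (Suc m)) *\<^sub>R x) * w x" for m x
    have v: "test_function (v m)" for m
      using test_function_mult[OF test_function_affine[OF \<psi>, of "1 / real (Suc m)" 0] w] by (simp add: v_def[abs_def])
    have vs: "smooth (partials js (v m))" for js m
      using v by (auto simp: test_function_iff intro: smooth_partials)
    have "\<forall>js. \<exists>K\<ge>0. \<forall>R\<ge>1. \<forall>x. \<bar>partials js (\<lambda>x. \<psi> ((1 / R) *\<^sub>R x) * w x) x
        - \<psi> ((1 / R) *\<^sub>R x) * partials js w x\<bar> \<le> K / R * jet (length js) w x"
      using partials_cutoff[OF w \<psi>] by (rule allI)
    from choice[OF this] obtain K where K: "\<And>js. 0 \<le> K js" "\<And>js R x. 1 \<le> R \<Longrightarrow>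
        \<bar>partials js (\<lambda>x. \<psi> ((1 / R) *\<^sub>R x) * w x) x - \<psi> ((1 / R) *\<^sub>R x) * partials js w x\<bar> \<le> K js / R * jet (length js) w x"
      by blast
    have Kv: "\<bar>partials js (v m) x - \<psi> ((1 / real (Suc m)) *\<^sub>R x) * partials js w x\<bar> \<le> K js * inverse (real (Suc m)) * jet (length js) w x"
      for js m x
      using K(2)[of "real (Suc m)" js x] by (simp add: v_def[abs_def] divide_inverse)
    define G where "G = (\<Sum>js | length js \<le> k. b js)"
    have jetn: "norm_le s (jet k w) G"
      unfolding jet_def[abs_def] G_def
    proof (intro norm_le_sum finite_lists_of_length_le st)
      fix js :: "'n list" assume "js \<in> {js. length js \<le> k}"
      then show "norm_le s (\<lambda>x. \<bar>partials js w x\<bar>) (b js)"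
        using norm_le_dominated[OF b, of js "\<lambda>x. \<bar>partials js w x\<bar>" 1] st smb[OF smooth_partials[OF w, of js]] by simp
    qed
    \<comment> \<open>Norm bounds for the derivatives of order \<open>k\<close> of the cut-off functions, by Minkowski's inequality.\<close>
    define \<beta> where "\<beta> m js = M * b js + K js * inverse (real (Suc m)) * G" for m js
    have vn: "norm_le s (partials js (v m)) (\<beta> m js)" if l: "length js = k" for js m
    proof -
      have "norm_le s (\<lambda>x. M * \<bar>partials js w x\<bar> + K js * inverse (real (Suc m)) * jet k w x) (\<beta> m js)"
        unfolding \<beta>_def
      proof (intro norm_le_add st)
        show "norm_le s (\<lambda>x. M * \<bar>partials js w x\<bar>) (M * b js)"
          using M st l smb[OF smooth_partials[OF w, of js]] by (intro norm_le_dominated[OF b]) auto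
        show "norm_le s (\<lambda>x. K js * inverse (real (Suc m)) * jet k w x) (K js * inverse (real (Suc m)) * G)"
          using K(1)[of js] st norm_leD(2)[OF jetn] by (intro norm_le_dominated[OF jetn]) (auto simp: abs_mult)
      qed
      moreover have "\<bar>partials js (v m) x\<bar> \<le> 1 * \<bar>M * \<bar>partials js w x\<bar> + K js * inverse (real (Suc m)) * jet k w x\<bar>" for x
      proof -
        have "\<bar>\<psi> ((1 / real (Suc m)) *\<^sub>R x) * partials js w x\<bar> \<le> M * \<bar>partials js w x\<bar>"
          unfolding abs_mult using M by (intro mult_right_mono) auto
        moreover have "\<bar>X\<bar> \<le> 1 * \<bar>P + Q\<bar>" if "\<bar>a\<bar> \<le> P" "\<bar>X - a\<bar> \<le> Q" for X a P Q :: real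
        proof -
          have "\<bar>X\<bar> \<le> P + Q" using that by linarith
          then show ?thesis by simp
        qed
        ultimately show ?thesis using Kv[of js m x, unfolded l] by blast
      qed
      ultimately have "norm_le s (partials js (v m)) (1 * \<beta> m js)"
        using st by (intro norm_le_dominated[of s _ "\<beta> m js"] smb vs AE_I2) auto
      then show ?thesis by simp
    qed
    have v0: "norm_le t (v m) (M * b0)" for m
    proof (rule norm_le_dominated[OF b0])
      show "v m \<in> borel_measurable borel" using vs[of "[]"] smb by simp
      show "AE x in lborel. \<bar>v m x\<bar> \<le> M * \<bar>w x\<bar>"
        unfolding v_def abs_mult using M by (intro AE_I2 mult_right_mono) auto
    qed (use M st in auto)
    have vj: "norm_le \<sigma> (partials is (v m)) (C * ((\<Sum>js | length js = k. \<beta> m js) powr \<theta> * (M * b0) powr (1 - \<theta>)))" for m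
    proof (rule norm_le_rnorm[OF test_function_partials[OF v] \<sigma>])
      have "rnorm \<sigma> (partials is (v m))
          \<le> C * ((\<Sum>js | length js = k. rnorm s (partials js (v m))) powr \<theta> * rnorm t (v m) powr (1 - \<theta>))"
        using test_function_interpolation[OF v st j "is"] by (simp add: \<sigma>_def \<theta>_def C_def)
      also have "\<dots> \<le> C * ((\<Sum>js | length js = k. \<beta> m js) powr \<theta> * (M * b0) powr (1 - \<theta>))"
      proof (intro mult_left_mono mult_mono powr_mono2 sum_mono C0)
        show "rnorm s (partials js (v m)) \<le> \<beta> m js" if "js \<in> {js. length js = k}" for js
          using that st by (intro rnorm_le test_function_partials v vn) auto
        show "rnorm t (v m) \<le> M * b0" using st by (intro rnorm_le v v0) auto
        show "0 \<le> (\<Sum>js | length js = k. rnorm s (partials js (v m)))"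
          by (intro sum_nonneg rnorm_nonneg test_function_partials v)
        show "0 \<le> rnorm t (v m)" by (intro rnorm_nonneg v)
      qed (use \<theta> in auto)
      finally show "rnorm \<sigma> (partials is (v m)) \<le> C * ((\<Sum>js | length js = k. \<beta> m js) powr \<theta> * (M * b0) powr (1 - \<theta>))" .
    qed
    show ?thesis
    proof (rule norm_le_limit[OF smb[OF smooth_partials[OF w]] vj _ _ \<sigma>])
      have inv: "(\<lambda>m. inverse (real (Suc m))) \<longlonglongrightarrow> 0" by (rule LIMSEQ_inverse_real_of_nat)
      have "(\<lambda>m. partials is (v m) x) \<longlonglongrightarrow> partials is w x" for x
      proof -
        have "(\<lambda>m. K is * inverse (real (Suc m)) * jet (length is) w x) \<longlonglongrightarrow> K is * 0 * jet (length is) w x"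
          by (rule tendsto_mult[OF tendsto_mult[OF tendsto_const inv] tendsto_const])
        then have K0: "(\<lambda>m. K is * inverse (real (Suc m)) * jet (length is) w x) \<longlonglongrightarrow> 0" by simp
        have "(\<lambda>m. partials is (v m) x - \<psi> ((1 / real (Suc m)) *\<^sub>R x) * partials is w x) \<longlonglongrightarrow> 0"
          by (rule Lim_null_comparison[OF always_eventually K0]) (simp only: real_norm_def Kv simp_thms)
        moreover have "(\<lambda>m. \<psi> ((1 / real (Suc m)) *\<^sub>R x) * partials is w x) \<longlonglongrightarrow> 1 * partials is w x"
        proof (rule tendsto_mult[OF _ tendsto_const])
          have "(\<lambda>m. inverse (real (Suc m)) *\<^sub>R x) \<longlonglongrightarrow> 0 *\<^sub>R x" by (rule tendsto_scaleR[OF inv tendsto_const])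
          moreover have "isCont \<psi> (0 *\<^sub>R x)"
            using \<psi> by (auto simp: test_function_iff intro: differentiable_imp_continuous_within smooth_differentiable)
          ultimately have "(\<lambda>m. \<psi> (inverse (real (Suc m)) *\<^sub>R x)) \<longlonglongrightarrow> \<psi> (0 *\<^sub>R x)" by (rule isCont_tendsto_compose[rotated])
          then show "(\<lambda>m. \<psi> ((1 / real (Suc m)) *\<^sub>R x)) \<longlonglongrightarrow> 1" by (simp add: \<psi>0 divide_inverse)
        qed
        ultimately have "(\<lambda>m. (partials is (v m) x - \<psi> ((1 / real (Suc m)) *\<^sub>R x) * partials is w x)
            + \<psi> ((1 / real (Suc m)) *\<^sub>R x) * partials is w x) \<longlonglongrightarrow> 0 + 1 * partials is w x"
          by (rule tendsto_add)
        then show ?thesis by simp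
      qed
      then show "AE x in lborel. (\<lambda>m. partials is (v m) x) \<longlonglongrightarrow> partials is w x" by simp
      have "(\<lambda>m. \<beta> m js) \<longlonglongrightarrow> M * b js + K js * 0 * G" for js
        unfolding \<beta>_def by (intro tendsto_add tendsto_const tendsto_mult[OF tendsto_mult[OF tendsto_const inv] tendsto_const])
      then have "(\<lambda>m. \<Sum>js | length js = k. \<beta> m js) \<longlonglongrightarrow> (\<Sum>js | length js = k. M * b js)"
        by (intro tendsto_sum) simp
      moreover have "0 \<le> \<beta> m js" if "length js = k" for m js by (rule norm_leD(1)[OF vn[OF that]])
      ultimately have "(\<lambda>m. (\<Sum>js | length js = k. \<beta> m js) powr \<theta>) \<longlonglongrightarrow> (\<Sum>js | length js = k. M * b js) powr \<theta>"
        using \<theta> by (intro tendsto_powr' tendsto_const) (auto intro!: always_eventually sum_nonneg)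
      then show "(\<lambda>m. C * ((\<Sum>js | length js = k. \<beta> m js) powr \<theta> * (M * b0) powr (1 - \<theta>)))
          \<longlonglongrightarrow> C * ((\<Sum>js | length js = k. M * b js) powr \<theta> * (M * b0) powr (1 - \<theta>))"
        by (intro tendsto_mult tendsto_const)
    qed
  qed
  have "norm_le \<sigma> (partials is w) (C * M * ((\<Sum>is | length is = k. b is) powr \<theta> * b0 powr (1 - \<theta>)))"
    if "smooth w" "\<And>is. length is \<le> k \<Longrightarrow> norm_le s (partials is w) (b is)"
      "norm_le t w b0" "length is = j" for w :: "real^'n \<Rightarrow> real" and b b0 "is"
  proof -
    let ?S = "(\<Sum>is | length is = k. b is)"
    have MM: "M powr \<theta> * M powr (1 - \<theta>) = M" using M by (simp flip: powr_add)
    have "C * ((\<Sum>is | length is = k. M * b is) powr \<theta> * (M * b0) powr (1 - \<theta>))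
        = C * ((M * ?S) powr \<theta> * (M * b0) powr (1 - \<theta>))"
      by (simp only: sum_distrib_left)
    also have "\<dots> = C * (M powr \<theta> * M powr (1 - \<theta>)) * (?S powr \<theta> * b0 powr (1 - \<theta>))"
      by (simp only: powr_mult mult_ac)
    also have "\<dots> = C * M * (?S powr \<theta> * b0 powr (1 - \<theta>))" by (simp only: MM)
    finally have "C * ((\<Sum>is | length is = k. M * b is) powr \<theta> * (M * b0) powr (1 - \<theta>)) = \<dots>" .
    then show ?thesis using main[OF that] by (simp only:)
  qed
  note final = this[unfolded \<sigma>_def \<theta>_def]
  show ?thesis
  proof (intro exI[of _ "C * M"] conjI allI impI)
    show "0 \<le> C * M" using C0 M by simp
  qed (rule final, simp_all)
qed

section \<open>Mollification\<close>

lemma lborel_integral_reflect: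
  fixes f :: "'a::euclidean_space \<Rightarrow> real"
  assumes [measurable]: "f \<in> borel_measurable borel"
  shows "(LBINT y. f (x - y)) = (LBINT y. f y)"
proof -
  have "lborel = distr lborel borel (\<lambda>y. x - y)"
    using lborel_affine[of "-1" x] by (simp add: density_1)
  then have "(LBINT y. f y) = (\<integral>y. f y \<partial>distr lborel borel (\<lambda>y. x - y))"
    by (rule arg_cong)
  also have "\<dots> = (LBINT y. f (x - y))"
    by (rule integral_distr) measurable
  finally show ?thesis by simp
qed

lemma lborel_integral_translate:
  fixes f :: "'a::euclidean_space \<Rightarrow> real"
  assumes [measurable]: "f \<in> borel_measurable borel"
  shows "(LBINT y. f (y - x)) = (LBINT y. f y)"
proof -
  have "(LBINT y. f y) = (\<integral>y. f y \<partial>distr lborel borel ((+) (- x)))"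
    by (simp only: lborel_distr_plus)
  also have "\<dots> = (LBINT y. f (y - x))"
    by (subst integral_distr) simp_all
  finally show ?thesis by simp
qed

definition mollifier :: "(real^'n \<Rightarrow> real) \<Rightarrow> real \<Rightarrow> bool" where
  "mollifier \<rho> e \<longleftrightarrow> test_function \<rho> \<and> (\<forall>x. 0 \<le> \<rho> x) \<and> (LBINT x. \<rho> x) = 1 \<and> (\<forall>x. e < norm x \<longrightarrow> \<rho> x = 0)"

lemma mollifier_exists:
  assumes e: "0 < e" obtains \<rho> :: "real^'n \<Rightarrow> real" where "mollifier \<rho> e"
proof -
  obtain \<phi> :: "real^'n \<Rightarrow> real" where \<phi>: "test_function \<phi>" "\<And>x. 0 \<le> \<phi> x" "0 < \<phi> 0" by (rule test_function_exists) (rule that)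
  obtain B where B: "\<And>x. B < norm x \<Longrightarrow> \<phi> x = 0" using \<phi>(1) by (auto simp: test_function_iff)
  define c where "c = (\<bar>B\<bar> + 1) / e"
  have c: "0 < c" using e by (simp add: c_def)
  define \<psi> where "\<psi> x = \<phi> (c *\<^sub>R x)" for x
  have \<psi>: "test_function \<psi>" using test_function_affine[OF \<phi>(1), of c 0] c by (simp add: \<psi>_def[abs_def])
  have \<psi>0: "\<psi> x = 0" if "e < norm x" for x
  proof -
    have "c * e < c * norm x" using that c by simp
    then have "B < norm (c *\<^sub>R x)" using c e by (simp add: c_def)
    then show ?thesis by (simp add: \<psi>_def B)
  qed
  have cont: "continuous_on UNIV \<psi>" using \<psi> by (auto simp: test_function_iff intro: smooth_continuous)
  have int: "integrable lborel \<psi>" using cont \<psi>0 by (rule integrable_continuous_compact_support)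
  have \<psi>nn: "0 \<le> \<psi> x" for x using \<phi>(2) by (simp add: \<psi>_def)
  let ?I = "LBINT x. \<psi> x"
  have "?I \<noteq> 0"
  proof
    assume "?I = 0"
    then have "AE x in lborel. \<psi> x = 0"
      using integral_nonneg_eq_0_iff_AE[OF int] \<psi>nn by simp
    then have "AE x in lborel. \<bar>\<psi> x\<bar> \<le> 0" by eventually_elim simp
    then show False using continuous_AE_bound[OF cont, of 0 0] \<phi>(3) by (simp add: \<psi>_def)
  qed
  moreover have "0 \<le> ?I" using \<psi>nn by simp
  ultimately have I: "0 < ?I" by simp
  have "mollifier (\<lambda>x. \<psi> x * inverse ?I) e"
    unfolding mollifier_def
    using test_function_mult[OF \<psi> smooth_const, of "inverse ?I"] \<psi>nn \<psi>0 I by simp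
  then show thesis by (rule that)
qed

definition conv :: "(real^'n \<Rightarrow> real) \<Rightarrow> (real^'n \<Rightarrow> real) \<Rightarrow> real^'n \<Rightarrow> real" where
  "conv f \<rho> x = (LBINT y. f y * \<rho> (x - y))"

lemma test_function_measurable: "test_function \<rho> \<Longrightarrow> \<rho> \<in> borel_measurable borel"
  by (intro borel_measurable_continuous_onI) (auto simp: test_function_iff intro: smooth_continuous)

lemma mollifierD:
  assumes "mollifier \<rho> e"
  shows "test_function \<rho>" "0 \<le> \<rho> x" "(LBINT x. \<rho> x) = 1" "e < norm x \<Longrightarrow> \<rho> x = 0"
    "\<rho> \<in> borel_measurable borel" "integrable lborel \<rho>"
proof -
  show *: "test_function \<rho>" "0 \<le> \<rho> x" "(LBINT x. \<rho> x) = 1" "e < norm x \<Longrightarrow> \<rho> x = 0"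
    using assms by (auto simp: mollifier_def)
  then show "\<rho> \<in> borel_measurable borel" by (intro test_function_measurable)
  have "(LBINT x. \<rho> x) \<noteq> 0" using *(3) by simp
  then show "integrable lborel \<rho>" using not_integrable_integral_eq by blast
qed

text \<open>Fubini's theorem for the integrable function \<open>f y \<rho>(x - y)\<close> on the product space.\<close>

lemma conv_integrable:
  assumes f: "integrable lborel f" and r: "mollifier \<rho> e"
  shows "integrable lborel (conv f \<rho>)" "(LBINT x. conv f \<rho> x) = (LBINT x. f x)"
    "(LBINT x. \<bar>conv f \<rho> x\<bar>) \<le> (LBINT x. \<bar>f x\<bar>)"
proof -
  have [measurable]: "f \<in> borel_measurable borel" "\<rho> \<in> borel_measurable borel"
    using f mollifierD(5)[OF r] by auto
  have \<rho>1: "(LBINT x. \<rho> (x - y)) = 1" for y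
    using lborel_integral_translate[of \<rho> y] mollifierD(3)[OF r] by simp
  have \<rho>i: "integrable lborel (\<lambda>x. \<rho> (x - y))" for y
    using \<rho>1[of y] not_integrable_integral_eq[of lborel "\<lambda>x. \<rho> (x - y)"] by fastforce
  have main: "integrable lborel (conv g \<rho>) \<and> (LBINT x. conv g \<rho> x) = (LBINT x. g x)"
    if g: "integrable lborel g" for g
  proof -
    have [measurable]: "g \<in> borel_measurable borel" using g by auto
    let ?F = "\<lambda>(y, x). g y * \<rho> (x - y)"
    have "integrable (lborel \<Otimes>\<^sub>M lborel) ?F"
    proof (rule lborel_pair.Fubini_integrable)
      show "?F \<in> borel_measurable (lborel \<Otimes>\<^sub>M lborel)" by measurable
      have "(\<integral>x. norm (?F (y, x)) \<partial>lborel) = \<bar>g y\<bar>" for y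
      proof -
        have "(\<integral>x. norm (?F (y, x)) \<partial>lborel) = (LBINT x. \<bar>g y\<bar> * \<rho> (x - y))"
          using mollifierD(2)[OF r] by (intro Bochner_Integration.integral_cong) (auto simp: abs_mult)
        then show ?thesis using \<rho>1 by simp
      qed
      then show "integrable lborel (\<lambda>y. \<integral>x. norm (?F (y, x)) \<partial>lborel)" using g by simp
      show "AE y in lborel. integrable lborel (\<lambda>x. ?F (y, x))" using \<rho>i by simp
    qed
    then have F: "integrable (lborel \<Otimes>\<^sub>M lborel) (case_prod (\<lambda>y x. g y * \<rho> (x - y)))" by simp
    have "integrable lborel (conv g \<rho>)"
      using lborel_pair.integrable_snd[OF F] by (simp add: conv_def[abs_def])
    moreover have "(LBINT x. conv g \<rho> x) = (LBINT y. (LBINT x. g y * \<rho> (x - y)))"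
      using lborel_pair.Fubini_integral[OF F] by (simp add: conv_def[abs_def])
    ultimately show ?thesis using \<rho>1 by simp
  qed
  show "integrable lborel (conv f \<rho>)" "(LBINT x. conv f \<rho> x) = (LBINT x. f x)" using main[OF f] by auto
  have fa: "integrable lborel (\<lambda>x. \<bar>f x\<bar>)" using f by simp
  have "\<bar>conv f \<rho> x\<bar> \<le> conv (\<lambda>y. \<bar>f y\<bar>) \<rho> x" for x
  proof -
    have "\<bar>conv f \<rho> x\<bar> \<le> (LBINT y. \<bar>f y * \<rho> (x - y)\<bar>)" unfolding conv_def by (rule integral_abs_bound)
    also have "\<dots> = conv (\<lambda>y. \<bar>f y\<bar>) \<rho> x"
      unfolding conv_def using mollifierD(2)[OF r] by (simp add: abs_mult)
    finally show ?thesis .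
  qed
  then have "(LBINT x. \<bar>conv f \<rho> x\<bar>) \<le> (LBINT x. conv (\<lambda>y. \<bar>f y\<bar>) \<rho> x)"
    using main[OF f] main[OF fa] by (intro integral_mono) auto
  then show "(LBINT x. \<bar>conv f \<rho> x\<bar>) \<le> (LBINT x. \<bar>f x\<bar>)" using main[OF fa] by simp
qed

text \<open>Local integrability with respect to \<open>lborel\<close> for Borel functions. Fubini's theorem is used on products of \<open>lborel\<close>, so
Lebesgue measurable functions are replaced by Borel representatives.\<close>

definition loc_int :: "('a::euclidean_space \<Rightarrow> real) \<Rightarrow> bool" where
  "loc_int f \<longleftrightarrow> f \<in> borel_measurable borel \<and> (\<forall>R. integrable lborel (\<lambda>x. indicator (cball 0 R) x * f x))"

lemma loc_intD:
  assumes "loc_int f" shows "f \<in> borel_measurable borel" "integrable lborel (\<lambda>x. indicator (cball 0 R) x * f x)"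
  using assms by (auto simp: loc_int_def)

lemma loc_int_mult_bounded:
  fixes f g :: "'a::euclidean_space \<Rightarrow> real"
  assumes f: "loc_int f" and [measurable]: "g \<in> borel_measurable borel"
    and bd: "\<And>x. \<bar>g x\<bar> \<le> M" and 0: "\<And>x. R < norm x \<Longrightarrow> g x = 0"
  shows "integrable lborel (\<lambda>x. f x * g x)"
proof (rule Bochner_Integration.integrable_bound)
  show "integrable lborel (\<lambda>x. M * (indicator (cball 0 R) x * f x))" using loc_intD(2)[OF f] by simp
  show "(\<lambda>x. f x * g x) \<in> borel_measurable lborel" using loc_intD(1)[OF f] by measurable
  have "\<bar>f x * g x\<bar> \<le> \<bar>M * (indicator (cball 0 R) x * f x)\<bar>" for x
  proof (cases "R < norm x")
    case False
    then have "\<bar>f x * g x\<bar> \<le> \<bar>f x\<bar> * \<bar>M\<bar>" unfolding abs_mult using bd[of x] by (intro mult_left_mono) auto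
    then show ?thesis using False by (simp add: abs_mult mult.commute)
  qed (simp add: 0)
  then show "AE x in lborel. norm (f x * g x) \<le> norm (M * (indicator (cball 0 R) x * f x))" by simp
qed

lemma conv_integrand:
  fixes f \<rho> :: "real^'n \<Rightarrow> real"
  assumes f: "loc_int f" and r: "test_function \<rho>"
  shows "integrable lborel (\<lambda>y. f y * \<rho> (x - y))"
proof -
  have [measurable]: "\<rho> \<in> borel_measurable borel" by (rule test_function_measurable[OF r])
  obtain M where M: "\<And>x. \<bar>\<rho> x\<bar> \<le> M" using test_function_bounded[OF r] by metis
  obtain B where B: "\<And>x. B < norm x \<Longrightarrow> \<rho> x = 0" using r by (auto simp: test_function_iff)
  show ?thesis
  proof (rule loc_int_mult_bounded[OF f, where M = M and R = "B + norm x"])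
    fix y :: "real^'n" assume "B + norm x < norm y"
    then have "B < norm (x - y)" using norm_triangle_ineq2[of y x] by (simp add: norm_minus_commute)
    then show "\<rho> (x - y) = 0" by (rule B)
  qed (use M in auto)
qed

text \<open>Jensen's inequality in the form of Hoelder's inequality with the weight \<open>\<rho>(x - y) dy\<close> of total mass \<open>1\<close> bounds the power of the
mollified function by the mollified power, whose integral is known.\<close>

lemma mollify_norm_le:
  assumes n: "norm_le s f B" and f: "loc_int f" and r: "mollifier \<rho> e" and s: "0 \<le> s" "s \<le> 1"
    and m: "conv f \<rho> \<in> borel_measurable borel"
  shows "norm_le s (conv f \<rho>) B"
proof -
  have [measurable]: "f \<in> borel_measurable borel" "\<rho> \<in> borel_measurable borel"
    using mollifierD(5)[OF r] norm_leD[OF n] by auto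
  have B: "0 \<le> B" by (rule norm_leD[OF n])
  note \<rho>0 = mollifierD(2)[OF r]
  have \<rho>1: "(LBINT y. \<rho> (x - y)) = 1" for x
    using lborel_integral_reflect[of \<rho> x] mollifierD(3)[OF r] by simp
  have \<rho>i: "integrable lborel (\<lambda>y. \<rho> (x - y))" for x
    using \<rho>1[of x] not_integrable_integral_eq[of lborel "\<lambda>y. \<rho> (x - y)"] by fastforce
  have int: "integrable lborel (\<lambda>y. f y * \<rho> (x - y))" for x
    by (rule conv_integrand[OF f mollifierD(1)[OF r]])
  have absb: "\<bar>conv f \<rho> x\<bar> \<le> (LBINT y. \<bar>f y\<bar> * \<rho> (x - y))" for x
  proof -
    have "\<bar>conv f \<rho> x\<bar> \<le> (LBINT y. \<bar>f y * \<rho> (x - y)\<bar>)" unfolding conv_def by (rule integral_abs_bound)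
    then show ?thesis using \<rho>0 by (simp add: abs_mult)
  qed
  have inta: "integrable lborel (\<lambda>y. \<bar>f y\<bar> * \<rho> (x - y))" for x
    using integrable_abs[OF int[of x]] \<rho>0 by (simp add: abs_mult)
  show ?thesis
  proof (cases "s = 0")
    case True
    have "\<bar>conv f \<rho> x\<bar> \<le> B" for x
    proof -
      have "(LBINT y. \<bar>f y\<bar> * \<rho> (x - y)) \<le> (LBINT y. B * \<rho> (x - y))"
      proof (rule integral_mono_AE[OF inta])
        have "AE y in lborel. \<bar>f y\<bar> \<le> B" using n True by (simp add: norm_le_def)
        then show "AE y in lborel. \<bar>f y\<bar> * \<rho> (x - y) \<le> B * \<rho> (x - y)"
          by eventually_elim (intro mult_right_mono \<rho>0)
      qed (use \<rho>i in simp)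
      also have "\<dots> = B" using \<rho>1 by simp
      finally show ?thesis using absb[of x] by linarith
    qed
    then show ?thesis using True B m by (simp add: norm_le_def)
  next
    case False
    then have s0: "0 < s" using s by simp
    define g where "g y = \<bar>f y\<bar> powr (1 / s)" for y
    have [measurable]: "g \<in> borel_measurable borel" unfolding g_def by measurable
    have g0: "0 \<le> g y" for y by (simp add: g_def)
    have gle: "(\<integral>\<^sup>+y. ennreal (g y) \<partial>lborel) \<le> ennreal (B powr (1 / s))"
      using n s0 by (simp add: norm_le_def g_def)
    have gi: "integrable lborel g"
      using gle g0 by (intro integrableI_bounded) (auto intro: le_less_trans)
    have pt: "\<bar>conv f \<rho> x\<bar> powr (1 / s) \<le> conv g \<rho> x" for x
    proof -
      have gx: "integrable lborel (\<lambda>y. g y * \<rho> (x - y))"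
      proof -
        obtain M where M: "\<And>x. \<bar>\<rho> x\<bar> \<le> M" using test_function_bounded[OF mollifierD(1)[OF r]] by metis
        show ?thesis
        proof (rule Bochner_Integration.integrable_bound)
          show "integrable lborel (\<lambda>y. M * g y)" using gi by simp
          show "AE y in lborel. norm (g y * \<rho> (x - y)) \<le> norm (M * g y)"
          proof (rule AE_I2)
            fix y
            have "\<bar>\<rho> (x - y)\<bar> \<le> \<bar>M\<bar>" using M[of "x - y"] by linarith
            then show "norm (g y * \<rho> (x - y)) \<le> norm (M * g y)"
              using g0[of y] mult_right_mono[of "\<bar>\<rho> (x - y)\<bar>" "\<bar>M\<bar>" "g y"] by (simp add: abs_mult mult.commute)
          qed
        qed measurable
      qed
      have "(LBINT y. \<bar>f y\<bar> * \<rho> (x - y)) = (LBINT y. (g y * \<rho> (x - y)) powr s * \<rho> (x - y) powr (1 - s))"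
      proof (intro Bochner_Integration.integral_cong refl)
        fix y
        show "\<bar>f y\<bar> * \<rho> (x - y) = (g y * \<rho> (x - y)) powr s * \<rho> (x - y) powr (1 - s)"
          using s0 \<rho>0[of "x - y"] by (cases "\<rho> (x - y) = 0") (auto simp: g_def powr_mult powr_powr powr_add[symmetric] mult.assoc)
      qed
      also have "\<dots> \<le> (LBINT y. g y * \<rho> (x - y)) powr s * (LBINT y. \<rho> (x - y)) powr (1 - s)"
        using g0 \<rho>0 s by (intro Holder_powr gx \<rho>i) auto
      also have "\<dots> = conv g \<rho> x powr s" using \<rho>1 by (simp add: conv_def)
      finally have "\<bar>conv f \<rho> x\<bar> powr (1 / s) \<le> (conv g \<rho> x powr s) powr (1 / s)"
        using absb[of x] s0 by (intro powr_mono2) auto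
      also have "\<dots> = conv g \<rho> x"
        using s0 g0 \<rho>0 by (simp add: powr_powr conv_def)
      finally show ?thesis .
    qed
    have "(\<integral>\<^sup>+x. ennreal (\<bar>conv f \<rho> x\<bar> powr (1 / s)) \<partial>lborel) \<le> (\<integral>\<^sup>+x. ennreal (conv g \<rho> x) \<partial>lborel)"
      by (intro nn_integral_mono ennreal_leI pt)
    also have "\<dots> = ennreal (LBINT x. conv g \<rho> x)"
      using g0 \<rho>0 by (intro nn_integral_eq_integral conv_integrable(1)[OF gi r]) (auto simp: conv_def)
    also have "\<dots> = ennreal (LBINT y. g y)" using conv_integrable(2)[OF gi r] by simp
    also have "\<dots> = (\<integral>\<^sup>+y. ennreal (g y) \<partial>lborel)" using g0 by (intro nn_integral_eq_integral[symmetric] gi) auto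
    also have "\<dots> \<le> ennreal (B powr (1 / s))" by (rule gle)
    finally show ?thesis using s0 B m by (simp add: norm_le_def)
  qed
qed

lemma conv_eq_const:
  assumes r: "mollifier \<rho> e" and c: "\<And>y. dist x y \<le> e \<Longrightarrow> f y = c"
  shows "conv f \<rho> x = c"
proof -
  have *: "f y * \<rho> (x - y) = c * \<rho> (x - y)" for y
    using c[of y] mollifierD(4)[OF r, of "x - y"] by (cases "dist x y \<le> e") (auto simp: dist_norm)
  have "conv f \<rho> x = c * (LBINT y. \<rho> (x - y))" unfolding conv_def * by simp
  also have "(LBINT y. \<rho> (x - y)) = 1"
    using lborel_integral_reflect[OF mollifierD(5)[OF r], of x] mollifierD(3)[OF r] by simp
  finally show ?thesis by simp
qed

lemma conv_indicator_bounds: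
  assumes r: "mollifier \<rho> e" and [measurable]: "A \<in> sets borel"
  shows "0 \<le> conv (indicator A) \<rho> x" "conv (indicator A) \<rho> x \<le> 1"
proof -
  have [measurable]: "\<rho> \<in> borel_measurable borel" by (rule mollifierD(5)[OF r])
  have \<rho>1: "(LBINT y. \<rho> (x - y)) = 1"
    using lborel_integral_reflect[of \<rho> x] mollifierD(3)[OF r] by simp
  have \<rho>i: "integrable lborel (\<lambda>y. \<rho> (x - y))"
    using \<rho>1 not_integrable_integral_eq[of lborel "\<lambda>y. \<rho> (x - y)"] by fastforce
  show "0 \<le> conv (indicator A) \<rho> x" using mollifierD(2)[OF r] by (simp add: conv_def)
  have "conv (indicator A) \<rho> x \<le> (LBINT y. \<rho> (x - y))"
    unfolding conv_def
  proof (rule integral_mono[OF _ \<rho>i])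
    show "integrable lborel (\<lambda>y. indicator A y * \<rho> (x - y))"
      using integrable_mult_indicator[of A lborel, OF _ \<rho>i] by simp
    show "indicator A y * \<rho> (x - y) \<le> \<rho> (x - y)" for y
      using mollifierD(2)[OF r] by (auto simp: indicator_def)
  qed
  then show "conv (indicator A) \<rho> x \<le> 1" using \<rho>1 by simp
qed

lemma conv_add:
  assumes "integrable lborel (\<lambda>y. f y * \<rho> (x - y))" "integrable lborel (\<lambda>y. g y * \<rho> (x - y))"
  shows "conv (\<lambda>y. f y + g y) \<rho> x = conv f \<rho> x + conv g \<rho> x"
  using assms by (simp add: conv_def distrib_right)

lemma conv_diff:
  assumes "integrable lborel (\<lambda>y. f y * \<rho> (x - y))" "integrable lborel (\<lambda>y. g y * \<rho> (x - y))"
  shows "conv (\<lambda>y. f y - g y) \<rho> x = conv f \<rho> x - conv g \<rho> x"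
  using assms by (simp add: conv_def left_diff_distrib)

lemma loc_int_integrable:
  assumes "integrable lborel f" shows "loc_int f"
  unfolding loc_int_def
proof (intro conjI allI)
  show "f \<in> borel_measurable borel" using assms by auto
  show "integrable lborel (\<lambda>x. indicator (cball 0 R) x * f x)" for R
    using integrable_mult_indicator[of "cball 0 R" lborel, OF _ assms] by simp
qed

text \<open>Mollification is a contraction in \<open>L\<^sup>1\<close>, so an error in \<open>f\<close> enters at most twice.\<close>

lemma mollify_err_stable:
  assumes f: "integrable lborel f" and g: "integrable lborel g" and r: "mollifier \<rho> e"
  shows "(LBINT x. \<bar>conv f \<rho> x - f x\<bar>) \<le> (LBINT x. \<bar>conv g \<rho> x - g x\<bar>) + 2 * (LBINT x. \<bar>f x - g x\<bar>)"
proof -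
  have fg: "integrable lborel (\<lambda>x. f x - g x)" using f g by simp
  have ci: "integrable lborel (conv f \<rho>)" "integrable lborel (conv g \<rho>)" "integrable lborel (conv (\<lambda>x. f x - g x) \<rho>)"
    using conv_integrable(1)[OF _ r] f g fg by auto
  have "\<bar>conv f \<rho> x - f x\<bar> \<le> \<bar>conv g \<rho> x - g x\<bar> + (\<bar>conv (\<lambda>x. f x - g x) \<rho> x\<bar> + \<bar>f x - g x\<bar>)" for x
  proof -
    note i = conv_integrand[OF loc_int_integrable mollifierD(1)[OF r], where x = x]
    show ?thesis using conv_diff[OF i[OF f] i[OF g]] by simp
  qed
  then have "(LBINT x. \<bar>conv f \<rho> x - f x\<bar>)
      \<le> (LBINT x. \<bar>conv g \<rho> x - g x\<bar> + (\<bar>conv (\<lambda>x. f x - g x) \<rho> x\<bar> + \<bar>f x - g x\<bar>))"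
    using f g ci by (intro integral_mono) auto
  also have "\<dots> = (LBINT x. \<bar>conv g \<rho> x - g x\<bar>) + ((LBINT x. \<bar>conv (\<lambda>x. f x - g x) \<rho> x\<bar>) + (LBINT x. \<bar>f x - g x\<bar>))"
    using f g ci by simp
  also have "(LBINT x. \<bar>conv (\<lambda>x. f x - g x) \<rho> x\<bar>) \<le> (LBINT x. \<bar>f x - g x\<bar>)"
    by (rule conv_integrable(3)[OF fg r])
  finally show ?thesis by simp
qed

lemma tendsto_zero_approx:
  fixes E :: "nat \<Rightarrow> real"
  assumes nn: "\<And>m. 0 \<le> E m"
    and ap: "\<And>\<epsilon>. 0 < \<epsilon> \<Longrightarrow> \<exists>F. F \<longlonglongrightarrow> 0 \<and> (\<forall>m. E m \<le> F m + \<epsilon>)"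
  shows "E \<longlonglongrightarrow> 0"
proof (rule LIMSEQ_I)
  fix r :: real assume "0 < r"
  then obtain F where F: "F \<longlonglongrightarrow> 0" "\<And>m. E m \<le> F m + r / 2" using ap[of "r / 2"] by auto
  obtain N where "\<And>m. N \<le> m \<Longrightarrow> \<bar>F m\<bar> < r / 2"
    using LIMSEQ_D[OF F(1), of "r / 2"] \<open>0 < r\<close> by auto
  then have "\<bar>E m\<bar> < r" if "N \<le> m" for m using F(2)[of m] nn[of m] that by fastforce
  then show "\<exists>N. \<forall>m\<ge>N. norm (E m - 0) < r" by auto
qed

text \<open>At a point of \<open>U\<close> the mollified indicator is eventually \<open>1\<close>. Outside of \<open>U\<close> no pointwise information is needed: since
the indicator of \<open>U\<close> and its mollification have the same total mass, the mass that has leaked out of \<open>U\<close> equals the deficit inside.\<close>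

lemma mollify_indicator_open:
  fixes \<rho> :: "nat \<Rightarrow> real^'n \<Rightarrow> real"
  assumes r: "\<And>m. mollifier (\<rho> m) (e m)" and e: "e \<longlonglongrightarrow> 0"
    and U: "open U" "emeasure lborel U < \<infinity>"
  shows "(\<lambda>m. LBINT x. \<bar>conv (indicator U) (\<rho> m) x - indicator U x\<bar>) \<longlonglongrightarrow> 0"
proof -
  have [measurable]: "U \<in> sets borel" using U by simp
  have iU: "integrable lborel (indicat_real U)" using U by (simp add: integrable_indicator_iff)
  note ci = conv_integrable[OF iU r]
  note cb = conv_indicator_bounds[OF r \<open>U \<in> sets borel\<close>]
  let ?h = "\<lambda>m x. indicat_real U x * (1 - conv (indicator U) (\<rho> m) x)"
  have hi: "integrable lborel (?h m)" for m
    using integrable_mult_indicator[of U lborel, OF _ ci(1)[of m]] iU by (simp add: right_diff_distrib)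
  have eq: "(LBINT x. \<bar>conv (indicator U) (\<rho> m) x - indicator U x\<bar>) = 2 * (LBINT x. ?h m x)" for m
  proof -
    \<comment> \<open>The first summand has integral \<open>0\<close>, and the deficit \<open>?h\<close> is dominated by the indicator of \<open>U\<close>.\<close>
    have "\<bar>conv (indicator U) (\<rho> m) x - indicator U x\<bar> = (conv (indicator U) (\<rho> m) x - indicator U x) + 2 * ?h m x" for x
      using cb[of m x] by (auto simp: indicator_def)
    then have "(LBINT x. \<bar>conv (indicator U) (\<rho> m) x - indicator U x\<bar>)
        = (LBINT x. (conv (indicator U) (\<rho> m) x - indicator U x) + 2 * ?h m x)" by simp
    also have "\<dots> = (LBINT x. conv (indicator U) (\<rho> m) x) - (LBINT x. indicator U x) + 2 * (LBINT x. ?h m x)"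
      using ci(1)[of m] iU hi[of m] by simp
    finally show ?thesis using ci(2)[of m] by simp
  qed
  have "(\<lambda>m. LBINT x. ?h m x) \<longlonglongrightarrow> (LBINT x::real^'n. (0::real))"
  proof (rule integral_dominated_convergence[where w = "indicat_real U"])
    show "(\<lambda>x. 0::real) \<in> borel_measurable lborel" by simp
    show "?h m \<in> borel_measurable lborel" for m using hi by auto
    show "AE x in lborel. norm (?h m x) \<le> indicat_real U x" for m
      using cb[of m] by (auto simp: indicator_def)
    show "AE x in lborel. (\<lambda>m. ?h m x) \<longlonglongrightarrow> 0"
    proof (rule AE_I2)
      fix x
      show "(\<lambda>m. ?h m x) \<longlonglongrightarrow> 0"
      proof (cases "x \<in> U")
        case True
        then obtain d where d: "0 < d" "cball x d \<subseteq> U" using U(1) open_contains_cball by blast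
        have "eventually (\<lambda>m. e m < d) sequentially" using order_tendstoD(2)[OF e d(1)] .
        then have "eventually (\<lambda>m. ?h m x = 0) sequentially"
        proof eventually_elim
          fix m assume "e m < d"
          then have "conv (indicator U) (\<rho> m) x = 1"
            using d by (intro conv_eq_const[OF r]) (auto simp: indicator_def subset_iff)
          then show "?h m x = 0" by simp
        qed
        then show ?thesis by (rule tendsto_eventually)
      qed simp
    qed
  qed (use iU in simp)
  then have "(\<lambda>m. 2 * (LBINT x. ?h m x)) \<longlonglongrightarrow> 2 * 0"
    by (intro tendsto_mult tendsto_const) simp
  then show ?thesis by (simp only: eq mult_zero_right)
qed

text \<open>Open sets of finite measure approximate measurable ones from outside, and the error is stable under limits in
\<open>L\<^sup>1\<close>.\<close>

lemma mollify_L1: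
  fixes \<rho> :: "nat \<Rightarrow> real^'n \<Rightarrow> real"
  assumes f: "integrable lborel f" and r: "\<And>m. mollifier (\<rho> m) (e m)" and e: "e \<longlonglongrightarrow> 0"
  shows "(\<lambda>m. LBINT x. \<bar>conv f (\<rho> m) x - f x\<bar>) \<longlonglongrightarrow> 0"
  using f
proof (induction rule: integrable_induct)
  case (base A c)
  have A[measurable]: "A \<in> sets borel" using base by simp
  have iA: "integrable lborel (indicat_real A)" using base by (simp add: integrable_indicator_iff)
  have "(\<lambda>m. LBINT x. \<bar>conv (indicator A) (\<rho> m) x - indicator A x\<bar>) \<longlonglongrightarrow> 0"
  proof (rule tendsto_zero_approx)
    fix \<epsilon> :: real assume \<epsilon>: "0 < \<epsilon>"
    have AL: "A \<in> sets lebesgue" using A by simp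
    obtain U where U: "open U" "A \<subseteq> U" "emeasure lebesgue (U - A) < ennreal (\<epsilon> / 2)"
      by (rule sets_lebesgue_outer_open[OF AL half_gt_zero[OF \<epsilon>]]) (rule that)
    have [measurable]: "U \<in> sets borel" using U by simp
    have UA: "emeasure lborel (U - A) < ennreal (\<epsilon> / 2)" using U(3) by simp
    have "emeasure lborel U = emeasure lborel A + emeasure lborel (U - A)"
      using U(2) by (subst plus_emeasure) (auto intro!: arg_cong[of _ _ "emeasure lborel"])
    then have Ufin: "emeasure lborel U < \<infinity>"
      using base(2) UA by (auto simp: less_top intro: less_trans)
    have iU: "integrable lborel (indicat_real U)" using Ufin by (simp add: integrable_indicator_iff)
    have "(LBINT x. \<bar>indicat_real A x - indicat_real U x\<bar>) = (LBINT x. indicat_real (U - A) x)"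
      using U(2) by (intro Bochner_Integration.integral_cong) (auto simp: indicator_def)
    also have "\<dots> = measure lborel (U - A)" by simp
    also have "\<dots> \<le> \<epsilon> / 2"
    proof -
      have "enn2real (emeasure lborel (U - A)) \<le> enn2real (ennreal (\<epsilon> / 2))"
        using UA by (intro enn2real_mono) auto
      then show ?thesis using \<epsilon> by (simp add: measure_def)
    qed
    finally have small: "2 * (LBINT x. \<bar>indicat_real A x - indicat_real U x\<bar>) \<le> \<epsilon>" by simp
    show "\<exists>F. F \<longlonglongrightarrow> 0 \<and> (\<forall>m. (LBINT x. \<bar>conv (indicator A) (\<rho> m) x - indicator A x\<bar>) \<le> F m + \<epsilon>)"
    proof (intro exI conjI allI)
      show "(\<lambda>m. LBINT x. \<bar>conv (indicator U) (\<rho> m) x - indicator U x\<bar>) \<longlonglongrightarrow> 0"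
        by (rule mollify_indicator_open[OF r e U(1) Ufin])
      show "(LBINT x. \<bar>conv (indicator A) (\<rho> m) x - indicator A x\<bar>)
          \<le> (LBINT x. \<bar>conv (indicator U) (\<rho> m) x - indicator U x\<bar>) + \<epsilon>" for m
        using mollify_err_stable[OF iA iU r, of m] small by linarith
    qed
  qed simp
  then have "(\<lambda>m. \<bar>c\<bar> * (LBINT x. \<bar>conv (indicator A) (\<rho> m) x - indicator A x\<bar>)) \<longlonglongrightarrow> \<bar>c\<bar> * 0"
    by (intro tendsto_mult tendsto_const)
  moreover have "(LBINT x. \<bar>conv (\<lambda>x. indicat_real A x *\<^sub>R c) (\<rho> m) x - indicat_real A x *\<^sub>R c\<bar>)
      = \<bar>c\<bar> * (LBINT x. \<bar>conv (indicator A) (\<rho> m) x - indicator A x\<bar>)" for m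
  proof -
    have "conv (\<lambda>x. indicat_real A x *\<^sub>R c) (\<rho> m) x = c * conv (indicator A) (\<rho> m) x" for x
    proof -
      have "conv (\<lambda>x. indicat_real A x *\<^sub>R c) (\<rho> m) x = (LBINT y. c * (indicat_real A y * \<rho> m (x - y)))"
        unfolding conv_def by (intro Bochner_Integration.integral_cong) (auto simp: mult_ac)
      then show ?thesis by (simp add: conv_def)
    qed
    then have "\<bar>conv (\<lambda>x. indicat_real A x *\<^sub>R c) (\<rho> m) x - indicat_real A x *\<^sub>R c\<bar>
        = \<bar>c\<bar> * \<bar>conv (indicator A) (\<rho> m) x - indicator A x\<bar>" for x
      by (simp add: abs_mult[symmetric] right_diff_distrib mult.commute)
    then show ?thesis by simp
  qed
  ultimately show ?case by simp
next
  case (add f g)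
  have "(LBINT x. \<bar>conv (\<lambda>x. f x + g x) (\<rho> m) x - (f x + g x)\<bar>)
      \<le> (LBINT x. \<bar>conv f (\<rho> m) x - f x\<bar>) + (LBINT x. \<bar>conv g (\<rho> m) x - g x\<bar>)" for m
  proof -
    have fg: "integrable lborel (\<lambda>x. f x + g x)" using add.hyps by simp
    note ci = conv_integrable(1)[OF _ r]
    have "\<bar>conv (\<lambda>x. f x + g x) (\<rho> m) x - (f x + g x)\<bar> \<le> \<bar>conv f (\<rho> m) x - f x\<bar> + \<bar>conv g (\<rho> m) x - g x\<bar>" for x
    proof -
      note i = conv_integrand[OF loc_int_integrable mollifierD(1)[OF r], where x = x]
      show ?thesis using conv_add[OF i[OF add.hyps(1)] i[OF add.hyps(2)]] by simp
    qed
    then have "(LBINT x. \<bar>conv (\<lambda>x. f x + g x) (\<rho> m) x - (f x + g x)\<bar>)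
        \<le> (LBINT x. \<bar>conv f (\<rho> m) x - f x\<bar> + \<bar>conv g (\<rho> m) x - g x\<bar>)"
      using ci[OF add.hyps(1), of m] ci[OF add.hyps(2), of m] ci[OF fg, of m] add.hyps by (intro integral_mono) auto
    then show ?thesis using ci[OF add.hyps(1), of m] ci[OF add.hyps(2), of m] add.hyps by simp
  qed
  then show ?case
    by (intro tendsto_sandwich[OF _ _ tendsto_const tendsto_add[OF add.IH(1) add.IH(2), simplified]]) auto
next
  case (lim f s)
  have conv0: "(\<lambda>i. LBINT x. \<bar>f x - s i x\<bar>) \<longlonglongrightarrow> (LBINT x::real^'n. (0::real))"
  proof (rule integral_dominated_convergence[where w = "\<lambda>x. 3 * \<bar>f x\<bar>"])
    show "AE x in lborel. (\<lambda>i. \<bar>f x - s i x\<bar>) \<longlonglongrightarrow> 0"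
    proof (rule AE_I2)
      fix x
      have "(\<lambda>i. \<bar>f x - s i x\<bar>) \<longlonglongrightarrow> \<bar>f x - f x\<bar>"
        by (intro tendsto_rabs tendsto_diff tendsto_const lim.hyps(2)) simp
      then show "(\<lambda>i. \<bar>f x - s i x\<bar>) \<longlonglongrightarrow> 0" by simp
    qed
    show "AE x in lborel. norm \<bar>f x - s i x\<bar> \<le> 3 * \<bar>f x\<bar>" for i
    proof (rule AE_I2)
      fix x
      show "norm \<bar>f x - s i x\<bar> \<le> 3 * \<bar>f x\<bar>" using lim.hyps(3)[of x i] by simp
    qed
  qed (use lim.hyps(1,4) in auto)
  show ?case
  proof (rule tendsto_zero_approx)
    fix \<epsilon> :: real assume \<epsilon>: "0 < \<epsilon>"
    obtain i where i: "(LBINT x. \<bar>f x - s i x\<bar>) < \<epsilon> / 2"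
      using order_tendstoD(2)[OF conv0, of "\<epsilon> / 2"] \<epsilon> by (auto simp: eventually_sequentially)
    show "\<exists>F. F \<longlonglongrightarrow> 0 \<and> (\<forall>m. (LBINT x. \<bar>conv f (\<rho> m) x - f x\<bar>) \<le> F m + \<epsilon>)"
    proof (intro exI conjI allI)
      show "(\<lambda>m. LBINT x. \<bar>conv (s i) (\<rho> m) x - s i x\<bar>) \<longlonglongrightarrow> 0" by (rule lim.IH)
      show "(LBINT x. \<bar>conv f (\<rho> m) x - f x\<bar>) \<le> (LBINT x. \<bar>conv (s i) (\<rho> m) x - s i x\<bar>) + \<epsilon>" for m
        using mollify_err_stable[OF lim.hyps(4) lim.hyps(1) r, of m i] i by linarith
    qed
  qed simp
qed

text \<open>Truncation to a ball makes \<open>f\<close> integrable and does not change the mollified function on a ball whose radius is smaller by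
\<open>1\<close>. There a subsequence converges almost everywhere, and Fatou's lemma applies; then the balls exhaust the space.\<close>

lemma mollify_limit:
  assumes f: "loc_int f" and r: "\<And>m. mollifier (\<rho> m) (e m)" and e: "e \<longlonglongrightarrow> 0" "\<And>m. e m \<le> 1"
    and n: "\<And>m. norm_le s (conv f (\<rho> m)) B" and s: "0 < s"
  shows "norm_le s f B"
proof -
  have fm[measurable]: "f \<in> borel_measurable borel" by (rule loc_intD[OF f])
  have cm[measurable]: "conv f (\<rho> m) \<in> borel_measurable borel" for m by (rule norm_leD[OF n])
  have trunc: "norm_le s (\<lambda>x. indicator (cball 0 (real N)) x * f x) B" for N
  proof -
    let ?g = "\<lambda>x. indicator (cball 0 (real N + 1)) x * f x"
    have gi: "integrable lborel ?g" by (rule loc_intD[OF f])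
    note ci = conv_integrable(1)[OF gi r]
    have "\<exists>q. strict_mono q \<and> (AE x in lborel. (\<lambda>m. conv ?g (\<rho> (q m)) x - ?g x) \<longlonglongrightarrow> 0)"
    proof (rule tendsto_L1_AE_subseq)
      show "integrable lborel (\<lambda>x. conv ?g (\<rho> m) x - ?g x)" for m
        using ci[of m] gi by (intro Bochner_Integration.integrable_diff)
      show "(\<lambda>m. LBINT x. norm (conv ?g (\<rho> m) x - ?g x)) \<longlonglongrightarrow> 0"
        using mollify_L1[OF gi r e(1)] by simp
    qed
    then obtain q where q: "AE x in lborel. (\<lambda>m. conv ?g (\<rho> (q m)) x - ?g x) \<longlonglongrightarrow> 0" by blast
    show ?thesis
    proof (rule norm_le_limit[where F = "\<lambda>m x. indicator (cball 0 (real N)) x * conv f (\<rho> (q m)) x", OF _ _ _ tendsto_const s])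
      show "(\<lambda>x. indicator (cball 0 (real N)) x * f x) \<in> borel_measurable borel"
        by (intro borel_measurable_times borel_measurable_indicator fm) auto
      show "norm_le s (\<lambda>x. indicator (cball 0 (real N)) x * conv f (\<rho> (q m)) x) B" for m
        using norm_le_dominated[OF n[of "q m"], of "\<lambda>x. indicator (cball 0 (real N)) x * conv f (\<rho> (q m)) x" 1] s
        by (auto simp: indicator_def)
      show "AE x in lborel. (\<lambda>m. indicator (cball 0 (real N)) x * conv f (\<rho> (q m)) x)
          \<longlonglongrightarrow> indicator (cball 0 (real N)) x * f x"
        using q
      proof eventually_elim
        fix x assume x: "(\<lambda>m. conv ?g (\<rho> (q m)) x - ?g x) \<longlonglongrightarrow> 0"
        show "(\<lambda>m. indicator (cball 0 (real N)) x * conv f (\<rho> (q m)) x) \<longlonglongrightarrow> indicator (cball 0 (real N)) x * f x"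
        proof (cases "norm x \<le> real N")
          case True
          have "conv ?g (\<rho> (q m)) x = conv f (\<rho> (q m)) x" for m
          proof -
            have *: "?g y * \<rho> (q m) (x - y) = f y * \<rho> (q m) (x - y)" for y
            proof (cases "norm (x - y) \<le> e (q m)")
              case True': True
              have "norm y \<le> norm x + norm (x - y)"
                using norm_triangle_ineq4[of x "x - y"] by simp
              then have "norm y \<le> real N + 1" using True True' e(2)[of "q m"] by linarith
              then show ?thesis by simp
            qed (use mollifierD(4)[OF r] in auto)
            show ?thesis by (simp only: conv_def *)
          qed
          then have "(\<lambda>m. conv f (\<rho> (q m)) x - f x) \<longlonglongrightarrow> 0" using x True by simp
          then show ?thesis using True by (simp add: LIM_zero_iff)
        qed simp
      qed
    qed
  qed
  show ?thesis
  proof (rule norm_le_limit[where F = "\<lambda>N x. indicator (cball 0 (real N)) x * f x", OF fm trunc _ tendsto_const s])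
    have "(\<lambda>N. indicator (cball 0 (real N)) x * f x) \<longlonglongrightarrow> f x" for x
    proof (rule tendsto_eventually)
      obtain N0 where N0: "norm x \<le> real N0" using real_arch_simple[of "norm x"] by auto
      show "eventually (\<lambda>N. indicator (cball 0 (real N)) x * f x = f x) sequentially"
      proof (rule eventually_sequentiallyI)
        fix N assume "N0 \<le> N"
        then have "norm x \<le> real N" using N0 by (simp add: order_trans[of _ "real N0"])
        then show "indicator (cball 0 (real N)) x * f x = f x" by simp
      qed
    qed
    then show "AE x in lborel. (\<lambda>N. indicator (cball 0 (real N)) x * f x) \<longlonglongrightarrow> f x" by simp
  qed
qed

section \<open>Smoothness of mollified functions\<close>

lemma smooth_mean_value:
  fixes \<psi> :: "real^'n \<Rightarrow> real"
  assumes "smooth \<psi>"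
  obtains \<xi> where "0 < \<xi>" "\<xi> < 1" "\<psi> (x + h) - \<psi> x = (\<Sum>i\<in>UNIV. h $ i * partial i \<psi> (x + \<xi> *\<^sub>R h))"
proof -
  let ?D = "\<lambda>z h. \<Sum>i\<in>UNIV. h $ i * partial i \<psi> z"
  have "((\<lambda>\<tau>. \<psi> (x + \<tau> *\<^sub>R h)) has_real_derivative ?D (x + \<tau> *\<^sub>R h) h) (at \<tau>)" for \<tau>
  proof -
    have "((\<lambda>\<tau>. \<psi> (x + \<tau> *\<^sub>R h)) has_derivative (\<lambda>\<tau>'. ?D (x + \<tau> *\<^sub>R h) (\<tau>' *\<^sub>R h))) (at \<tau>)"
      by (rule has_derivative_compose[of "\<lambda>\<tau>. x + \<tau> *\<^sub>R h" _ \<tau> UNIV \<psi> "?D (x + \<tau> *\<^sub>R h)", simplified])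
        (auto intro!: derivative_eq_intros has_derivative_partials smooth_differentiable assms)
    moreover have "?D z (\<tau>' *\<^sub>R h) = ?D z h * \<tau>'" for z \<tau>'
      unfolding sum_distrib_right by (intro sum.cong) (simp_all add: mult_ac)
    ultimately show ?thesis by (simp add: has_field_derivative_def)
  qed
  then obtain \<xi> where "0 < \<xi>" "\<xi> < 1" "\<psi> (x + 1 *\<^sub>R h) - \<psi> (x + 0 *\<^sub>R h) = (1 - 0) * ?D (x + \<xi> *\<^sub>R h) h"
    using MVT2[of 0 1 "\<lambda>\<tau>. \<psi> (x + \<tau> *\<^sub>R h)" "\<lambda>\<tau>. ?D (x + \<tau> *\<^sub>R h) h"] by auto
  then show thesis using that by simp
qed

lemma gradient_sum_bound:
  fixes h :: "real^'n"
  assumes "\<And>i. \<bar>a i\<bar> \<le> M"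
  shows "\<bar>\<Sum>i\<in>UNIV. h $ i * a i\<bar> \<le> real CARD('n) * M * norm h"
proof -
  have "0 \<le> M" using assms[of undefined] by linarith
  have "\<bar>\<Sum>i\<in>UNIV. h $ i * a i\<bar> \<le> (\<Sum>i\<in>UNIV. \<bar>h $ i * a i\<bar>)" by (rule sum_abs)
  also have "\<dots> \<le> (\<Sum>i\<in>(UNIV :: 'n set). norm h * M)"
    unfolding abs_mult using assms by (intro sum_mono mult_mono component_le_norm_cart) auto
  finally show ?thesis by (simp add: mult_ac)
qed

text \<open>Taylor's formula with a remainder that is uniform in \<open>x\<close>, from two applications of the mean value theorem and the
boundedness of the second derivatives.\<close>

lemma test_function_quadratic_remainder:
  fixes \<psi> :: "real^'n \<Rightarrow> real"
  assumes \<psi>: "test_function \<psi>"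
  obtains L where "0 \<le> L" "\<And>x h. \<bar>\<psi> (x + h) - \<psi> x - (\<Sum>i\<in>UNIV. h $ i * partial i \<psi> x)\<bar> \<le> L * (norm h)\<^sup>2"
proof -
  let ?n = "real CARD('n)"
  have sm: "smooth \<psi>" "smooth (partial i \<psi>)" for i
    using \<psi> by (auto simp: test_function_iff intro: smooth_partial)
  define m where "m i j = (SOME M. \<forall>x. \<bar>partial j (partial i \<psi>) x\<bar> \<le> M)" for i j
  have m: "\<bar>partial j (partial i \<psi>) x\<bar> \<le> m i j" for i j x
  proof -
    have "test_function (partial j (partial i \<psi>))" using test_function_partials[OF \<psi>, of "[j, i]"] by simp
    then have "\<exists>M. \<forall>x. \<bar>partial j (partial i \<psi>) x\<bar> \<le> M" by (rule test_function_bounded) blast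
    then show ?thesis unfolding m_def by (rule someI_ex[THEN spec])
  qed
  define M where "M = (\<Sum>i\<in>UNIV. \<Sum>j\<in>UNIV. m i j)"
  have m0: "0 \<le> m i j" for i j using m[of j i 0] by linarith
  have mM: "m i j \<le> M" for i j
  proof -
    have "m i j \<le> (\<Sum>j\<in>UNIV. m i j)" using m0 by (intro member_le_sum) auto
    also have "\<dots> \<le> M" unfolding M_def using m0 by (intro member_le_sum[of i UNIV "\<lambda>i. \<Sum>j\<in>UNIV. m i j"] sum_nonneg) auto
    finally show ?thesis .
  qed
  have bd: "\<bar>partial j (partial i \<psi>) x\<bar> \<le> M" for i j x using m[of j i x] mM[of i j] by linarith
  have M0: "0 \<le> M" using bd[of undefined undefined 0] by linarith
  show thesis
  proof (rule that[of "?n * (?n * M)"])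
    show "0 \<le> ?n * (?n * M)" using M0 by simp
    fix x h :: "real^'n"
    obtain \<xi> where \<xi>: "0 < \<xi>" "\<xi> < 1" "\<psi> (x + h) - \<psi> x = (\<Sum>i\<in>UNIV. h $ i * partial i \<psi> (x + \<xi> *\<^sub>R h))"
      by (rule smooth_mean_value[OF sm(1)])
    have d: "\<bar>partial i \<psi> (x + \<xi> *\<^sub>R h) - partial i \<psi> x\<bar> \<le> ?n * M * norm h" for i
    proof -
      obtain \<zeta> where \<zeta>: "partial i \<psi> (x + \<xi> *\<^sub>R h) - partial i \<psi> x
          = (\<Sum>j\<in>UNIV. (\<xi> *\<^sub>R h) $ j * partial j (partial i \<psi>) (x + \<zeta> *\<^sub>R (\<xi> *\<^sub>R h)))"
        by (rule smooth_mean_value[OF sm(2)[of i], of x "\<xi> *\<^sub>R h"])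
      have "\<bar>partial i \<psi> (x + \<xi> *\<^sub>R h) - partial i \<psi> x\<bar> \<le> ?n * M * norm (\<xi> *\<^sub>R h)"
        unfolding \<zeta> by (rule gradient_sum_bound) (rule bd)
      also have "\<dots> \<le> ?n * M * norm h"
      proof (rule mult_left_mono)
        have "\<xi> * norm h \<le> 1 * norm h" using \<xi> by (intro mult_right_mono) auto
        then show "norm (\<xi> *\<^sub>R h) \<le> norm h" using \<xi> by simp
      qed (use M0 in simp)
      finally show ?thesis .
    qed
    have "\<psi> (x + h) - \<psi> x - (\<Sum>i\<in>UNIV. h $ i * partial i \<psi> x)
        = (\<Sum>i\<in>UNIV. h $ i * (partial i \<psi> (x + \<xi> *\<^sub>R h) - partial i \<psi> x))"
      using \<xi>(3) by (simp add: sum_subtractf right_diff_distrib)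
    then have "\<bar>\<psi> (x + h) - \<psi> x - (\<Sum>i\<in>UNIV. h $ i * partial i \<psi> x)\<bar> \<le> ?n * (?n * M * norm h) * norm h"
      using gradient_sum_bound[of "\<lambda>i. partial i \<psi> (x + \<xi> *\<^sub>R h) - partial i \<psi> x", OF d] by simp
    then show "\<bar>\<psi> (x + h) - \<psi> x - (\<Sum>i\<in>UNIV. h $ i * partial i \<psi> x)\<bar> \<le> ?n * (?n * M) * (norm h)\<^sup>2"
      by (simp add: power2_eq_square mult_ac)
  qed
qed

text \<open>The quadratic remainder is integrated against \<open>f\<close> over a ball that contains the supports of all integrands with
increments of norm at most \<open>1\<close>.\<close>

lemma conv_has_derivative:
  fixes f \<psi> :: "real^'n \<Rightarrow> real"
  assumes f: "loc_int f" and \<psi>: "test_function \<psi>"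
  shows "(conv f \<psi> has_derivative (\<lambda>h. \<Sum>i\<in>UNIV. h $ i * conv f (partial i \<psi>) x)) (at x)"
proof -
  let ?D = "\<lambda>h. \<Sum>i\<in>UNIV. h $ i * conv f (partial i \<psi>) x"
  have \<psi>i: "test_function (partial i \<psi>)" for i using test_function_partials[OF \<psi>, of "[i]"] by simp
  obtain L where L: "0 \<le> L" "\<And>x h. \<bar>\<psi> (x + h) - \<psi> x - (\<Sum>i\<in>UNIV. h $ i * partial i \<psi> x)\<bar> \<le> L * (norm h)\<^sup>2"
    by (rule test_function_quadratic_remainder[OF \<psi>]) (rule that)
  obtain B where B: "\<And>z. B < norm z \<Longrightarrow> \<psi> z = 0" using \<psi> by (auto simp: test_function_iff)
  have Bi: "partial i \<psi> z = 0" if "B < norm z" for i z using partials_support[of B \<psi> z "[i]"] B that by simp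
  let ?R = "B + 1 + norm x"
  define J where "J = (LBINT y. \<bar>indicator (cball 0 ?R) y * f y\<bar>)"
  note iR = loc_intD(2)[OF f, of ?R]
  have J0: "0 \<le> J" unfolding J_def by simp
  have est: "\<bar>conv f \<psi> (x + h) - conv f \<psi> x - ?D h\<bar> \<le> L * J * (norm h)\<^sup>2" if h: "norm h \<le> 1" for h
  proof -
    let ?r = "\<lambda>y. \<psi> (x - y + h) - \<psi> (x - y) - (\<Sum>i\<in>UNIV. h $ i * partial i \<psi> (x - y))"
    have i1: "integrable lborel (\<lambda>y. f y * \<psi> (x - y + h))"
      using conv_integrand[OF f \<psi>, of "x + h"] by (simp add: algebra_simps)
    have i2: "integrable lborel (\<lambda>y. f y * \<psi> (x - y))" by (rule conv_integrand[OF f \<psi>])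
    have i3: "integrable lborel (\<lambda>y. f y * partial i \<psi> (x - y))" for i by (rule conv_integrand[OF f \<psi>i])
    have eq: "f y * ?r y = f y * \<psi> (x - y + h) - f y * \<psi> (x - y) - (\<Sum>i\<in>UNIV. h $ i * (f y * partial i \<psi> (x - y)))" for y
      by (simp add: right_diff_distrib sum_distrib_left mult_ac)
    have ir: "integrable lborel (\<lambda>y. f y * ?r y)" unfolding eq using i1 i2 i3 by simp
    have c1: "conv f \<psi> (x + h) = (LBINT y. f y * \<psi> (x - y + h))"
      unfolding conv_def by (simp add: algebra_simps)
    have "(LBINT y. f y * ?r y) = conv f \<psi> (x + h) - conv f \<psi> x - ?D h"
      unfolding eq c1 using i1 i2 i3 by (simp add: conv_def)
    then have "\<bar>conv f \<psi> (x + h) - conv f \<psi> x - ?D h\<bar> \<le> (LBINT y. \<bar>f y * ?r y\<bar>)"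
      using integral_abs_bound[of lborel "\<lambda>y. f y * ?r y"] by simp
    also have "\<dots> \<le> (LBINT y. L * (norm h)\<^sup>2 * \<bar>indicator (cball 0 ?R) y * f y\<bar>)"
    proof (rule integral_mono)
      show "integrable lborel (\<lambda>y. \<bar>f y * ?r y\<bar>)" using ir by simp
      show "integrable lborel (\<lambda>y. L * (norm h)\<^sup>2 * \<bar>indicator (cball 0 ?R) y * f y\<bar>)"
        using iR by (intro integrable_mult_right integrable_abs)
      fix y
      show "\<bar>f y * ?r y\<bar> \<le> L * (norm h)\<^sup>2 * \<bar>indicator (cball 0 ?R) y * f y\<bar>"
      proof (cases "norm y \<le> ?R")
        case True
        have "\<bar>f y\<bar> * \<bar>?r y\<bar> \<le> \<bar>f y\<bar> * (L * (norm h)\<^sup>2)"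
          using L(2)[of "x - y" h] by (intro mult_left_mono) auto
        then show ?thesis using True by (simp add: abs_mult mult_ac)
      next
        case False
        have "norm y \<le> norm (x - y) + norm x" using norm_triangle_ineq4[of x "x - y"] by simp
        then have 1: "B + 1 < norm (x - y)" using False by linarith
        have "norm (x - y) \<le> norm (x - y + h) + norm h" using norm_triangle_ineq4[of "x - y + h" h] by simp
        then have 2: "B < norm (x - y + h)" using 1 h by linarith
        have "?r y = 0" using 1 2 B[of "x - y"] B[of "x - y + h"] Bi[of "x - y"] by simp
        then show ?thesis using L J0 by simp
      qed
    qed
    also have "\<dots> = L * J * (norm h)\<^sup>2" by (simp add: J_def)
    finally show ?thesis .
  qed
  show ?thesis
    unfolding has_derivative_at
  proof
    show "bounded_linear ?D"
      by (intro bounded_linear_sum bounded_linear_mult_const bounded_linear_vec_nth)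
    show "(\<lambda>h. norm (conv f \<psi> (x + h) - conv f \<psi> x - ?D h) / norm h) \<midarrow>0\<rightarrow> 0"
    proof (rule Lim_null_comparison)
      show "eventually (\<lambda>h. norm (norm (conv f \<psi> (x + h) - conv f \<psi> x - ?D h) / norm h) \<le> L * J * norm h) (at 0)"
        unfolding eventually_at
      proof (intro exI[of _ 1] conjI ballI impI)
        fix h :: "real^'n" assume "h \<noteq> 0 \<and> dist h 0 < 1"
        then have h: "0 < norm h" "norm h \<le> 1" by auto
        have "\<bar>conv f \<psi> (x + h) - conv f \<psi> x - ?D h\<bar> \<le> (L * J * norm h) * norm h"
          using est[OF h(2)] by (simp add: power2_eq_square mult_ac)
        then show "norm (norm (conv f \<psi> (x + h) - conv f \<psi> x - ?D h) / norm h) \<le> L * J * norm h"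
          using h(1) by (simp add: divide_le_eq)
      qed simp
      have "((\<lambda>h::real^'n. L * J * norm h) \<longlongrightarrow> L * J * norm (0::real^'n)) (at 0)"
        by (intro tendsto_mult tendsto_const tendsto_norm tendsto_ident_at)
      then show "((\<lambda>h::real^'n. L * J * norm h) \<longlongrightarrow> 0) (at 0)" by simp
    qed
  qed
qed

lemma partial_conv:
  fixes f \<psi> :: "real^'n \<Rightarrow> real"
  assumes f: "loc_int f" and \<psi>: "test_function \<psi>"
  shows "partial i (conv f \<psi>) = conv f (partial i \<psi>)"
proof
  fix x
  have "(\<Sum>j\<in>UNIV. (axis i 1 :: real^'n) $ j * conv f (partial j \<psi>) x) = conv f (partial i \<psi>) x"
    by (simp add: axis_def if_distrib[of "\<lambda>c. c * _"] cong: if_cong)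
  then show "partial i (conv f \<psi>) x = conv f (partial i \<psi>) x"
    using partial_eq_derivative[OF conv_has_derivative[OF f \<psi>, of x], of i] by simp
qed

lemma partials_conv:
  fixes f \<psi> :: "real^'n \<Rightarrow> real"
  assumes f: "loc_int f" and \<psi>: "test_function \<psi>"
  shows "partials is (conv f \<psi>) = conv f (partials is \<psi>)"
  by (induction "is") (simp_all add: partial_conv[OF f test_function_partials[OF \<psi>]])

lemma smooth_conv:
  fixes f \<psi> :: "real^'n \<Rightarrow> real"
  assumes f: "loc_int f" and \<psi>: "test_function \<psi>"
  shows "smooth (conv f \<psi>)"
  unfolding smooth_def partials_conv[OF f \<psi>]
  using conv_has_derivative[OF f test_function_partials[OF \<psi>]] by (auto simp: differentiable_def)

text \<open>The weak derivative is tested with the reflected and translated mollifier \<open>y \<mapsto> \<rho>(x - y)\<close>. Its derivatives carry the sign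
\<open>(-1)\<close> to the order, which cancels the sign in the definition of the weak derivative.\<close>

lemma conv_weak_derivative:
  fixes u v \<rho> :: "real^'n \<Rightarrow> real"
  assumes \<rho>: "test_function \<rho>"
    and weak: "\<And>\<phi>. test_function \<phi> \<Longrightarrow> (LBINT x. u x * partials is \<phi> x) = (- 1) ^ length is * (LBINT x. v x * \<phi> x)"
  shows "conv u (partials is \<rho>) = conv v \<rho>"
proof
  fix x
  let ?\<phi> = "\<lambda>y. \<rho> ((-1) *\<^sub>R y + x)"
  have sm: "smooth \<rho>" using \<rho> by (simp add: test_function_iff)
  have "test_function ?\<phi>" by (rule test_function_affine[OF \<rho>]) simp
  from weak[OF this]
  have "(LBINT y. u y * ((-1) ^ length is * partials is \<rho> ((-1) *\<^sub>R y + x))) = (- 1) ^ length is * (LBINT y. v y * ?\<phi> y)"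
    unfolding partials_affine[OF sm] .
  also have "(LBINT y. u y * ((-1) ^ length is * partials is \<rho> ((-1) *\<^sub>R y + x)))
      = (-1) ^ length is * (LBINT y. u y * partials is \<rho> (x - y))"
    by (simp add: mult.left_commute[of _ "(-1) ^ length is"])
  finally show "conv u (partials is \<rho>) x = conv v \<rho> x" by (simp add: conv_def)
qed

section \<open>Interpolation for Sobolev functions\<close>

text \<open>The index \<open>1/m\<close> of \<open>L\<^sup>m\<close>, with \<open>0\<close> for the exponent infinity.\<close>

definition recip :: "ennreal \<Rightarrow> real" where
  "recip m = (if m = top then 0 else 1 / enn2real m)"

lemma recip_bounds:
  assumes "1 \<le> m" shows "0 \<le> recip m" "recip m \<le> 1" "m < top \<Longrightarrow> 0 < recip m"
proof -
  have "1 \<le> enn2real m" if "m < top"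
    using enn2real_mono[OF assms, of] that by simp
  then show "0 \<le> recip m" "recip m \<le> 1" "m < top \<Longrightarrow> 0 < recip m"
    by (auto simp: recip_def top.not_eq_extremum divide_le_eq)
qed

lemma L_norm_finite:
  assumes m: "1 \<le> m" "m < top"
  shows "L_norm m f = (\<integral>\<^sup>+x. ennreal (\<bar>f x\<bar> powr (1 / recip m)) \<partial>lborel) epowr recip m"
proof -
  have p: "enn2real m \<noteq> 0" using recip_bounds(3)[OF m] by (auto simp: recip_def split: if_splits)
  show ?thesis
    using p m by (simp add: L_norm_def recip_def epowr_def nn_integral_completion)
qed

lemma borel_representative:
  fixes f :: "real^'n \<Rightarrow> real"
  assumes "f \<in> borel_measurable lebesgue"
  obtains g where "g \<in> borel_measurable borel" "AE x in lborel. f x = g x"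
  using completion_ex_borel_measurable_real[OF assms] by auto

lemma norm_le_L_norm:
  fixes f g :: "real^'n \<Rightarrow> real"
  assumes m: "1 \<le> m" and fin: "L_norm m f < top" and g: "g \<in> borel_measurable borel"
    and eq: "AE x in lborel. f x = g x"
  shows "norm_le (recip m) g (enn2real (L_norm m f))"
proof (cases "m = top")
  case True
  have "AE x in lebesgue. ennreal \<bar>f x\<bar> \<le> L_norm m f"
    using esssup_AE[where M = lebesgue and f = "\<lambda>x. ennreal \<bar>f x\<bar>"] True by (simp add: L_norm_def)
  then have "AE x in lborel. ennreal \<bar>f x\<bar> \<le> L_norm m f" by (simp add: AE_completion_iff)
  with eq have "AE x in lborel. \<bar>g x\<bar> \<le> enn2real (L_norm m f)"
  proof eventually_elim
    case (elim x)
    have "enn2real (ennreal \<bar>f x\<bar>) \<le> enn2real (L_norm m f)"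
      using elim(2) fin by (rule enn2real_mono)
    then show ?case using elim(1) by simp
  qed
  then show ?thesis using True g by (simp add: norm_le_def recip_def)
next
  case False
  then have mt: "m < top" by (simp add: top.not_eq_extremum)
  define s where "s = recip m"
  have s: "0 < s" using recip_bounds(3)[OF m mt] by (simp add: s_def)
  let ?I = "\<integral>\<^sup>+x. ennreal (\<bar>f x\<bar> powr (1 / s)) \<partial>lborel"
  have L: "L_norm m f = ?I epowr s" using L_norm_finite[OF m mt] by (simp add: s_def)
  have It: "?I < top" using fin s by (auto simp: L epowr_def top.not_eq_extremum split: if_splits)
  then have "ennreal (enn2real (L_norm m f) powr (1 / s)) = ?I"
    using s by (simp add: L epowr_def powr_powr)
  moreover have "(\<integral>\<^sup>+x. ennreal (\<bar>g x\<bar> powr (1 / s)) \<partial>lborel) = ?I"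
    using eq by (intro nn_integral_cong_AE) (auto elim: eventually_mono)
  ultimately show ?thesis using g s by (simp add: norm_le_def s_def[symmetric])
qed

lemma L_norm_le:
  fixes f g :: "real^'n \<Rightarrow> real"
  assumes m: "1 \<le> m" "m < top" and n: "norm_le (recip m) g B"
    and eq: "AE x in lborel. f x = g x"
  shows "L_norm m f \<le> ennreal B"
proof -
  define s where "s = recip m"
  have s: "0 < s" using recip_bounds(3)[OF m] by (simp add: s_def)
  have B: "0 \<le> B" by (rule norm_leD[OF n])
  let ?I = "\<integral>\<^sup>+x. ennreal (\<bar>f x\<bar> powr (1 / s)) \<partial>lborel"
  have "?I = (\<integral>\<^sup>+x. ennreal (\<bar>g x\<bar> powr (1 / s)) \<partial>lborel)"
    using eq by (intro nn_integral_cong_AE) (auto elim: eventually_mono)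
  then have I: "?I \<le> ennreal (B powr (1 / s))" using n s by (simp add: norm_le_def s_def[symmetric])
  then have "enn2real ?I \<le> B powr (1 / s)" by (intro enn2real_leI) auto
  then have "enn2real ?I powr s \<le> (B powr (1 / s)) powr s" using s by (intro powr_mono2) auto
  then have "enn2real ?I powr s \<le> B" using s B by (simp add: powr_powr)
  moreover have "?I \<noteq> top" using I by (auto simp: top_unique)
  ultimately show ?thesis
    unfolding L_norm_finite[OF m] s_def[symmetric] using s by (simp add: epowr_def ennreal_leI)
qed

lemma L_norm_cong_AE:
  fixes f g :: "real^'n \<Rightarrow> real"
  assumes f: "f \<in> borel_measurable lebesgue" and g: "g \<in> borel_measurable lebesgue"
    and eq: "AE x in lborel. \<bar>f x\<bar> = \<bar>g x\<bar>"
  shows "L_norm m f = L_norm m g"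
proof -
  have eq': "AE x in lebesgue. \<bar>f x\<bar> = \<bar>g x\<bar>" using eq by (simp add: AE_completion_iff)
  have "esssup lebesgue (\<lambda>x. ennreal \<bar>f x\<bar>) = esssup lebesgue (\<lambda>x. ennreal \<bar>g x\<bar>)"
    using eq' f g by (intro esssup_AE_cong) (auto elim: eventually_mono)
  moreover have "(\<integral>\<^sup>+x. ennreal \<bar>f x\<bar> epowr a \<partial>lebesgue) = (\<integral>\<^sup>+x. ennreal \<bar>g x\<bar> epowr a \<partial>lebesgue)" for a
    using eq' by (intro nn_integral_cong_AE) (auto elim: eventually_mono)
  ultimately show ?thesis by (simp add: L_norm_def)
qed

lemma loc_int_representative:
  fixes f g :: "real^'n \<Rightarrow> real"
  assumes f: "locally_integrable f" and g: "g \<in> borel_measurable borel" and eq: "AE x in lborel. f x = g x"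
  shows "loc_int g"
  unfolding loc_int_def
proof (intro conjI allI g)
  fix R
  have i: "integrable lebesgue (\<lambda>x. indicat_real (cball 0 R) x *\<^sub>R f x)"
    using f by (auto simp: locally_integrable_def set_integrable_def)
  have m: "(\<lambda>x. indicat_real (cball 0 R) x * g x) \<in> borel_measurable lborel"
    by (intro borel_measurable_times borel_measurable_indicator) (use g in auto)
  have "integrable lebesgue (\<lambda>x. indicat_real (cball 0 R) x * g x)"
  proof (rule integrable_cong_AE_imp[OF i])
    show "(\<lambda>x. indicat_real (cball 0 R) x * g x) \<in> borel_measurable lebesgue"
      using m by (rule measurable_completion)
    show "AE x in lebesgue. indicat_real (cball 0 R) x *\<^sub>R f x = indicat_real (cball 0 R) x * g x"
      unfolding AE_completion_iff using eq by eventually_elim simp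
  qed
  then show "integrable lborel (\<lambda>x. indicat_real (cball 0 R) x * g x)"
    using integrable_completion[OF m] by simp
qed

lemma integral_representative:
  fixes f g \<phi> :: "real^'n \<Rightarrow> real"
  assumes f: "f \<in> borel_measurable lebesgue" and g: "g \<in> borel_measurable borel" and eq: "AE x in lborel. f x = g x"
    and \<phi>: "\<phi> \<in> borel_measurable borel"
  shows "(LINT x|lebesgue. f x * \<phi> x) = (LBINT x. g x * \<phi> x)"
proof -
  have m: "(\<lambda>x. g x * \<phi> x) \<in> borel_measurable lborel" using g \<phi> by measurable
  have \<phi>': "\<phi> \<in> borel_measurable lebesgue" using \<phi> by (intro measurable_completion) simp
  have "(LINT x|lebesgue. f x * \<phi> x) = (LINT x|lebesgue. g x * \<phi> x)"
  proof (rule integral_cong_AE)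
    show "(\<lambda>x. f x * \<phi> x) \<in> borel_measurable lebesgue" using f \<phi>' by measurable
    show "(\<lambda>x. g x * \<phi> x) \<in> borel_measurable lebesgue" using m by (rule measurable_completion)
    show "AE x in lebesgue. f x * \<phi> x = g x * \<phi> x"
      unfolding AE_completion_iff using eq by eventually_elim simp
  qed
  then show ?thesis using integral_completion[OF m] by simp
qed

lemma mollifier_sequence:
  obtains \<rho> :: "nat \<Rightarrow> real^'n \<Rightarrow> real" and e where "\<And>m. mollifier (\<rho> m) (e m)" "e \<longlonglongrightarrow> 0" "\<And>m. e m \<le> 1"
proof -
  have "\<exists>\<rho> :: real^'n \<Rightarrow> real. mollifier \<rho> (inverse (real (Suc m)))" for m
    by (rule mollifier_exists[of "inverse (real (Suc m))"]) auto
  then obtain \<rho> :: "nat \<Rightarrow> real^'n \<Rightarrow> real" where \<rho>: "\<And>m. mollifier (\<rho> m) (inverse (real (Suc m)))" by metis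
  have "inverse (real (Suc m)) \<le> 1" for m by (simp add: inverse_eq_divide)
  then show thesis by (rule that[OF \<rho> LIMSEQ_inverse_real_of_nat])
qed

text \<open>The fundamental lemma of the calculus of variations: all mollifications of \<open>f - g\<close> vanish, so \<open>f - g\<close> has norm bound \<open>0\<close>.\<close>

lemma AE_eq_of_conv_eq:
  fixes f g :: "real^'n \<Rightarrow> real"
  assumes f: "loc_int f" and g: "loc_int g" and eq: "\<And>\<rho>. test_function \<rho> \<Longrightarrow> conv f \<rho> = conv g \<rho>"
  shows "AE x in lborel. f x = g x"
proof -
  obtain \<rho> :: "nat \<Rightarrow> real^'n \<Rightarrow> real" and e where \<rho>: "\<And>m. mollifier (\<rho> m) (e m)" "e \<longlonglongrightarrow> 0" "\<And>m. e m \<le> 1"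
    by (rule mollifier_sequence) (rule that)
  have fg: "loc_int (\<lambda>x. f x - g x)"
    unfolding loc_int_def using loc_intD[OF f] loc_intD[OF g] by (auto simp: right_diff_distrib)
  have "conv (\<lambda>x. f x - g x) (\<rho> m) = (\<lambda>x. 0)" for m
  proof
    fix x
    note i = conv_integrand[OF _ mollifierD(1)[OF \<rho>(1)], where x = x]
    show "conv (\<lambda>x. f x - g x) (\<rho> m) x = 0"
      using conv_diff[OF i[OF f] i[OF g]] eq[OF mollifierD(1)[OF \<rho>(1)]] by simp
  qed
  then have "norm_le 1 (conv (\<lambda>x. f x - g x) (\<rho> m)) 0" for m by (simp add: norm_le_zero)
  then have "norm_le 1 (\<lambda>x. f x - g x) 0"
    by (rule mollify_limit[OF fg \<rho>]) simp
  then have "(\<integral>\<^sup>+x. ennreal \<bar>f x - g x\<bar> \<partial>lborel) = 0"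
    by (simp add: norm_le_def)
  then have "AE x in lborel. ennreal \<bar>f x - g x\<bar> = 0"
    using loc_intD(1)[OF fg] by (subst (asm) nn_integral_0_iff_AE) auto
  then show ?thesis by eventually_elim simp
qed

lemma weak_partial_representatives:
  fixes u :: "real^'n \<Rightarrow> real"
  assumes u: "u \<in> sobolev k r"
  obtains U0 U where "loc_int U0" "AE x in lborel. u x = U0 x"
    "\<And>is. length is \<le> k \<Longrightarrow> loc_int (U is)"
    "\<And>is. length is \<le> k \<Longrightarrow> AE x in lborel. weak_partial is u x = U is x"
    "\<And>is \<rho>. length is \<le> k \<Longrightarrow> test_function \<rho> \<Longrightarrow> conv U0 (partials is \<rho>) = conv (U is) \<rho>"
proof -
  have um: "u \<in> borel_measurable lebesgue" using u by (auto simp: sobolev_def L_space_def)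
  obtain U0 where U0: "U0 \<in> borel_measurable borel" "AE x in lborel. u x = U0 x"
    by (rule borel_representative[OF um])
  have W: "has_weak_partial u is (weak_partial is u)" "weak_partial is u \<in> borel_measurable lebesgue"
    if "length is \<le> k" for "is"
  proof -
    have "\<exists>v. has_weak_partial u is v" using u that by (auto simp: sobolev_def)
    then show "has_weak_partial u is (weak_partial is u)" unfolding weak_partial_def by (rule someI_ex)
    show "weak_partial is u \<in> borel_measurable lebesgue" using u that by (auto simp: sobolev_def L_space_def)
  qed
  define U where "U is = (SOME g. g \<in> borel_measurable borel \<and> (AE x in lborel. weak_partial is u x = g x))" for "is"
  have U: "U is \<in> borel_measurable borel \<and> (AE x in lborel. weak_partial is u x = U is x)"
    if l: "length is \<le> k" for "is"
  proof -
    have "\<exists>g. g \<in> borel_measurable borel \<and> (AE x in lborel. weak_partial is u x = g x)"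
      using completion_ex_borel_measurable_real[OF W(2)[OF l]] by auto
    then show ?thesis unfolding U_def by (rule someI_ex)
  qed
  have L0: "loc_int U0"
    using W(1)[of "[]"] by (intro loc_int_representative[OF _ U0]) (auto simp: has_weak_partial_def)
  have L: "loc_int (U is)" if "length is \<le> k" for "is"
    using W(1)[OF that] U[OF that] by (intro loc_int_representative[of "weak_partial is u"]) (auto simp: has_weak_partial_def)
  have "conv U0 (partials is \<rho>) = conv (U is) \<rho>" if l: "length is \<le> k" and \<rho>: "test_function \<rho>" for "is" \<rho>
  proof (rule conv_weak_derivative[OF \<rho>])
    fix \<phi> :: "real^'n \<Rightarrow> real" assume \<phi>: "test_function \<phi>"
    have "(LINT x|lebesgue. u x * partials is \<phi> x) = (- 1) ^ length is * (LINT x|lebesgue. weak_partial is u x * \<phi> x)"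
      using W(1)[OF l] \<phi> by (auto simp: has_weak_partial_def)
    moreover have "(LINT x|lebesgue. u x * partials is \<phi> x) = (LBINT x. U0 x * partials is \<phi> x)"
      by (rule integral_representative[OF um U0 test_function_measurable[OF test_function_partials[OF \<phi>]]])
    moreover have "(LINT x|lebesgue. weak_partial is u x * \<phi> x) = (LBINT x. U is x * \<phi> x)"
      using U[OF l] by (intro integral_representative[OF W(2)[OF l]] test_function_measurable[OF \<phi>]) auto
    ultimately show "(LBINT x. U0 x * partials is \<phi> x) = (- 1) ^ length is * (LBINT x. U is x * \<phi> x)" by simp
  qed
  then show thesis using that[of U0 U] L0 U0(2) L U by blast
qed

lemma weak_partial_le_nabla_length:
  fixes u :: "real^'n \<Rightarrow> real"
  shows "length is = j \<Longrightarrow> \<bar>weak_partial is u x\<bar> \<le> nabla_length j u x"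
  unfolding nabla_length_def
  by (rule real_le_rsqrt) (simp add: member_le_sum[of "is" "{is. length is = j}" "\<lambda>is. (weak_partial is u x)\<^sup>2"] finite_lists_of_length)

text \<open>The Euclidean length is at most the sum of the absolute values of the components.\<close>

lemma nabla_length_norm_le:
  fixes u :: "real^'n \<Rightarrow> real"
  assumes U: "\<And>is. length is = j \<Longrightarrow> AE x in lborel. weak_partial is u x = U is x"
    and n: "\<And>is. length is = j \<Longrightarrow> norm_le s (U is) (b is)" and s: "0 < s" "s \<le> 1"
  shows "norm_le s (\<lambda>x. sqrt (\<Sum>is | length is = j. (U is x)\<^sup>2)) (\<Sum>is | length is = j. b is)"
    and "AE x in lborel. nabla_length j u x = sqrt (\<Sum>is | length is = j. (U is x)\<^sup>2)"
proof -
  have fin: "finite {is :: 'n list. length is = j}" by (rule finite_lists_of_length)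
  have Um[measurable]: "U is \<in> borel_measurable borel" if "length is = j" for "is" by (rule norm_leD[OF n[OF that]])
  have "norm_le s (\<lambda>x. \<Sum>is | length is = j. \<bar>U is x\<bar>) (\<Sum>is | length is = j. b is)"
  proof (intro norm_le_sum fin s)
    fix "is" :: "'n list" assume "is \<in> {is. length is = j}"
    then show "norm_le s (\<lambda>x. \<bar>U is x\<bar>) (b is)"
      using norm_le_dominated[OF n, of "is" "\<lambda>x. \<bar>U is x\<bar>" 1] s Um by simp
  qed
  then have "norm_le s (\<lambda>x. sqrt (\<Sum>is | length is = j. (U is x)\<^sup>2)) (1 * (\<Sum>is | length is = j. b is))"
  proof (rule norm_le_dominated)
    have "(\<lambda>x. \<Sum>is | length is = j. (U is x)\<^sup>2) \<in> borel_measurable borel"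
      using Um by (intro borel_measurable_sum borel_measurable_power) simp
    then show "(\<lambda>x. sqrt (\<Sum>is | length is = j. (U is x)\<^sup>2)) \<in> borel_measurable borel"
      by measurable
    show "AE x in lborel. \<bar>sqrt (\<Sum>is | length is = j. (U is x)\<^sup>2)\<bar> \<le> 1 * \<bar>\<Sum>is | length is = j. \<bar>U is x\<bar>\<bar>"
    proof (rule AE_I2)
      fix x
      have "sqrt (\<Sum>is | length is = j. (U is x)\<^sup>2) \<le> (\<Sum>is | length is = j. \<bar>U is x\<bar>)"
        using L2_set_le_sum_abs[of "\<lambda>is. U is x" "{is. length is = j}"] by (simp add: L2_set_def)
      then show "\<bar>sqrt (\<Sum>is | length is = j. (U is x)\<^sup>2)\<bar> \<le> 1 * \<bar>\<Sum>is | length is = j. \<bar>U is x\<bar>\<bar>"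
        by (simp add: sum_nonneg)
    qed
  qed (use s in auto)
  then show "norm_le s (\<lambda>x. sqrt (\<Sum>is | length is = j. (U is x)\<^sup>2)) (\<Sum>is | length is = j. b is)" by simp
  have "AE x in lborel. \<forall>is\<in>{is. length is = j}. weak_partial is u x = U is x"
    using U by (intro AE_finite_allI fin) auto
  then show "AE x in lborel. nabla_length j u x = sqrt (\<Sum>is | length is = j. (U is x)\<^sup>2)"
    by eventually_elim (simp add: nabla_length_def)
qed

lemma of_nat_divide_recip:
  assumes k: "0 < k" and m1: "1 \<le> m"
  shows "of_nat i / (of_nat k * m) = ennreal (real i / real k * recip m)"
proof (cases "m = top")
  case True
  then show ?thesis using k by (simp add: recip_def)
next
  case False
  have mp: "0 < enn2real m" using recip_bounds(3)[OF m1] False by (simp add: recip_def top.not_eq_extremum)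
  have m: "m = ennreal (enn2real m)" using False by (simp add: top.not_eq_extremum)
  have "of_nat k * m = ennreal (real k * enn2real m)"
    by (subst m) (simp add: ennreal_of_nat_eq_real_of_nat ennreal_mult)
  then have "of_nat i / (of_nat k * m) = ennreal (real i) / ennreal (real k * enn2real m)"
    by (simp add: ennreal_of_nat_eq_real_of_nat)
  also have "\<dots> = ennreal (real i / (real k * enn2real m))" using mp k by (intro divide_ennreal) auto
  finally show ?thesis using False by (simp add: recip_def)
qed

lemma inverse_eq_recip:
  assumes "1 \<le> m" shows "1 / m = ennreal (recip m)"
  using of_nat_divide_recip[OF zero_less_one assms, of 1] by simp

text \<open>For positive \<open>j\<close> the exponent \<open>p\<close> is finite, because \<open>r\<close> is; it is at least \<open>1\<close> as a weighted harmonic mean of exponents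
at least \<open>1\<close>.\<close>

lemma exponent_relation:
  fixes p q r :: ennreal and j k :: nat
  assumes "1 \<le> q" "1 \<le> r" "r < top" and j: "0 < j" "j < k"
    and eq: "1 / p = of_nat j / (of_nat k * r) + of_nat (k - j) / (of_nat k * q)"
  shows "1 \<le> p" "p < top" "recip p = real j / real k * recip r + (1 - real j / real k) * recip q"
proof -
  define \<sigma> where "\<sigma> = real j / real k * recip r + (1 - real j / real k) * recip q"
  have k: "0 < k" using j by simp
  note quot = of_nat_divide_recip[OF k]
  have rb: "0 < recip r" "recip r \<le> 1" "0 \<le> recip q" "recip q \<le> 1"
    using recip_bounds assms(1-3) by auto
  have \<theta>: "0 < real j / real k" "real j / real k \<le> 1" using j by auto
  have \<sigma>0: "0 < \<sigma>" unfolding \<sigma>_def using rb \<theta> by (intro add_pos_nonneg mult_pos_pos mult_nonneg_nonneg) auto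
  have "\<sigma> \<le> real j / real k * 1 + (1 - real j / real k) * 1"
    unfolding \<sigma>_def using rb \<theta> by (intro add_mono mult_left_mono) auto
  then have \<sigma>1: "\<sigma> \<le> 1" by simp
  have "real (k - j) / real k = 1 - real j / real k" using j by (simp add: of_nat_diff diff_divide_distrib)
  then have p\<sigma>: "1 / p = ennreal \<sigma>"
    unfolding eq quot[OF assms(1)] quot[OF assms(2)] \<sigma>_def using rb \<theta> by (subst ennreal_plus[symmetric]) auto
  have pt: "p \<noteq> top" using p\<sigma> \<sigma>0 by (auto simp: ennreal_eq_0_iff)
  have p0: "p \<noteq> 0" using p\<sigma> by (auto simp: divide_ennreal_def)
  have pp: "0 < enn2real p" using pt p0 by (simp add: enn2real_positive_iff top.not_eq_extremum zero_less_iff_neq_zero)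
  have pe: "p = ennreal (enn2real p)" using pt by (simp add: top.not_eq_extremum)
  have "ennreal (1 / enn2real p) = 1 / p"
    by (subst (2) pe) (use pp in \<open>simp add: divide_ennreal flip: ennreal_1\<close>)
  then have s: "1 / enn2real p = \<sigma>" using p\<sigma> \<sigma>0 pp by simp
  show "p < top" using pt by (simp add: top.not_eq_extremum)
  show "recip p = real j / real k * recip r + (1 - real j / real k) * recip q"
    using s pt by (simp add: recip_def \<sigma>_def)
  have "1 \<le> enn2real p" using s \<sigma>1 pp by (simp add: divide_le_eq flip: s)
  then show "1 \<le> p" by (subst pe) (simp flip: ennreal_1)
qed

text \<open>For order \<open>0\<close> the claim reduces to the fact that the weak derivative of order \<open>0\<close> is the function itself almost
everywhere.\<close>

lemma interpolation_order_0:
  fixes u :: "real^'n \<Rightarrow> real"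
  assumes u: "u \<in> sobolev k r"
  shows "L_norm q (nabla_length 0 u) = L_norm q u"
proof -
  obtain U0 U where U: "loc_int U0" "AE x in lborel. u x = U0 x"
    "\<And>is. length is \<le> k \<Longrightarrow> loc_int (U is)"
    "\<And>is. length is \<le> k \<Longrightarrow> AE x in lborel. weak_partial is u x = U is x"
    "\<And>is \<rho>. length is \<le> k \<Longrightarrow> test_function \<rho> \<Longrightarrow> conv U0 (partials is \<rho>) = conv (U is) \<rho>"
    by (rule weak_partial_representatives[OF u]) (rule that)
  have "AE x in lborel. U0 x = U [] x"
    using U(5)[of "[]"] by (intro AE_eq_of_conv_eq U(1,3)) auto
  with U(2) U(4)[of "[]"] have ae: "AE x in lborel. \<bar>nabla_length 0 u x\<bar> = \<bar>u x\<bar>"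
    by (auto simp: nabla_length_def elim!: eventually_elim2)
  have um: "u \<in> borel_measurable lebesgue" "weak_partial [] u \<in> borel_measurable lebesgue"
    using u by (auto simp: sobolev_def L_space_def)
  have "nabla_length 0 u = (\<lambda>x. \<bar>weak_partial [] u x\<bar>)" by (simp add: nabla_length_def fun_eq_iff)
  then show ?thesis using um ae by (intro L_norm_cong_AE) auto
qed

lemma interpolation_positive_order:
  fixes p q r :: ennreal and j k :: nat
  assumes q: "1 \<le> q" and r: "1 \<le> r" "r < top" and j: "0 < j" "j < k"
    and eq: "1 / p = of_nat j / (of_nat k * r) + of_nat (k - j) / (of_nat k * q)"
  shows "\<exists>C::real. C \<ge> 0 \<and>
    (\<forall>u :: real^'n \<Rightarrow> real. u \<in> L_space q \<inter> sobolev k r \<longrightarrow>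
      L_norm p (nabla_length j u) \<le>
        ennreal C * L_norm r (nabla_length k u) epowr (real j / real k)
                  * L_norm q u epowr (1 - real j / real k))"
proof -
  let ?s = "recip r" and ?t = "recip q" and ?\<theta> = "real j / real k"
  have st: "0 < ?s" "?s \<le> 1" "0 \<le> ?t" "?t \<le> 1" using recip_bounds[OF q] recip_bounds[OF r(1)] r by auto
  have \<theta>: "0 < ?\<theta>" "?\<theta> < 1" using j by auto
  note p = exponent_relation[OF q r j eq]
  obtain C where C: "0 \<le> C" "\<And>(w :: real^'n \<Rightarrow> real) b b0 is. smooth w \<Longrightarrow> (\<And>is. length is \<le> k \<Longrightarrow> norm_le ?s (partials is w) (b is)) \<Longrightarrow>
     norm_le ?t w b0 \<Longrightarrow> length is = j \<Longrightarrow>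
     norm_le (recip p) (partials is w) (C * ((\<Sum>is | length is = k. b is) powr ?\<theta> * b0 powr (1 - ?\<theta>)))"
    using smooth_interpolation[OF st j, where 'n = 'n] unfolding p(3) by blast
  define nk where "nk = real (card {is :: 'n list. length is = k})"
  define nj where "nj = real (card {is :: 'n list. length is = j})"
  let ?C = "nj * (C * nk powr ?\<theta>)"
  have "L_norm p (nabla_length j u) \<le>
        ennreal ?C * L_norm r (nabla_length k u) epowr ?\<theta> * L_norm q u epowr (1 - ?\<theta>)"
    if u: "u \<in> L_space q \<inter> sobolev k r" for u :: "real^'n \<Rightarrow> real"
  proof -
    obtain U0 U where U: "loc_int U0" "AE x in lborel. u x = U0 x"
      "\<And>is. length is \<le> k \<Longrightarrow> loc_int (U is)"
      "\<And>is. length is \<le> k \<Longrightarrow> AE x in lborel. weak_partial is u x = U is x"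
      "\<And>is \<rho>. length is \<le> k \<Longrightarrow> test_function \<rho> \<Longrightarrow> conv U0 (partials is \<rho>) = conv (U is) \<rho>"
      by (rule weak_partial_representatives[of u k r]) (use u in auto)
    obtain \<rho> :: "nat \<Rightarrow> real^'n \<Rightarrow> real" and e where \<rho>: "\<And>m. mollifier (\<rho> m) (e m)" "e \<longlonglongrightarrow> 0" "\<And>m. e m \<le> 1"
      by (rule mollifier_sequence) (rule that)
    note \<rho>t = mollifierD(1)[OF \<rho>(1)]
    have qfin: "L_norm q u < top" using u by (auto simp: L_space_def)
    define b0 where "b0 = enn2real (L_norm q u)"
    have n0: "norm_le ?t U0 b0"
      unfolding b0_def by (rule norm_le_L_norm[OF q qfin loc_intD(1)[OF U(1)] U(2)])
    define a where "a is = enn2real (L_norm r (weak_partial is u))" for "is"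
    have na: "norm_le ?s (U is) (a is)" if "length is \<le> k" for "is"
      unfolding a_def using u that
      by (intro norm_le_L_norm[OF r(1) _ loc_intD(1)[OF U(3)[OF that]] U(4)[OF that]]) (auto simp: sobolev_def L_space_def)
    define V where "V x = sqrt (\<Sum>is | length is = k. (U is x)\<^sup>2)" for x
    have V: "norm_le ?s V (\<Sum>is | length is = k. a is)" "AE x in lborel. nabla_length k u x = V x"
      unfolding V_def[abs_def] by (rule nabla_length_norm_le[of k u U ?s a]; use U(4) na st in simp)+
    \<comment> \<open>An infinite norm would be turned into the default value \<open>0\<close> of \<open>c\<close>.\<close>
    have rfin: "L_norm r (nabla_length k u) < top"
      using L_norm_le[OF r V] by (rule le_less_trans) simp
    define c where "c = enn2real (L_norm r (nabla_length k u))"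
    have nV: "norm_le ?s V c"
      unfolding c_def by (rule norm_le_L_norm[OF r(1) rfin norm_leD(2)[OF V(1)] V(2)])
    \<comment> \<open>For the top order the norm of \<open>nabla_length k u\<close> serves for each component; for lower orders any finite bound will do.\<close>
    define b where "b is = (if length is = k then c else a is)" for "is"
    have nb: "norm_le ?s (U is) (b is)" if l: "length is \<le> k" for "is"
    proof (cases "length is = k")
      case True
      have "norm_le ?s (U is) (1 * c)"
      proof (rule norm_le_dominated[OF nV loc_intD(1)[OF U(3)[OF l]]])
        show "AE x in lborel. \<bar>U is x\<bar> \<le> 1 * \<bar>V x\<bar>"
          using V(2) U(4)[OF l]
        proof eventually_elim
          case (elim x)
          then show ?case using weak_partial_le_nabla_length[OF True, of u x] by simp
        qed
      qed (use st in auto)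
      then show ?thesis using True by (simp add: b_def)
    qed (use na l in \<open>auto simp: b_def\<close>)
    let ?D = "C * ((nk * c) powr ?\<theta> * b0 powr (1 - ?\<theta>))"
    have sumb: "(\<Sum>is | length is = k. b is) = nk * c" by (simp add: b_def nk_def)
    have D: "norm_le (recip p) (U is) ?D" if l: "length is = j" for "is"
    proof (rule mollify_limit[OF U(3) \<rho>])
      show "length is \<le> k" using l j by simp
      show "0 < recip p" by (rule recip_bounds(3)[OF p(1,2)])
      fix m
      let ?w = "conv U0 (\<rho> m)"
      have sm: "smooth ?w" by (rule smooth_conv[OF U(1) \<rho>t])
      have pw: "partials js ?w = conv (U js) (\<rho> m)" if "length js \<le> k" for js
        using partials_conv[OF U(1) \<rho>t] U(5)[OF that \<rho>t] by simp
      have meas: "partials js ?w \<in> borel_measurable borel" for js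
        by (intro borel_measurable_continuous_onI smooth_continuous smooth_partials sm)
      have "norm_le (recip p) (partials is ?w) (C * ((\<Sum>is | length is = k. b is) powr ?\<theta> * b0 powr (1 - ?\<theta>)))"
      proof (rule C(2)[OF sm _ _ l])
        show "norm_le ?s (partials js ?w) (b js)" if "length js \<le> k" for js
          using mollify_norm_le[OF nb[OF that] U(3)[OF that] \<rho>(1)] st meas[of js] pw[OF that] by simp
        show "norm_le ?t ?w b0"
          using mollify_norm_le[OF n0 U(1) \<rho>(1)] st meas[of "[]"] by simp
      qed
      then show "norm_le (recip p) (conv (U is) (\<rho> m)) ?D"
        using pw[of "is"] l j by (simp add: sumb)
    qed
    have rp: "0 < recip p" "recip p \<le> 1" using recip_bounds[OF p(1)] p(2) by auto
    have Uj: "AE x in lborel. weak_partial is u x = U is x" if "length is = j" for "is"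
      using U(4)[of "is"] that j by simp
    have "L_norm p (nabla_length j u) \<le> ennreal (\<Sum>is :: 'n list | length is = j. ?D)"
      by (rule L_norm_le[OF p(1,2) nabla_length_norm_le[OF Uj D rp]])
    also have "(\<Sum>is :: 'n list | length is = j. ?D) = ?C * (c powr ?\<theta> * b0 powr (1 - ?\<theta>))"
      by (simp add: nj_def powr_mult)
    also have "ennreal \<dots> = ennreal ?C * (ennreal (c powr ?\<theta>) * ennreal (b0 powr (1 - ?\<theta>)))"
      using C(1) by (simp add: ennreal_mult nj_def)
    also have "ennreal (c powr ?\<theta>) = L_norm r (nabla_length k u) epowr ?\<theta>"
      using rfin j by (simp add: epowr_def c_def)
    also have "ennreal (b0 powr (1 - ?\<theta>)) = L_norm q u epowr (1 - ?\<theta>)"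
      using qfin j by (simp add: epowr_def b0_def)
    finally show ?thesis by (simp add: mult.assoc)
  qed
  moreover have "0 \<le> ?C" using C(1) by (simp add: nj_def)
  ultimately show ?thesis by blast
qed

theorem theorem1p2:
  fixes p q r :: ennreal and j k :: nat
  assumes "1 \<le> q"
    and "1 \<le> r" and "r < \<infinity>"
    and "j < k"
    and "1 / p = of_nat j / (of_nat k * r) + of_nat (k - j) / (of_nat k * q)"
  shows "\<exists>C::real. C \<ge> 0 \<and>
    (\<forall>u :: real^'n \<Rightarrow> real. u \<in> L_space q \<inter> sobolev k r \<longrightarrow>
      L_norm p (nabla_length j u) \<le>
        ennreal C * L_norm r (nabla_length k u) epowr (real j / real k)
                  * L_norm q u epowr (1 - real j / real k))"
proof (cases "j = 0")
  case False
  then show ?thesis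
    using interpolation_positive_order[OF assms(1,2) _ _ assms(4,5)] assms(3) by (simp add: top.not_eq_extremum)
next
  case True
  have "p = q"
  proof -
    have "1 / p = of_nat k / (of_nat k * q)" using assms(5) True by simp
    also have "\<dots> = 1 / q"
      using of_nat_divide_recip[of k q k] inverse_eq_recip[of q] assms(1,4) by simp
    finally show ?thesis by (metis one_divide_one_divide_ennreal)
  qed
  have "L_norm p (nabla_length j u) \<le> ennreal 1 * L_norm r (nabla_length k u) epowr (real j / real k)
      * L_norm q u epowr (1 - real j / real k)" if "u \<in> L_space q \<inter> sobolev k r" for u :: "real^'n \<Rightarrow> real"
  proof -
    have "L_norm p (nabla_length j u) = L_norm q u"
      using interpolation_order_0[of u k r q] that True \<open>p = q\<close> by simp
    also have "\<dots> = L_norm q u epowr 1" by (simp add: epowr_def top.not_eq_extremum)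
    finally show ?thesis using True by (simp add: epowr_def)
  qed
  then show ?thesis by (intro exI[of _ 1]) auto
qed

end
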